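(* Let $Y$ be a random simplicial complex on the vertex set $[n]=\{0,1,\dots,n\}$ drawn from the upper model with probability parameters $\{p_\sigma\}$ satisfying $0<p\le p_\sigma\le P<1$ for all $\sigma$, where $p=e^{-a}$ and $P=e^{-A}$ are constants independent of $n$ (the medial regime). Define the dual numbers $0<a'\le A'$ by $e^{-a}+e^{-a'}=1=e^{-A}+e^{-A'}$, and for $y>0$ put $\beta(n,y)=\log_2\ln n+\log_2\log_2\ln n-\log_2 y$. Then, with probability tending to $1$ as $n\to\infty$: (1) $\dim Y=n-1$; (2) for any fixed constant $\epsilon_0>0$, the maximal integer $d$ such that $Y$ contains the $(n-d)$-dimensional skeleton $\Delta_n^{(n-d)}$ of the simplex $\Delta_n$ satisfies $\lfloor\beta(n,A')\rfloor+1\le d\le \beta(n,a')+1+\epsilon_0$; (3) if the system of probability parameters is homogeneous, then for any fixed constants $\epsilon_0,\delta_0>0$ the reduced Betti numbers $b_j(Y)$ vanish for all $j$ except possibly those with $\log_2\ln n-\log_2 A'+1-\delta_0< n-j\le \beta(n,a')+1+\epsilon_0$.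
   Context: Upper model: for each non-empty proper subset $\sigma\subsetneq[n]$ (a simplex of dimension $|\sigma|-1$) a probability parameter $p_\sigma\in[0,1]$ is given. A random hypergraph $X$ is formed by including each non-empty proper subset $\sigma\subsetneq[n]$ independently with probability $p_\sigma$. The upper random simplicial complex $Y$ is the smallest simplicial complex containing $X$: $\sigma\in Y$ iff some $\tau\supseteq\sigma$ lies in $X$. $\Delta_n$ denotes the simplex on $[n]$ (all non-empty subsets of $[n]$) and $\Delta_n^{(k)}$ its $k$-skeleton. Homogeneous: $p_\sigma=p_{\sigma'}$ whenever $\dim\sigma=\dim\sigma'$.
   Formalization: In (2), "the maximal integer d" is corrected to the minimal integer d such that Y contains the (n-d)-skeleton (the largest skeleton contained): containment persists as d grows, so no maximal d exists, and the stated upper bound would fail. *)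

theory Defs
  imports Complex_Main "HOL-Library.Function_Algebras"
begin

definition simps :: "nat \<Rightarrow> nat set set" where
  "simps n = {\<sigma>. \<sigma> \<subseteq> {0..n} \<and> \<sigma> \<noteq> {} \<and> \<sigma> \<noteq> {0..n}}"

definition upper_closure :: "nat set set \<Rightarrow> nat set set" where
  "upper_closure X = {\<sigma>. \<sigma> \<noteq> {} \<and> (\<exists>\<tau>\<in>X. \<sigma> \<subseteq> \<tau>)}"

text \<open>Probability, in the upper model with parameters q on [n], that the
  random complex Y = upper_closure X satisfies E. X contains each non-empty
  proper subset \<sigma> of [n] independently with probability q \<sigma>.\<close>
definition upper_prob :: "nat \<Rightarrow> (nat set \<Rightarrow> real) \<Rightarrow> (nat set set \<Rightarrow> bool) \<Rightarrow> real" where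
  "upper_prob n q E =
     (\<Sum>X\<in>Pow (simps n).
        (\<Prod>\<sigma>\<in>X. q \<sigma>) * (\<Prod>\<sigma>\<in>simps n - X. 1 - q \<sigma>) * (if E (upper_closure X) then 1 else 0))"

definition homogeneous :: "nat \<Rightarrow> (nat set \<Rightarrow> real) \<Rightarrow> bool" where
  "homogeneous n q \<longleftrightarrow>
     (\<forall>\<sigma>\<in>simps n. \<forall>\<sigma>'\<in>simps n. card \<sigma> = card \<sigma>' \<longrightarrow> q \<sigma> = q \<sigma>')"

definition cdim :: "nat set set \<Rightarrow> int" where
  "cdim Y = (if Y = {} then -1 else int (Max (card ` Y)) - 1)"

definition skeleton :: "nat \<Rightarrow> int \<Rightarrow> nat set set" where
  "skeleton n k = {\<sigma>. \<sigma> \<subseteq> {0..n} \<and> \<sigma> \<noteq> {} \<and> int (card \<sigma>) \<le> k + 1}"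

text \<open>The least d such that Y contains the (n-d)-skeleton of the simplex on [n]
  (equivalently n minus the largest k with skeleton n k contained in Y).\<close>
definition skel_defect :: "nat \<Rightarrow> nat set set \<Rightarrow> int" where
  "skel_defect n Y = int n - Max {k::int. -1 \<le> k \<and> k \<le> int n \<and> skeleton n k \<subseteq> Y}"

text \<open>Chains are functions from vertex sets to the reals; a j-chain of Y is
  supported on the j-simplices of the augmented complex Y \<union> {{}}
  (the empty simplex in degree -1 gives reduced homology).\<close>

definition rscale :: "real \<Rightarrow> (nat set \<Rightarrow> real) \<Rightarrow> (nat set \<Rightarrow> real)" where
  "rscale r c = (\<lambda>\<sigma>. r * c \<sigma>)"

definition faces_of_dim :: "nat set set \<Rightarrow> int \<Rightarrow> nat set set" where
  "faces_of_dim Y j = {\<sigma>. \<sigma> \<in> Y \<union> {{}} \<and> int (card \<sigma>) = j + 1}"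

definition chains :: "nat set set \<Rightarrow> int \<Rightarrow> (nat set \<Rightarrow> real) set" where
  "chains Y j = {c. \<forall>\<sigma>. c \<sigma> \<noteq> 0 \<longrightarrow> \<sigma> \<in> faces_of_dim Y j}"

text \<open>Boundary: for \<sigma> = {v_0 < ... < v_k}, d \<sigma> = \<Sum>_i (-1)^i (\<sigma> - {v_i}).
  Dually, (d c)(\<tau>) = \<Sum>_{v \<notin> \<tau>, \<tau> \<union> {v} \<in> Y} (-1)^(#{u\<in>\<tau>. u < v}) c(\<tau> \<union> {v}).\<close>
definition bdry :: "nat set set \<Rightarrow> (nat set \<Rightarrow> real) \<Rightarrow> (nat set \<Rightarrow> real)" where
  "bdry Y c = (\<lambda>\<tau>. if \<tau> \<in> Y \<union> {{}} \<and> finite \<tau> then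
       (\<Sum>v\<in>{v. v \<notin> \<tau> \<and> insert v \<tau> \<in> Y}.
          (-1) ^ card {u\<in>\<tau>. u < v} * c (insert v \<tau>))
     else 0)"

definition reduced_betti :: "nat set set \<Rightarrow> int \<Rightarrow> nat" where
  "reduced_betti Y j =
     vector_space.dim rscale {c \<in> chains Y j. bdry Y c = 0}
     - vector_space.dim rscale (bdry Y ` chains Y (j + 1))"

definition beta :: "nat \<Rightarrow> real \<Rightarrow> real" where
  "beta n y = log 2 (ln (real n)) + log 2 (log 2 (ln (real n))) - log 2 y"

end

theory Submission
  imports Defs "HOL-Analysis.Convex" "HOL-Real_Asymp.Real_Asymp"
begin

text \<open>Pass to the Alexander dual: with \<open>G\<close> the set of \<open>T\<close> whose complement is not in \<open>X\<close>, the complement of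
  a set \<open>S\<close> is missing from \<open>Y\<close> iff every non-empty subset of \<open>S\<close> lies in \<open>G\<close>, which for \<open>card S = m\<close> has
  probability between \<open>exp (- A' (2^m - 1))\<close> and \<open>exp (- a' (2^m - 1))\<close>. A union bound gives the
  dimension and the upper bound on the skeleton defect, and a second moment computation gives the lower bound.

  A full skeleton kills the homology in low degrees by coning. In high degrees, the homology of \<open>Y\<close> is
  the cohomology of the lower complex dual to it, which vanishes by Garland's method as soon as all
  degrees of faces exceed a multiple of the second eigenvalues of the links. In the homogeneous case
  the links are Erdos-Renyi graphs on random vertex sets. Their degrees are controlled by a Chernoff
  bound, and the eigenvalues by the trace of a high power (of order \<open>log log n\<close>) of the centred adjacency
  matrix: the expected degree is a positive power of \<open>n\<close>, so this beats the union bound over all links.\<close>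

section \<open>Expectations over a random subset\<close>

text \<open>The expected number of dual faces with \<open>m\<close> vertices is about
  \<open>n^m exp (- y 2^m)\<close>, \<open>y\<close> between \<open>a'\<close> and
  \<open>A'\<close>. It turns from large to small near \<open>y 2^m = m ln n\<close>, where
  \<open>m\<close> is close to \<open>log_2 ln n\<close>; putting this value for \<open>m\<close> on
  the right and solving gives \<open>beta n y\<close>. In high degrees the scale is
  \<open>l = n - j - 1\<close>. A dual face with \<open>l\<close> vertices has on average at least
  about \<open>n exp (- A' 2^l)\<close> cofaces, which is at least \<open>n^c\<close> with
  \<open>c = 1 - 2^(- delta)\<close> as long as \<open>2^l <= 2^(- delta) ln n / A'\<close>. The
  graph in the link of a face with one vertex less has the same mean degree, so its second
  eigenvalue should be of the order of the square root, far below the degree divided by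
  \<open>l\<close>, which is what Garland's method needs. The obstacle is the number of links, up to
  \<open>n^l\<close> with \<open>l\<close> unbounded: one link may fail only with probability below
  every fixed power of \<open>n\<close>. This fixes the power \<open>s\<close> of the matrix:
  \<open>(n^c)^s\<close> has to exceed \<open>n^l\<close> by some further powers of
  \<open>n\<close>, so \<open>s\<close> is proportional to \<open>l / c\<close>, while counting the
  walks costs only \<open>exp (O ((ln ln n)^2))\<close>. Eigenvalues never occur; all bounds are on
  quadratic forms.\<close>

definition expect :: "'a set \<Rightarrow> ('a \<Rightarrow> real) \<Rightarrow> ('a set \<Rightarrow> real) \<Rightarrow> real" where
  "expect S r F = (\<Sum>G\<in>Pow S. (\<Prod>x\<in>G. r x) * (\<Prod>x\<in>S - G. 1 - r x) * F G)"

definition depends :: "'a set \<Rightarrow> ('a set \<Rightarrow> 'b) \<Rightarrow> bool" where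
  "depends A F \<longleftrightarrow> (\<forall>G. F G = F (G \<inter> A))"

lemma expect_empty [simp]: "expect {} r F = F {}"
  by (simp add: expect_def)

text \<open>Conditioning on whether \<open>x\<close> is chosen; this recursion drives the inductions
  over the ground set below.\<close>

lemma expect_insert:
  assumes "finite S" "x \<notin> S"
  shows "expect (insert x S) r F = r x * expect S r (\<lambda>G. F (insert x G)) + (1 - r x) * expect S r F"
proof -
  have d: "Pow S \<inter> insert x ` Pow S = {}" using assms by auto
  have inj: "inj_on (insert x) (Pow S)" using assms by (auto simp: inj_on_def)
  have 1: "(\<Prod>y\<in>insert x S - G. 1 - r y) = (1 - r x) * (\<Prod>y\<in>S - G. 1 - r y)" if "G \<subseteq> S" for G
  proof -
    have "insert x S - G = insert x (S - G)" using assms that by auto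
    thus ?thesis using assms by simp
  qed
  have 2: "(\<Prod>y\<in>insert x G. r y) = r x * (\<Prod>y\<in>G. r y)" "insert x S - insert x G = S - G" if "G \<subseteq> S" for G
  proof -
    have "x \<notin> G" "finite G" using assms that finite_subset by auto
    thus "(\<Prod>y\<in>insert x G. r y) = r x * (\<Prod>y\<in>G. r y)" by simp
  qed (use assms that in auto)
  show ?thesis
    unfolding expect_def Pow_insert
    using assms d
    by (subst sum.union_disjoint)
       (auto simp: sum.reindex[OF inj] 1 2 sum_distrib_left algebra_simps intro!: sum.cong)
qed

lemma expect_cong:
  assumes "\<And>G. G \<subseteq> S \<Longrightarrow> F G = H G"
  shows "expect S r F = expect S r H"
  unfolding expect_def by (intro sum.cong) (auto simp: assms)

lemma expect_add: "expect S r (\<lambda>G. F G + H G) = expect S r F + expect S r H"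
  by (simp add: expect_def sum.distrib algebra_simps)

lemma expect_diff: "expect S r (\<lambda>G. F G - H G) = expect S r F - expect S r H"
  by (simp add: expect_def sum_subtractf algebra_simps)

lemma expect_cmult: "expect S r (\<lambda>G. c * F G) = c * expect S r F"
  by (simp add: expect_def sum_distrib_left algebra_simps)

lemma expect_sum: "expect S r (\<lambda>G. \<Sum>i\<in>I. F i G) = (\<Sum>i\<in>I. expect S r (F i))"
  unfolding expect_def by (subst sum.swap) (simp add: sum_distrib_left)

lemma expect_const [simp]:
  assumes "finite S" shows "expect S r (\<lambda>_. c) = c"
  using assms by (induction S) (simp_all add: expect_insert algebra_simps)

lemma expect_mono:
  assumes "\<And>x. x \<in> S \<Longrightarrow> 0 \<le> r x \<and> r x \<le> 1" and "\<And>G. G \<subseteq> S \<Longrightarrow> F G \<le> H G"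
  shows "expect S r F \<le> expect S r H"
  unfolding expect_def using assms
  by (intro sum_mono mult_left_mono mult_nonneg_nonneg prod_nonneg) auto

text \<open>Independence. A new element \<open>x\<close> lies outside \<open>A\<close> or outside
  \<open>B\<close>, so at least one of the two factors does not notice it, and the induction
  hypothesis applies to both branches of the conditioning.\<close>

lemma expect_depends_mult:
  assumes "finite S" "depends A F" "depends B H" "A \<inter> B = {}"
  shows "expect S r (\<lambda>G. F G * H G) = expect S r F * expect S r H"
  using assms(1,2,3)
proof (induction S arbitrary: F H rule: finite_induct)
  case (insert x S)
  have dF: "depends A (\<lambda>G. F (insert x G))"
    unfolding depends_def
  proof
    fix G
    have "F (insert x G) = F (insert x G \<inter> A)" "F (insert x (G \<inter> A)) = F (insert x (G \<inter> A) \<inter> A)"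
      using insert.prems by (auto simp: depends_def)
    moreover have "insert x G \<inter> A = insert x (G \<inter> A) \<inter> A" by auto
    ultimately show "F (insert x G) = F (insert x (G \<inter> A))" by simp
  qed
  have dH: "depends B (\<lambda>G. H (insert x G))"
    unfolding depends_def
  proof
    fix G
    have "H (insert x G) = H (insert x G \<inter> B)" "H (insert x (G \<inter> B)) = H (insert x (G \<inter> B) \<inter> B)"
      using insert.prems by (auto simp: depends_def)
    moreover have "insert x G \<inter> B = insert x (G \<inter> B) \<inter> B" by auto
    ultimately show "H (insert x G) = H (insert x (G \<inter> B))" by simp
  qed
  note IH = insert.IH[OF insert.prems] insert.IH[OF dF dH] 
  show ?case
  proof (cases "x \<in> A")
    case True
    hence "x \<notin> B" using assms(4) by auto
    hence "H (insert x G) = H G" for G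
      using insert.prems(2) by (metis Int_insert_left depends_def)
    thus ?thesis using insert.hyps IH by (simp add: expect_insert algebra_simps)
  next
    case False
    hence "F (insert x G) = F G" for G
      using insert.prems(1) by (metis Int_insert_left depends_def)
    thus ?thesis using insert.hyps IH by (simp add: expect_insert algebra_simps)
  qed
qed (auto)

lemma depends_prod:
  assumes "\<And>i. i \<in> I \<Longrightarrow> depends (B i) (F i)" "\<And>i. i \<in> I \<Longrightarrow> B i \<subseteq> A"
  shows "depends A (\<lambda>G. \<Prod>i\<in>I. F i G :: real)"
  unfolding depends_def
proof
  fix G
  have "F i G = F i (G \<inter> A)" if "i \<in> I" for i
  proof -
    have "F i G = F i (G \<inter> B i)" "F i (G \<inter> A) = F i (G \<inter> A \<inter> B i)" using assms(1)[OF that] by (auto simp: depends_def)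
    moreover have "G \<inter> A \<inter> B i = G \<inter> B i" using assms(2)[OF that] by auto
    ultimately show ?thesis by simp
  qed
  thus "(\<Prod>i\<in>I. F i G) = (\<Prod>i\<in>I. F i (G \<inter> A))" by simp
qed

lemma expect_prod:
  assumes "finite S" "finite I" "\<And>i. i \<in> I \<Longrightarrow> depends (B i) (F i)"
    and "\<And>i j. i \<in> I \<Longrightarrow> j \<in> I \<Longrightarrow> i \<noteq> j \<Longrightarrow> B i \<inter> B j = {}"
  shows "expect S r (\<lambda>G. \<Prod>i\<in>I. F i G) = (\<Prod>i\<in>I. expect S r (F i))"
  using assms(2,3,4)
proof (induction I rule: finite_induct)
  case (insert i I)
  have "depends (\<Union>i\<in>I. B i) (\<lambda>G. \<Prod>i\<in>I. F i G)"
    by (rule depends_prod[of _ B]) (use insert.prems in auto)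
  moreover have "B i \<inter> (\<Union>i\<in>I. B i) = {}" using insert.prems(2) insert.hyps by auto
  ultimately show ?case
    using insert expect_depends_mult[OF assms(1), of "B i" "F i" "\<Union>i\<in>I. B i"]
    by simp
qed (use assms(1) in simp)

lemma expect_subset:
  assumes "finite S" "A \<subseteq> S"
  shows "expect S r (\<lambda>G. of_bool (A \<subseteq> G)) = (\<Prod>x\<in>A. r x)"
  using assms
proof (induction S arbitrary: A rule: finite_induct)
  case (insert x S)
  show ?case
  proof (cases "x \<in> A")
    case True
    have "expect S r (\<lambda>G. of_bool (A \<subseteq> insert x G)) = expect S r (\<lambda>G. of_bool (A - {x} \<subseteq> G))"
      by (intro expect_cong) auto
    also have "\<dots> = (\<Prod>y\<in>A - {x}. r y)" using insert by (intro insert.IH) auto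
    finally have 1: "expect S r (\<lambda>G. of_bool (A \<subseteq> insert x G)) = (\<Prod>y\<in>A - {x}. r y)" .
    have 2: "expect S r (\<lambda>G. of_bool (A \<subseteq> G)) = expect S r (\<lambda>G. 0)"
      using True insert.hyps by (intro expect_cong) auto
    have "finite A" using insert finite_subset by blast
    hence "(\<Prod>y\<in>A. r y) = r x * (\<Prod>y\<in>A - {x}. r y)" using True by (simp add: prod.remove)
    thus ?thesis using insert.hyps 1 2 by (simp add: expect_insert)
  next
    case False
    have "expect S r (\<lambda>G. of_bool (A \<subseteq> insert x G)) = expect S r (\<lambda>G. of_bool (A \<subseteq> G))"
      using False by (intro expect_cong) auto
    thus ?thesis using False insert by (simp add: expect_insert algebra_simps subset_insert)
  qed
qed auto

text \<open>Chosen and unchosen elements exchange their roles, hence the parameter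
  \<open>1 - r x\<close>. With \<open>h\<close> the complement of vertex sets this is the passage
  from \<open>X\<close> to the dual family \<open>G\<close>.\<close>

lemma expect_reindex:
  assumes "bij_betw h S S'" "finite S" "\<And>x. x \<in> S \<Longrightarrow> q (h x) = 1 - r x"
  shows "expect S' q F = expect S r (\<lambda>G. F (h ` (S - G)))"
proof -
  let ?c = "\<lambda>G. h ` (S - G)"
  have inj: "inj_on h S" and im: "h ` S = S'" using assms(1) by (auto simp: bij_betw_def)
  have b: "bij_betw ?c (Pow S) (Pow S')"
  proof (rule bij_betw_byWitness[where f' = "\<lambda>X. S - (h -` X)"])
    show "\<forall>a\<in>Pow S. S - h -` h ` (S - a) = a" using inj by (auto simp: inj_on_def)
    show "\<forall>a'\<in>Pow S'. h ` (S - (S - h -` a')) = a'" using im by auto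
  qed (use im in auto)
  show ?thesis unfolding expect_def
    unfolding sum.reindex_bij_betw[OF b, symmetric]
  proof (intro sum.cong refl)
    fix G assume "G \<in> Pow S"
    hence G: "G \<subseteq> S" by auto
    have 1: "(\<Prod>x\<in>h ` (S - G). q x) = (\<Prod>x\<in>S - G. 1 - r x)"
      using inj assms(3) by (subst prod.reindex) (auto intro: inj_on_subset)
    have "S' - h ` (S - G) = h ` G" using inj im G by (auto simp: inj_on_def)
    hence 2: "(\<Prod>x\<in>S' - h ` (S - G). 1 - q x) = (\<Prod>x\<in>G. r x)"
      using inj assms(3) G by (simp, subst prod.reindex) (auto intro: inj_on_subset intro!: prod.cong)
    show "(\<Prod>x\<in>h ` (S - G). q x) * (\<Prod>x\<in>S' - h ` (S - G). 1 - q x) * F (h ` (S - G))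
        = (\<Prod>x\<in>G. r x) * (\<Prod>x\<in>S - G. 1 - r x) * F (h ` (S - G))"
      by (simp add: 1 2)
  qed
qed

section \<open>Probabilities of events, union bound and Markov's inequality\<close>

definition prob :: "'a set \<Rightarrow> ('a \<Rightarrow> real) \<Rightarrow> ('a set \<Rightarrow> bool) \<Rightarrow> real" where
  "prob S r E = expect S r (\<lambda>G. of_bool (E G))"

locale bernoulli_family =
  fixes S :: "'a set" and r :: "'a \<Rightarrow> real"
  assumes finite_S [simp]: "finite S" and r_range: "\<And>x. x \<in> S \<Longrightarrow> 0 \<le> r x \<and> r x \<le> 1"
begin

lemma prob_mono: "(\<And>G. G \<subseteq> S \<Longrightarrow> E G \<Longrightarrow> E' G) \<Longrightarrow> prob S r E \<le> prob S r E'"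
  unfolding prob_def by (intro expect_mono r_range) auto

lemma prob_nonneg: "0 \<le> prob S r E"
  using expect_mono[of S r "\<lambda>_. 0"] r_range unfolding prob_def by fastforce

lemma prob_not: "prob S r (\<lambda>G. \<not> E G) = 1 - prob S r E"
  using expect_diff[of S r "\<lambda>_. 1" "\<lambda>G. of_bool (E G)"] unfolding prob_def
  by (simp add: of_bool_not_iff)

lemma prob_disj: "prob S r (\<lambda>G. E G \<or> E' G) \<le> prob S r E + prob S r E'"
  unfolding prob_def expect_add[symmetric] by (intro expect_mono r_range) auto

lemma prob_Bex:
  assumes "finite I" shows "prob S r (\<lambda>G. \<exists>i\<in>I. E i G) \<le> (\<Sum>i\<in>I. prob S r (E i))"
  unfolding prob_def expect_sum[symmetric]
proof (intro expect_mono r_range)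
  fix G
  show "of_bool (\<exists>i\<in>I. E i G) \<le> (\<Sum>i\<in>I. of_bool (E i G) :: real)"
  proof (cases "\<exists>i\<in>I. E i G")
    case True
    then obtain i where i: "i \<in> I" "E i G" by auto
    have "(1::real) = of_bool (E i G)" using i by simp
    also have "\<dots> \<le> (\<Sum>i\<in>I. of_bool (E i G))" using i assms by (intro member_le_sum) auto
    finally show ?thesis using True by simp
  qed (simp add: sum_nonneg)
qed auto

lemma prob_markov:
  assumes "\<And>G. G \<subseteq> S \<Longrightarrow> 0 \<le> F G" "0 < c"
  shows "prob S r (\<lambda>G. c \<le> F G) \<le> expect S r F / c"
proof -
  have "prob S r (\<lambda>G. c \<le> F G) \<le> expect S r (\<lambda>G. (1 / c) * F G)"
    unfolding prob_def using assms by (intro expect_mono r_range) (auto simp: field_simps)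
  thus ?thesis by (simp only: expect_cmult) simp
qed

end

section \<open>Homology of a subcomplex of the simplex\<close>

lemma rscale_vector_space: "vector_space rscale"
  by (unfold_locales) (auto simp: rscale_def fun_eq_iff algebra_simps)

interpretation fun_vs: vector_space rscale
  by (rule rscale_vector_space)

definition sgn_at :: "nat \<Rightarrow> nat set \<Rightarrow> real" where
  "sgn_at v \<tau> = (-1) ^ card {u\<in>\<tau>. u < v}"

text \<open>Boundary operator of the whole simplex. It agrees with \<open>bdry Y\<close> on chains
  of \<open>Y\<close>, but also acts on non-faces of \<open>Y\<close>, where relative homology
  lives.\<close>

definition full_bdry :: "nat set \<Rightarrow> (nat set \<Rightarrow> real) \<Rightarrow> nat set \<Rightarrow> real" where
  "full_bdry V c \<tau> = (\<Sum>v\<in>V - \<tau>. sgn_at v \<tau> * c (insert v \<tau>))"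

lemma sgn_at_square [simp]: "sgn_at v \<tau> * sgn_at v \<tau> = 1"
  by (simp add: sgn_at_def flip: power_add)

lemma sgn_at_insert:
  assumes "finite \<tau>" "u \<notin> \<tau>"
  shows "sgn_at v (insert u \<tau>) = (if u < v then - sgn_at v \<tau> else sgn_at v \<tau>)"
proof -
  have "{w \<in> insert u \<tau>. w < v} = (if u < v then insert u {w\<in>\<tau>. w < v} else {w\<in>\<tau>. w < v})" by auto
  thus ?thesis using assms by (auto simp: sgn_at_def)
qed

text \<open>Inserting the smaller of \<open>u\<close>, \<open>v\<close> flips the sign of the larger
  one; inserting the larger leaves the smaller one's sign alone.\<close>

lemma sgn_at_anticomm:
  assumes "finite \<tau>" "u \<notin> \<tau>" "v \<notin> \<tau>" "u \<noteq> v"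
  shows "sgn_at v \<tau> * sgn_at u (insert v \<tau>) = - (sgn_at u \<tau> * sgn_at v (insert u \<tau>))"
  using assms by (cases "u < v") (auto simp: sgn_at_insert)

text \<open>Exchanging the two summation variables negates the sum. This is the common core of
  \<open>d d = 0\<close> for boundaries and for coboundaries.\<close>

lemma sum_offdiag_antisym:
  fixes h :: "'a \<Rightarrow> 'a \<Rightarrow> real"
  assumes "\<And>u v. u \<in> A \<Longrightarrow> v \<in> A \<Longrightarrow> u \<noteq> v \<Longrightarrow> h u v = - h v u"
  shows "(\<Sum>u\<in>A. \<Sum>v\<in>A - {u}. h u v) = 0"
proof (cases "finite A")
  case True
  have "(\<Sum>u\<in>A. \<Sum>v\<in>A - {u}. h u v) = (\<Sum>u\<in>A. \<Sum>v\<in>A. if u \<noteq> v then h u v else 0)"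
    by (intro sum.cong refl sum.mono_neutral_cong_left) (use True in auto)
  also have "\<dots> = (\<Sum>u\<in>A. \<Sum>v\<in>A. if u \<noteq> v then - h v u else 0)"
    by (intro sum.cong refl) (metis assms)
  also have "\<dots> = - (\<Sum>u\<in>A. \<Sum>v\<in>A. if u \<noteq> v then h v u else 0)"
    by (simp only: sum_negf[symmetric]) (intro sum.cong refl, auto)
  also have "(\<Sum>u\<in>A. \<Sum>v\<in>A. if u \<noteq> v then h v u else 0) = (\<Sum>u\<in>A. \<Sum>v\<in>A. if u \<noteq> v then h u v else 0)"
    by (subst sum.swap) (intro sum.cong refl, auto)
  also have "\<dots> = (\<Sum>u\<in>A. \<Sum>v\<in>A - {u}. h u v)"
    by (intro sum.cong refl sum.mono_neutral_cong_right) (use True in auto)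
  finally show ?thesis by simp
qed simp

lemma full_bdry_full_bdry:
  assumes "finite V" "\<tau> \<subseteq> V"
  shows "full_bdry V (full_bdry V c) \<tau> = 0"
proof -
  have fin: "finite \<tau>" using assms finite_subset by auto
  have *: "V - insert v \<tau> = (V - \<tau>) - {v}" for v by auto
  have "full_bdry V (full_bdry V c) \<tau>
      = (\<Sum>u\<in>V - \<tau>. \<Sum>v\<in>(V - \<tau>) - {u}. sgn_at u \<tau> * sgn_at v (insert u \<tau>) * c (insert u (insert v \<tau>)))"
    unfolding full_bdry_def * by (simp add: sum_distrib_left insert_commute algebra_simps)
  also have "\<dots> = 0"
  proof (rule sum_offdiag_antisym)
    fix u v assume uv: "u \<in> V - \<tau>" "v \<in> V - \<tau>" "u \<noteq> v"
    hence "sgn_at u \<tau> * sgn_at v (insert u \<tau>) = - (sgn_at v \<tau> * sgn_at u (insert v \<tau>))"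
      by (intro sgn_at_anticomm fin) auto
    thus "sgn_at u \<tau> * sgn_at v (insert u \<tau>) * c (insert u (insert v \<tau>))
        = - (sgn_at v \<tau> * sgn_at u (insert v \<tau>) * c (insert v (insert u \<tau>)))"
      by (simp add: insert_commute)
  qed
  finally show ?thesis .
qed

text \<open>Coning from the vertex 0. As 0 is the smallest vertex, it carries sign +1 and flips all
  other signs, so the boundary of the cone over \<open>z\<close> is \<open>z\<close> minus the cone
  over the boundary of \<open>z\<close>, which vanishes.\<close>

lemma full_bdry_cone:
  assumes V: "V = {0..n::nat}" and z: "\<And>\<tau>. z \<tau> \<noteq> 0 \<Longrightarrow> \<tau> \<subseteq> V" and cyc: "\<And>\<tau>. \<tau> \<subseteq> V \<Longrightarrow> full_bdry V z \<tau> = 0"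
    and \<tau>: "\<tau> \<subseteq> V"
  shows "full_bdry V (\<lambda>\<sigma>. if 0 \<in> \<sigma> then z (\<sigma> - {0}) else 0) \<tau> = z \<tau>"
proof (cases "0 \<in> \<tau>")
  case False
  have "full_bdry V (\<lambda>\<sigma>. if 0 \<in> \<sigma> then z (\<sigma> - {0}) else 0) \<tau>
     = (\<Sum>v\<in>V - \<tau>. if v = 0 then z \<tau> else 0)"
    unfolding full_bdry_def using False
    by (intro sum.cong refl) (auto simp: sgn_at_def)
  also have "\<dots> = z \<tau>" using False V by simp
  finally show ?thesis .
next
  case True
  define \<rho> where "\<rho> = \<tau> - {0}"
  have \<rho>: "\<tau> = insert 0 \<rho>" "0 \<notin> \<rho>" "finite \<rho>" using True \<tau> V by (auto simp: \<rho>_def finite_subset)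
  have "full_bdry V (\<lambda>\<sigma>. if 0 \<in> \<sigma> then z (\<sigma> - {0}) else 0) \<tau>
     = (\<Sum>v\<in>V - \<tau>. - (sgn_at v \<rho> * z (insert v \<rho>)))"
    unfolding full_bdry_def
  proof (intro sum.cong refl)
    fix v assume v: "v \<in> V - \<tau>"
    hence "insert v \<tau> - {0} = insert v \<rho>" using \<rho> by auto
    moreover have "0 < v" using v True by (metis DiffD2 gr0I)
    ultimately show "sgn_at v \<tau> * (if 0 \<in> insert v \<tau> then z (insert v \<tau> - {0}) else 0) = - (sgn_at v \<rho> * z (insert v \<rho>))"
      using \<rho> by (simp add: sgn_at_insert)
  qed
  \<comment> \<open>The boundary of \<open>z\<close> at \<open>\<rho>\<close> has one more term than
    this sum, that of the apex, which is \<open>z \<tau>\<close>.\<close>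
  also have "\<dots> = - (full_bdry V z \<rho> - sgn_at 0 \<rho> * z \<tau>)"
  proof -
    have *: "V - \<rho> = insert 0 (V - \<tau>)" "0 \<notin> V - \<tau>" "finite (V - \<tau>)" "insert 0 \<rho> = \<tau>"
      using \<rho> V by auto
    have "full_bdry V z \<rho> = sgn_at 0 \<rho> * z \<tau> + (\<Sum>v\<in>V - \<tau>. sgn_at v \<rho> * z (insert v \<rho>))"
      unfolding full_bdry_def *(1) sum.insert[OF *(3,2)] *(4) ..
    thus ?thesis by (simp add: sum_negf)
  qed
  also have "\<dots> = z \<tau>" using cyc[of \<rho>] \<tau> by (auto simp: \<rho>_def sgn_at_def)
  finally show ?thesis .
qed

locale complex_on =
  fixes V :: "nat set" and Y :: "nat set set" and n :: nat
  assumes V: "V = {0..n}" and Y_sub: "\<And>\<sigma>. \<sigma> \<in> Y \<Longrightarrow> \<sigma> \<subseteq> V" and Y_ne: "{} \<notin> Y"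
    and Y_down: "\<And>\<sigma> \<tau>. \<sigma> \<in> Y \<Longrightarrow> \<tau> \<subseteq> \<sigma> \<Longrightarrow> \<tau> \<noteq> {} \<Longrightarrow> \<tau> \<in> Y"
begin

lemma finite_V [simp]: "finite V" using V by simp

lemma finite_Y [simp]: "finite Y"
  by (rule finite_subset[of _ "Pow V"]) (use Y_sub in auto)

text \<open>The terms that \<open>bdry Y\<close> omits vanish by the support of \<open>c\<close>; at
  a non-face everything vanishes, since no set containing a non-empty non-face is a face.\<close>

lemma bdry_eq_full_bdry:
  assumes "\<And>\<sigma>. c \<sigma> \<noteq> 0 \<Longrightarrow> \<sigma> \<in> Y \<union> {{}}"
  shows "bdry Y c = full_bdry V c"
proof
  fix \<tau>
  have 0: "c (insert v \<tau>) = 0" if "insert v \<tau> \<notin> Y" for v using assms[of "insert v \<tau>"] that by auto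
  show "bdry Y c \<tau> = full_bdry V c \<tau>"
  proof (cases "\<tau> \<in> Y \<union> {{}}")
    case True
    hence fin: "finite \<tau>" using Y_sub finite_V finite_subset by blast
    have sub: "{v. v \<notin> \<tau> \<and> insert v \<tau> \<in> Y} \<subseteq> V - \<tau>" using Y_sub by auto
    have "(\<Sum>v\<in>{v. v \<notin> \<tau> \<and> insert v \<tau> \<in> Y}. sgn_at v \<tau> * c (insert v \<tau>)) = full_bdry V c \<tau>"
      unfolding full_bdry_def using 0 by (intro sum.mono_neutral_left sub) auto
    thus ?thesis using True fin by (simp only: bdry_def sgn_at_def simp_thms if_True)
  next
    case False
    hence "insert v \<tau> \<notin> Y" for v using Y_down by blast
    thus ?thesis using False 0 by (simp add: bdry_def full_bdry_def)
  qed
qed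

lemma chainsD: "c \<in> chains Y j \<Longrightarrow> c \<sigma> \<noteq> 0 \<Longrightarrow> \<sigma> \<in> Y \<union> {{}} \<and> int (card \<sigma>) = j + 1"
  by (auto simp: chains_def faces_of_dim_def)

lemma bdry_chain_eq: "c \<in> chains Y j \<Longrightarrow> bdry Y c = full_bdry V c"
  using chainsD by (intro bdry_eq_full_bdry) blast

text \<open>Needed because the ambient function space has infinite dimension:
  \<open>fun_vs.dim\<close> can only be compared for subspaces with a finite basis.\<close>

lemma chains_in_span: "\<exists>B. finite B \<and> chains Y j \<subseteq> fun_vs.span B"
proof (intro exI conjI subsetI)
  let ?B = "(\<lambda>\<sigma> \<tau>. of_bool (\<sigma> = \<tau>) :: real) ` (Y \<union> {{}})"
  show "finite ?B" by simp
  fix c assume c: "c \<in> chains Y j"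
  have "c = (\<Sum>\<sigma>\<in>Y \<union> {{}}. rscale (c \<sigma>) (\<lambda>\<tau>. of_bool (\<sigma> = \<tau>)))"
  proof
    fix \<tau>
    have sum_app: "(\<Sum>\<sigma>\<in>A. f \<sigma>) \<tau> = (\<Sum>\<sigma>\<in>A. f \<sigma> \<tau>)" if "finite A" for A and f :: "nat set \<Rightarrow> nat set \<Rightarrow> real"
      using that by (induction A) auto
    have "(\<Sum>\<sigma>\<in>Y \<union> {{}}. rscale (c \<sigma>) (\<lambda>\<tau>. of_bool (\<sigma> = \<tau>))) \<tau> = (\<Sum>\<sigma>\<in>Y \<union> {{}}. if \<sigma> = \<tau> then c \<sigma> else 0)"
      by (subst sum_app) (auto simp: rscale_def intro!: sum.cong)
    also have "\<dots> = c \<tau>" using chainsD[OF c, of \<tau>] by auto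
    finally show "c \<tau> = (\<Sum>\<sigma>\<in>Y \<union> {{}}. rscale (c \<sigma>) (\<lambda>\<tau>. of_bool (\<sigma> = \<tau>))) \<tau>" by simp
  qed
  also have "\<dots> \<in> fun_vs.span ?B"
    by (intro fun_vs.span_sum fun_vs.span_scale fun_vs.span_base) auto
  finally show "c \<in> fun_vs.span ?B" .
qed

lemma bdry_in_chains: assumes "c \<in> chains Y (j + 1)" shows "bdry Y c \<in> chains Y j"
  unfolding chains_def faces_of_dim_def
proof (intro CollectI allI impI conjI)
  fix \<sigma> assume nz: "bdry Y c \<sigma> \<noteq> 0"
  then show "\<sigma> \<in> Y \<union> {{}}" by (auto simp: bdry_def split: if_splits)
  from nz have "full_bdry V c \<sigma> \<noteq> 0" using bdry_chain_eq[OF assms] by simp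
  then obtain v where "v \<in> V - \<sigma>" "c (insert v \<sigma>) \<noteq> 0"
    unfolding full_bdry_def by (metis (no_types, lifting) mult_zero_right sum.neutral)
  moreover have "finite \<sigma>" using nz by (auto simp: bdry_def split: if_splits)
  ultimately show "int (card \<sigma>) = j + 1" using chainsD[OF assms, of "insert v \<sigma>"] by auto
qed

text \<open>The Betti number is a truncated difference of naturals, so it vanishes as soon as every
  cycle is a boundary; only this inclusion and a finite basis of the boundaries are used.\<close>

lemma reduced_betti_eq_0I:
  assumes "\<And>z. z \<in> chains Y j \<Longrightarrow> (\<And>\<tau>. \<tau> \<subseteq> V \<Longrightarrow> full_bdry V z \<tau> = 0) \<Longrightarrow>
             \<exists>c\<in>chains Y (j + 1). \<forall>\<tau>\<subseteq>V. full_bdry V c \<tau> = z \<tau>"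
  shows "reduced_betti Y j = 0"
proof -
  let ?Z = "{c \<in> chains Y j. bdry Y c = 0}" and ?B = "bdry Y ` chains Y (j + 1)"
  have "?Z \<subseteq> ?B"
  proof
    fix z assume "z \<in> ?Z"
    hence z: "z \<in> chains Y j" "bdry Y z = 0" by auto
    hence "full_bdry V z \<tau> = 0" for \<tau> using bdry_chain_eq[OF z(1)] by (simp add: fun_eq_iff)
    then obtain c where c: "c \<in> chains Y (j + 1)" "\<forall>\<tau>\<subseteq>V. full_bdry V c \<tau> = z \<tau>" using assms[OF z(1)] by blast
    have "bdry Y c \<tau> = z \<tau>" for \<tau>
    proof (cases "\<tau> \<subseteq> V")
      case True
      then show ?thesis using c bdry_chain_eq[OF c(1)] by simp
    next
      case False
      hence "\<tau> \<notin> Y \<union> {{}}" using Y_sub by auto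
      hence "z \<tau> = 0" "bdry Y c \<tau> = 0"
        using chainsD[OF z(1), of \<tau>] chainsD[OF bdry_in_chains[OF c(1)], of \<tau>] by blast+
      thus ?thesis by simp
    qed
    thus "z \<in> ?B" using c(1) by (intro image_eqI[of _ _ c]) auto
  qed
  obtain b where b: "b \<subseteq> ?B" "fun_vs.independent b" "?B \<subseteq> fun_vs.span b" "card b = fun_vs.dim ?B"
    using fun_vs.basis_exists by metis
  obtain B where B: "finite B" "chains Y j \<subseteq> fun_vs.span B" using chains_in_span by auto
  have "b \<subseteq> fun_vs.span B" using b(1) bdry_in_chains B(2) by blast
  hence "finite b" using fun_vs.independent_span_bound[OF B(1) b(2)] by simp
  hence "fun_vs.dim ?Z \<le> card b" using \<open>?Z \<subseteq> ?B\<close> b(3) by (intro fun_vs.dim_le_card) auto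
  thus ?thesis unfolding reduced_betti_def using b(4) by simp
qed

text \<open>The cone over a \<open>j\<close>-cycle consists of simplices of dimension
  \<open>j + 1 \<le> k\<close>, all of which lie in the skeleton, hence in \<open>Y\<close>.\<close>

lemma reduced_betti_skeleton:
  assumes "skeleton n k \<subseteq> Y" "j < k"
  shows "reduced_betti Y j = 0"
proof (rule reduced_betti_eq_0I)
  fix z assume z: "z \<in> chains Y j" and cyc: "\<And>\<tau>. \<tau> \<subseteq> V \<Longrightarrow> full_bdry V z \<tau> = 0"
  let ?c = "\<lambda>\<sigma>. if 0 \<in> \<sigma> then z (\<sigma> - {0}) else 0"
  have zV: "\<tau> \<subseteq> V" if "z \<tau> \<noteq> 0" for \<tau> using chainsD[OF z that] Y_sub by auto
  have "?c \<in> chains Y (j + 1)" unfolding chains_def faces_of_dim_def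
  proof (intro CollectI allI impI conjI)
    fix \<sigma> assume nz: "?c \<sigma> \<noteq> 0"
    hence s: "0 \<in> \<sigma>" "z (\<sigma> - {0}) \<noteq> 0" by (auto split: if_splits)
    have sub: "\<sigma> \<subseteq> V" using zV[OF s(2)] V by auto
    hence fin: "finite \<sigma>" by (simp add: finite_subset)
    have "int (card (\<sigma> - {0})) = j + 1" using chainsD[OF z s(2)] by simp
    thus card: "int (card \<sigma>) = j + 1 + 1" using s(1) fin by (metis card.remove int_ops(4) add.commute of_nat_Suc)
    have "\<sigma> \<in> skeleton n k" using sub V s(1) card assms(2) by (auto simp: skeleton_def)
    thus "\<sigma> \<in> Y \<union> {{}}" using assms(1) by auto
  qed
  moreover have "\<forall>\<tau>\<subseteq>V. full_bdry V ?c \<tau> = z \<tau>"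
    using full_bdry_cone[OF V zV cyc] by blast
  ultimately show "\<exists>c\<in>chains Y (j + 1). \<forall>\<tau>\<subseteq>V. full_bdry V c \<tau> = z \<tau>" by blast
qed

lemma reduced_betti_high:
  assumes "V \<notin> Y" "j \<ge> int n" shows "reduced_betti Y j = 0"
proof (rule reduced_betti_eq_0I)
  fix z assume z: "z \<in> chains Y j"
  have "z \<tau> = 0" for \<tau>
  proof (rule ccontr)
    assume "z \<tau> \<noteq> 0"
    hence \<tau>: "\<tau> \<in> Y \<union> {{}}" "int (card \<tau>) = j + 1" using chainsD[OF z] by auto
    hence sub: "\<tau> \<subseteq> V" using Y_sub by auto
    have "card V \<le> card \<tau>" using \<tau>(2) assms(2) V by simp
    hence "\<tau> = V" using sub by (simp add: card_seteq)
    thus False using \<tau> assms V by auto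
  qed
  thus "\<exists>c\<in>chains Y (j + 1). \<forall>\<tau>\<subseteq>V. full_bdry V c \<tau> = z \<tau>"
    by (intro bexI[of _ "\<lambda>_. 0"]) (auto simp: full_bdry_def chains_def)
qed

text \<open>The simplex being acyclic, the homology of \<^term>\<open>Y\<close> is the relative homology one degree
  higher, computed by chains on the non-faces.\<close>
lemma reduced_betti_relative:
  assumes rel: "\<And>b. (\<And>\<sigma>. b \<sigma> \<noteq> 0 \<Longrightarrow> \<sigma> \<subseteq> V \<and> \<sigma> \<notin> Y \<union> {{}} \<and> int (card \<sigma>) = j + 2) \<Longrightarrow>
        (\<And>\<tau>. \<tau> \<subseteq> V \<Longrightarrow> \<tau> \<notin> Y \<union> {{}} \<Longrightarrow> full_bdry V b \<tau> = 0) \<Longrightarrow>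
        \<exists>e. (\<forall>\<sigma>. e \<sigma> \<noteq> 0 \<longrightarrow> \<sigma> \<subseteq> V \<and> int (card \<sigma>) = j + 3)
           \<and> (\<forall>\<sigma>\<subseteq>V. \<sigma> \<notin> Y \<union> {{}} \<longrightarrow> full_bdry V e \<sigma> = b \<sigma>)"
  shows "reduced_betti Y j = 0"
proof (rule reduced_betti_eq_0I)
  fix z assume z: "z \<in> chains Y j" and cyc: "\<And>\<tau>. \<tau> \<subseteq> V \<Longrightarrow> full_bdry V z \<tau> = 0"
  define c0 where "c0 = (\<lambda>\<sigma>. if 0 \<in> \<sigma> then z (\<sigma> - {0}) else 0)"
  have zV: "\<tau> \<subseteq> V" if "z \<tau> \<noteq> 0" for \<tau> using chainsD[OF z that] Y_sub by auto
  have c0: "full_bdry V c0 \<tau> = z \<tau>" if "\<tau> \<subseteq> V" for \<tau>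
    unfolding c0_def using full_bdry_cone[OF V zV cyc that] by blast
  have c0s: "\<sigma> \<subseteq> V \<and> int (card \<sigma>) = j + 2" if "c0 \<sigma> \<noteq> 0" for \<sigma>
  proof -
    have s: "0 \<in> \<sigma>" "z (\<sigma> - {0}) \<noteq> 0" using that by (auto simp: c0_def split: if_splits)
    have sub: "\<sigma> \<subseteq> V" using zV[OF s(2)] V by auto
    hence fin: "finite \<sigma>" by (simp add: finite_subset)
    have "int (card (\<sigma> - {0})) = j + 1" using chainsD[OF z s(2)] by simp
    moreover have "card \<sigma> = Suc (card (\<sigma> - {0}))" using s(1) fin by (metis card.remove)
    ultimately show ?thesis using sub by simp
  qed
  \<comment> \<open>The cone \<open>c0\<close> fills \<open>z\<close> in the simplex; its part
    \<open>b\<close> on the non-faces is a relative cycle, because all sets containing a non-face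
    are again non-faces and \<open>z\<close> vanishes there.\<close>
  define b where "b = (\<lambda>\<sigma>. if \<sigma> \<in> Y \<union> {{}} then 0 else c0 \<sigma>)"
  have "\<exists>e. (\<forall>\<sigma>. e \<sigma> \<noteq> 0 \<longrightarrow> \<sigma> \<subseteq> V \<and> int (card \<sigma>) = j + 3)
           \<and> (\<forall>\<sigma>\<subseteq>V. \<sigma> \<notin> Y \<union> {{}} \<longrightarrow> full_bdry V e \<sigma> = b \<sigma>)"
  proof (rule rel)
    fix \<tau> assume \<tau>: "\<tau> \<subseteq> V" "\<tau> \<notin> Y \<union> {{}}"
    hence "insert v \<tau> \<notin> Y \<union> {{}}" for v using Y_down by auto
    hence "full_bdry V b \<tau> = full_bdry V c0 \<tau>" by (simp add: full_bdry_def b_def)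
    also have "\<dots> = z \<tau>" using c0 \<tau> by simp
    also have "\<dots> = 0" using chainsD[OF z, of \<tau>] \<tau> by auto
    finally show "full_bdry V b \<tau> = 0" .
  qed (use c0s in \<open>auto simp: b_def split: if_splits\<close>)
  then obtain e where e: "\<And>\<sigma>. e \<sigma> \<noteq> 0 \<Longrightarrow> \<sigma> \<subseteq> V \<and> int (card \<sigma>) = j + 3"
      "\<And>\<sigma>. \<sigma> \<subseteq> V \<Longrightarrow> \<sigma> \<notin> Y \<union> {{}} \<Longrightarrow> full_bdry V e \<sigma> = b \<sigma>" by blast
  \<comment> \<open>Subtracting the boundary of \<open>e\<close> removes the filling from the
    non-faces and leaves its own boundary \<open>z\<close> unchanged.\<close>
  define c where "c = (\<lambda>\<sigma>. if \<sigma> \<subseteq> V then c0 \<sigma> - full_bdry V e \<sigma> else 0)"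
  have "c \<in> chains Y (j + 1)" unfolding chains_def faces_of_dim_def
  proof (intro CollectI allI impI conjI)
    fix \<sigma> assume nz: "c \<sigma> \<noteq> 0"
    hence sub: "\<sigma> \<subseteq> V" by (auto simp: c_def split: if_splits)
    have "\<sigma> \<in> Y \<union> {{}}"
    proof (rule ccontr)
      assume n: "\<sigma> \<notin> Y \<union> {{}}"
      with e(2)[OF sub] show False using nz sub by (auto simp: c_def b_def)
    qed
    moreover have "int (card \<sigma>) = j + 2"
    proof (cases "c0 \<sigma> = 0")
      case True
      hence "full_bdry V e \<sigma> \<noteq> 0" using nz sub by (auto simp: c_def)
      then obtain v where "v \<in> V - \<sigma>" "e (insert v \<sigma>) \<noteq> 0"
        unfolding full_bdry_def by (metis (no_types, lifting) mult_zero_right sum.neutral)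
      moreover have "finite \<sigma>" using sub by (simp add: finite_subset)
      ultimately show ?thesis using e(1)[of "insert v \<sigma>"] by auto
    qed (use c0s in blast)
    ultimately show "\<sigma> \<in> Y \<union> {{}}" "int (card \<sigma>) = j + 1 + 1" by auto
  qed
  moreover have "full_bdry V c \<tau> = z \<tau>" if "\<tau> \<subseteq> V" for \<tau>
  proof -
    have "full_bdry V c \<tau> = full_bdry V c0 \<tau> - full_bdry V (full_bdry V e) \<tau>"
      unfolding full_bdry_def[of V c] full_bdry_def[of V c0] full_bdry_def[of V "full_bdry V e"] using that
      by (auto simp: c_def algebra_simps sum_subtractf[symmetric] intro!: sum.cong)
    thus ?thesis using full_bdry_full_bdry[OF finite_V that] c0[OF that] by simp
  qed
  ultimately show "\<exists>c\<in>chains Y (j + 1). \<forall>\<tau>\<subseteq>V. full_bdry V c \<tau> = z \<tau>" by blast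
qed

end

section \<open>Garland's method\<close>

text \<open>The normal equations of the projection of \<open>\<phi>\<close> to the span of the
  vectors \<open>a t\<close> are solvable even if these are dependent. The induction is
  Gram-Schmidt: \<open>b\<close> below is the part of the new vector orthogonal to the old
  ones.\<close>

lemma least_squares:
  fixes a :: "'t \<Rightarrow> 'c \<Rightarrow> real"
  assumes "finite C" "finite T"
  shows "\<exists>\<psi>. \<forall>t\<in>T. (\<Sum>x\<in>C. a t x * (\<phi> x - (\<Sum>t'\<in>T. \<psi> t' * a t' x))) = 0"
  using assms(2)
proof (induction T arbitrary: \<phi> rule: finite_induct)
  case (insert t T)
  define ip where "ip = (\<lambda>f g. \<Sum>x\<in>C. f x * g x :: real)"
  define comb where "comb = (\<lambda>\<psi> x. \<Sum>t'\<in>T. \<psi> t' * a t' x :: real)"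
  obtain \<psi>1 where "\<forall>t'\<in>T. (\<Sum>x\<in>C. a t' x * (\<phi> x - (\<Sum>t'\<in>T. \<psi>1 t' * a t' x))) = 0"
    using insert.IH[of \<phi>] by blast
  hence 1: "ip (a t') (\<lambda>x. \<phi> x - comb \<psi>1 x) = 0" if "t' \<in> T" for t' 
    using that by (simp add: ip_def comb_def)
  obtain \<psi>2 where "\<forall>t'\<in>T. (\<Sum>x\<in>C. a t' x * (a t x - (\<Sum>t'\<in>T. \<psi>2 t' * a t' x))) = 0"
    using insert.IH[of "a t"] by blast
  hence 2: "ip (a t') (\<lambda>x. a t x - comb \<psi>2 x) = 0" if "t' \<in> T" for t' 
    using that by (simp add: ip_def comb_def)
  define b where "b = (\<lambda>x. a t x - comb \<psi>2 x)"
  have 2: "ip (a t') b = 0" if "t' \<in> T" for t' using 2[OF that] by (simp add: b_def)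
  \<comment> \<open>If \<open>b\<close> has norm 0, it vanishes on \<open>C\<close> and the new
    vector adds nothing to the span, so the coefficient 0 will do.\<close>
  define c where "c = (if ip b b = 0 then 0 else ip b (\<lambda>x. \<phi> x - comb \<psi>1 x) / ip b b)"
  define \<psi> where "\<psi> = (\<lambda>t'. if t' = t then c else \<psi>1 t' - c * \<psi>2 t')"
  have res: "\<phi> x - (\<Sum>t'\<in>insert t T. \<psi> t' * a t' x) = \<phi> x - comb \<psi>1 x - c * b x" for x
  proof -
    have "(\<Sum>t'\<in>T. \<psi> t' * a t' x) = (\<Sum>t'\<in>T. (\<psi>1 t' - c * \<psi>2 t') * a t' x)"
      using insert.hyps by (intro sum.cong) (auto simp: \<psi>_def)
    also have "\<dots> = comb \<psi>1 x - c * comb \<psi>2 x"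
      by (simp add: comb_def algebra_simps sum_subtractf sum_distrib_left)
    finally show ?thesis using insert.hyps by (simp add: \<psi>_def b_def algebra_simps)
  qed
  have lin: "ip f (\<lambda>x. \<phi> x - comb \<psi>1 x - c * b x) = ip f (\<lambda>x. \<phi> x - comb \<psi>1 x) - c * ip f b" for f
    by (simp add: ip_def algebra_simps sum_subtractf sum_distrib_left sum.distrib)
  have comb0: "ip (comb \<psi>') (\<lambda>x. \<phi> x - comb \<psi>1 x - c * b x) = 0" for \<psi>'
  proof -
    have "ip (comb \<psi>') g = (\<Sum>t'\<in>T. \<psi>' t' * ip (a t') g)" for g
      unfolding ip_def comb_def by (simp add: sum_distrib_left sum_distrib_right mult.assoc) (rule sum.swap)
    thus ?thesis using 1 2 by (simp add: lin)
  qed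
  have "ip b (\<lambda>x. \<phi> x - comb \<psi>1 x - c * b x) = 0"
  proof (cases "ip b b = 0")
    case True
    hence "b x = 0" if "x \<in> C" for x
      using that assms(1) by (simp add: ip_def sum_nonneg_eq_0_iff)
    thus ?thesis by (simp add: ip_def)
  qed (unfold lin, simp add: c_def)
  moreover have "ip (a t) g = ip b g + ip (comb \<psi>2) g" for g
    by (simp add: ip_def b_def algebra_simps sum_subtractf sum.distrib)
  ultimately have "ip (a t) (\<lambda>x. \<phi> x - comb \<psi>1 x - c * b x) = 0" using comb0 by simp
  moreover have "ip (a t') (\<lambda>x. \<phi> x - comb \<psi>1 x - c * b x) = 0" if "t' \<in> T" for t'
    using 1[OF that] 2[OF that] by (simp add: lin)
  ultimately show ?case
    by (intro exI[of _ \<psi>]) (auto simp: res ip_def)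
qed simp

text \<open>\<open>s v S\<close> is the incidence sign of \<open>S - {v}\<close> in
  \<open>S\<close>. It stays abstract because the dual complex needs the signs of the complements.
  The empty face may belong to \<open>Z\<close>, so the cochain complex is augmented.\<close>

locale signed_complex =
  fixes V :: "'a set" and Z :: "'a set set" and s :: "'a \<Rightarrow> 'a set \<Rightarrow> real"
  assumes fin: "finite V" and Z_sub: "\<And>S. S \<in> Z \<Longrightarrow> S \<subseteq> V"
    and Z_down: "\<And>S T. S \<in> Z \<Longrightarrow> T \<subseteq> S \<Longrightarrow> T \<in> Z"
    and s_square: "\<And>v S. s v S * s v S = 1"
    and s_anticomm: "\<And>S u v. S \<subseteq> V \<Longrightarrow> u \<in> S \<Longrightarrow> v \<in> S \<Longrightarrow> u \<noteq> v \<Longrightarrow>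
       s v S * s u (S - {v}) = - (s u S * s v (S - {u}))"
begin

definition faces :: "nat \<Rightarrow> 'a set set" where
  "faces k = {S \<in> Z. card S = k}"

definition cobdry :: "('a set \<Rightarrow> real) \<Rightarrow> 'a set \<Rightarrow> real" where
  "cobdry \<phi> S = (\<Sum>v\<in>S. s v S * \<phi> (S - {v}))"

lemma finite_Z: "finite Z"
  by (rule finite_subset[of _ "Pow V"]) (use Z_sub fin in auto)

lemma finite_faces [simp]: "finite (faces k)"
  using finite_Z by (simp add: faces_def)

lemma finite_face: "S \<in> Z \<Longrightarrow> finite S"
  using Z_sub fin finite_subset by blast

lemma cobdry_cobdry:
  assumes "S \<subseteq> V" shows "cobdry (cobdry \<phi>) S = 0"
proof -
  have "cobdry (cobdry \<phi>) S = (\<Sum>u\<in>S. \<Sum>v\<in>S - {u}. s u S * s v (S - {u}) * \<phi> (S - {u} - {v}))"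
    by (simp add: cobdry_def sum_distrib_left mult.assoc)
  also have "\<dots> = 0"
  proof (rule sum_offdiag_antisym)
    fix u v assume uv: "u \<in> S" "v \<in> S" "u \<noteq> v"
    have "S - {u} - {v} = S - {v} - {u}" by auto
    thus "s u S * s v (S - {u}) * \<phi> (S - {u} - {v}) = - (s v S * s u (S - {v}) * \<phi> (S - {v} - {u}))"
      using s_anticomm[OF assms uv] by simp
  qed
  finally show ?thesis .
qed

text \<open>Double counting of the pairs of a face and a coface with one more vertex, seen from the
  coface on the left and from the face on the right.\<close>

lemma sum_flags:
  "(\<Sum>R\<in>faces (Suc k). \<Sum>v\<in>R. h v R) =
   (\<Sum>S\<in>faces k. \<Sum>v\<in>V - S. of_bool (insert v S \<in> Z) * h v (insert v S))" for h :: "'a \<Rightarrow> 'a set \<Rightarrow> real"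
proof -
  have fR: "finite R" if "R \<in> faces j" for R j using that finite_face by (auto simp: faces_def)
  have "(\<Sum>R\<in>faces (Suc k). \<Sum>v\<in>R. h v R) = (\<Sum>(R, v)\<in>Sigma (faces (Suc k)) (\<lambda>R. R). h v R)"
    using fR by (intro sum.Sigma) auto
  also have "\<dots> = (\<Sum>(S, v)\<in>Sigma (faces k) (\<lambda>S. {v\<in>V - S. insert v S \<in> Z}). h v (insert v S))"
    by (rule sum.reindex_bij_witness[of _ "\<lambda>(S, v). (insert v S, v)" "\<lambda>(R, v). (R - {v}, v)"])
       (use Z_sub Z_down finite_face in \<open>auto simp: faces_def insert_absorb card_insert_if\<close>)
  also have "\<dots> = (\<Sum>S\<in>faces k. \<Sum>v\<in>{v\<in>V - S. insert v S \<in> Z}. h v (insert v S))"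
    using fin by (subst sum.Sigma) auto
  also have "\<dots> = (\<Sum>S\<in>faces k. \<Sum>v\<in>V - S. of_bool (insert v S \<in> Z) * h v (insert v S))"
    using fin by (intro sum.cong refl sum.mono_neutral_cong_left) auto
  finally show ?thesis .
qed

text \<open>Unweighted form of Garland's identity; the double sums are the quadratic forms of the adjacency
  matrices of the links.\<close>
lemma cobdry_norm:
  fixes \<phi> :: "'a set \<Rightarrow> real"
  assumes supp: "\<And>S. \<phi> S \<noteq> 0 \<Longrightarrow> S \<in> faces l"
  shows "(\<Sum>R\<in>faces (Suc l). (cobdry \<phi> R)\<^sup>2) =
      (\<Sum>S\<in>faces l. card {v\<in>V - S. insert v S \<in> Z} * (\<phi> S)\<^sup>2)
    - (\<Sum>T\<in>{T\<in>Z. Suc (card T) = l}. \<Sum>u\<in>V - T. \<Sum>v\<in>V - T - {u}.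
        of_bool (insert u (insert v T) \<in> Z) * (s u (insert u T) * \<phi> (insert u T)) * (s v (insert v T) * \<phi> (insert v T)))"
    (is "?lhs = ?A - ?B")
proof -
  define H where "H = (\<lambda>u v R. s u R * \<phi> (R - {u}) * (s v R * \<phi> (R - {v})))"
  have fR: "finite R" if "R \<in> faces j" for R j using that finite_face by (auto simp: faces_def)
  have split: "(cobdry \<phi> R)\<^sup>2 = (\<Sum>v\<in>R. (\<phi> (R - {v}))\<^sup>2) + (\<Sum>u\<in>R. \<Sum>v\<in>R - {u}. H u v R)" if "R \<in> faces (Suc l)" for R
  proof -
    have HH: "H u u R = (\<phi> (R - {u}))\<^sup>2" for u
    proof -
      have "H u u R = (s u R * s u R) * (\<phi> (R - {u}))\<^sup>2" by (simp add: H_def power2_eq_square)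
      thus ?thesis by (simp add: s_square)
    qed
    have "(cobdry \<phi> R)\<^sup>2 = (\<Sum>u\<in>R. \<Sum>v\<in>R. H u v R)"
      by (simp add: cobdry_def power2_eq_square sum_product H_def)
    also have "\<dots> = (\<Sum>u\<in>R. H u u R + (\<Sum>v\<in>R - {u}. H u v R))"
      using fR[OF that] by (intro sum.cong refl sum.remove) auto
    finally show ?thesis by (simp add: sum.distrib HH)
  qed
  have "(\<Sum>R\<in>faces (Suc l). \<Sum>v\<in>R. (\<phi> (R - {v}))\<^sup>2) =
      (\<Sum>S\<in>faces l. \<Sum>v\<in>V - S. of_bool (insert v S \<in> Z) * (\<phi> (insert v S - {v}))\<^sup>2)"
    by (rule sum_flags)
  also have "\<dots> = ?A"
  proof (intro sum.cong refl)
    fix S assume "S \<in> faces l"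
    have "(\<Sum>v\<in>V - S. of_bool (insert v S \<in> Z) * (\<phi> (insert v S - {v}))\<^sup>2)
        = (\<Sum>v\<in>V - S. of_bool (insert v S \<in> Z) * (\<phi> S)\<^sup>2)"
      by (intro sum.cong refl) auto
    also have "\<dots> = (\<Sum>v\<in>{v\<in>V - S. insert v S \<in> Z}. (\<phi> S)\<^sup>2)"
      using fin by (intro sum.mono_neutral_cong_right) auto
    finally show "(\<Sum>v\<in>V - S. of_bool (insert v S \<in> Z) * (\<phi> (insert v S - {v}))\<^sup>2)
        = card {v\<in>V - S. insert v S \<in> Z} * (\<phi> S)\<^sup>2" by simp
  qed
  finally have A: "(\<Sum>R\<in>faces (Suc l). \<Sum>v\<in>R. (\<phi> (R - {v}))\<^sup>2) = ?A" .
  \<comment> \<open>The pairs \<open>u\<close>, \<open>v\<close> in \<open>R\<close> are regrouped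
    by \<open>T = R - {u, v}\<close>, removing the two vertices by two uses of
    \<open>sum_flags\<close>. Anticommutation trades the signs at \<open>R\<close> for those at
    \<open>insert u T\<close> and \<open>insert v T\<close>, which produces the minus.\<close>
  have B: "(\<Sum>R\<in>faces (Suc l). \<Sum>u\<in>R. \<Sum>v\<in>R - {u}. H u v R) = - ?B"
  proof -
    have "(\<Sum>R\<in>faces (Suc l). \<Sum>u\<in>R. \<Sum>v\<in>R - {u}. H u v R)
        = (\<Sum>S\<in>faces l. \<Sum>u\<in>V - S. of_bool (insert u S \<in> Z) * (\<Sum>v\<in>insert u S - {u}. H u v (insert u S)))"
      by (rule sum_flags)
    also have "\<dots> = (\<Sum>S\<in>faces l. \<Sum>u\<in>V - S. \<Sum>v\<in>S. of_bool (insert u S \<in> Z) * H u v (insert u S))"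
      by (intro sum.cong refl) (simp add: sum_distrib_left)
    also have "\<dots> = (\<Sum>S\<in>faces l. \<Sum>v\<in>S. \<Sum>u\<in>V - S. of_bool (insert u S \<in> Z) * H u v (insert u S))"
      by (intro sum.cong refl sum.swap)
    also have "\<dots> = - ?B"
    proof (cases l)
      case 0
      have "S = {}" if "S \<in> faces l" for S using 0 that fR[OF that] by (auto simp: faces_def)
      hence "(\<Sum>S\<in>faces l. \<Sum>v\<in>S. \<Sum>u\<in>V - S. of_bool (insert u S \<in> Z) * H u v (insert u S)) = 0"
        by (intro sum.neutral ballI) fastforce
      thus ?thesis using 0 by simp
    next
      case (Suc k)
      have "(\<Sum>S\<in>faces l. \<Sum>v\<in>S. \<Sum>u\<in>V - S. of_bool (insert u S \<in> Z) * H u v (insert u S))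
        = (\<Sum>T\<in>faces k. \<Sum>v\<in>V - T. of_bool (insert v T \<in> Z) *
            (\<Sum>u\<in>V - insert v T. of_bool (insert u (insert v T) \<in> Z) * H u v (insert u (insert v T))))"
        unfolding Suc by (rule sum_flags)
      also have "\<dots> = (\<Sum>T\<in>faces k. \<Sum>v\<in>V - T. \<Sum>u\<in>V - T - {v}.
          - (of_bool (insert v (insert u T) \<in> Z) * (s v (insert v T) * \<phi> (insert v T)) * (s u (insert u T) * \<phi> (insert u T))))"
      proof (intro sum.cong refl)
        fix T v assume T: "T \<in> faces k" and v: "v \<in> V - T"
        have eq: "V - insert v T = V - T - {v}" by auto
        show "of_bool (insert v T \<in> Z) *
            (\<Sum>u\<in>V - insert v T. of_bool (insert u (insert v T) \<in> Z) * H u v (insert u (insert v T)))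
          = (\<Sum>u\<in>V - T - {v}. - (of_bool (insert v (insert u T) \<in> Z) * (s v (insert v T) * \<phi> (insert v T)) * (s u (insert u T) * \<phi> (insert u T))))"
          unfolding eq sum_distrib_left
        proof (intro sum.cong refl)
          fix u assume u: "u \<in> V - T - {v}"
          define R where "R = insert u (insert v T)"
          have R: "insert v (insert u T) = R" "R - {u} = insert v T" "R - {v} = insert u T" "u \<in> R" "v \<in> R"
            using u v by (auto simp: R_def)
          show "of_bool (insert v T \<in> Z) * (of_bool (insert u (insert v T) \<in> Z) * H u v (insert u (insert v T)))
            = - (of_bool (insert v (insert u T) \<in> Z) * (s v (insert v T) * \<phi> (insert v T)) * (s u (insert u T) * \<phi> (insert u T)))"
          proof (cases "R \<in> Z")
            case False
            thus ?thesis using R by (simp add: R_def[symmetric])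
          next
            case True
            have vT: "insert v T \<in> Z" using Z_down[OF True] R(2) by blast
            have ac: "s v R * s u (insert u T) = - (s u R * s v (insert v T))"
              using s_anticomm[of R u v] R u Z_sub[OF True] by simp
            have "s u R * s v R = s u R * s v R * (s u (insert u T) * s u (insert u T))" by (simp only: s_square mult_1_right)
            also have "\<dots> = s u R * (s v R * s u (insert u T)) * s u (insert u T)" by (simp add: mult_ac)
            also have "\<dots> = - ((s u R * s u R) * s v (insert v T) * s u (insert u T))" by (simp add: ac mult_ac)
            also have "\<dots> = - (s v (insert v T) * s u (insert u T))" by (simp add: s_square)
            finally have "s u R * s v R = - (s v (insert v T) * s u (insert u T))" .
            moreover have "H u v R = (s u R * s v R) * (\<phi> (insert v T) * \<phi> (insert u T))"
              by (simp add: H_def R)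
            ultimately have "H u v R = - (s v (insert v T) * s u (insert u T)) * (\<phi> (insert v T) * \<phi> (insert u T))"
              by simp
            thus ?thesis unfolding R(1) R_def[symmetric] using True vT by simp
          qed
        qed
      qed
      also have "\<dots> = - ?B"
        using Suc by (simp add: sum_negf faces_def)
      finally show ?thesis .
    qed
    finally show ?thesis .
  qed
  have "?lhs = (\<Sum>R\<in>faces (Suc l). (\<Sum>v\<in>R. (\<phi> (R - {v}))\<^sup>2) + (\<Sum>u\<in>R. \<Sum>v\<in>R - {u}. H u v R))"
    using split by (intro sum.cong refl)
  also have "\<dots> = ?A - ?B" by (simp add: sum.distrib A B)
  finally show ?thesis .
qed

text \<open>The norm identity for a cocycle equates the degree sum with the sum of the link forms.
  Coclosedness says that each localisation \<open>f T\<close> has zero sum, so \<open>gap\<close>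
  applies to it; every \<open>l\<close>-face occurs in \<open>l\<close> localisations, which cancels
  the factor \<open>l\<close> and bounds the link forms by \<open>D\<close> times the squared norm.
  Degrees above \<open>D\<close> then force \<open>\<phi>\<close> to vanish.\<close>

lemma harmonic_eq_0:
  fixes D :: real
  assumes D0: "0 \<le> D" and supp: "\<And>S. \<phi> S \<noteq> 0 \<Longrightarrow> S \<in> faces l"
    and cocycle: "\<And>R. R \<in> faces (Suc l) \<Longrightarrow> cobdry \<phi> R = 0"
    and coclosed: "\<And>T. T \<in> Z \<Longrightarrow> Suc (card T) = l \<Longrightarrow> (\<Sum>v\<in>V - T. s v (insert v T) * \<phi> (insert v T)) = 0"
    and deg: "\<And>S. S \<in> faces l \<Longrightarrow> D < card {v\<in>V - S. insert v S \<in> Z}"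
    and gap: "\<And>T f. T \<in> Z \<Longrightarrow> Suc (card T) = l \<Longrightarrow> (\<And>v. f v \<noteq> 0 \<Longrightarrow> v \<in> V - T \<and> insert v T \<in> Z) \<Longrightarrow>
        (\<Sum>v\<in>V - T. f v) = 0 \<Longrightarrow>
        real l * (\<Sum>u\<in>V - T. \<Sum>v\<in>V - T - {u}. of_bool (insert u (insert v T) \<in> Z) * f u * f v) \<le> D * (\<Sum>v\<in>V - T. (f v)\<^sup>2)"
  shows "\<phi> S = 0"
proof -
  define f where "f = (\<lambda>T v. if v \<in> V - T then s v (insert v T) * \<phi> (insert v T) else 0)"
  let ?Q = "\<lambda>T. \<Sum>u\<in>V - T. \<Sum>v\<in>V - T - {u}. of_bool (insert u (insert v T) \<in> Z) * f T u * f T v"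
  have "0 = (\<Sum>R\<in>faces (Suc l). (cobdry \<phi> R)\<^sup>2)" using cocycle by simp
  also have "\<dots> = (\<Sum>S\<in>faces l. card {v\<in>V - S. insert v S \<in> Z} * (\<phi> S)\<^sup>2) - (\<Sum>T\<in>{T\<in>Z. Suc (card T) = l}. ?Q T)"
    by (subst cobdry_norm[OF supp]) (auto simp: f_def intro!: sum.cong)
  finally have eq: "(\<Sum>S\<in>faces l. card {v\<in>V - S. insert v S \<in> Z} * (\<phi> S)\<^sup>2) = (\<Sum>T\<in>{T\<in>Z. Suc (card T) = l}. ?Q T)" by simp
  have "(\<Sum>T\<in>{T\<in>Z. Suc (card T) = l}. ?Q T) \<le> D * (\<Sum>S\<in>faces l. (\<phi> S)\<^sup>2)"
  proof (cases l)
    \<comment> \<open>For \<open>l = 0\<close> there are no links, so the left side is an empty sum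
      and \<open>D \<ge> 0\<close> is enough.\<close>
    case 0
        have "faces l = (if {} \<in> Z then {{}} else {})" using 0 finite_face Z_down by (auto simp: faces_def)
    thus ?thesis using 0 D0 by auto
  next
    case (Suc k)
    have "real l * (\<Sum>T\<in>{T\<in>Z. Suc (card T) = l}. ?Q T) = (\<Sum>T\<in>{T\<in>Z. Suc (card T) = l}. real l * ?Q T)"
      by (simp add: sum_distrib_left)
    also have "\<dots> \<le> (\<Sum>T\<in>{T\<in>Z. Suc (card T) = l}. D * (\<Sum>v\<in>V - T. (f T v)\<^sup>2))"
    proof (intro sum_mono)
      fix T assume "T \<in> {T\<in>Z. Suc (card T) = l}"
      hence T: "T \<in> Z" "Suc (card T) = l" by auto
      show "real l * ?Q T \<le> D * (\<Sum>v\<in>V - T. (f T v)\<^sup>2)"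
      proof (rule gap[OF T])
        show "v \<in> V - T \<and> insert v T \<in> Z" if "f T v \<noteq> 0" for v
          using that supp[of "insert v T"] by (auto simp: f_def faces_def split: if_splits)
        show "(\<Sum>v\<in>V - T. f T v) = 0" using coclosed[OF T] by (simp add: f_def)
      qed
    qed
    also have "\<dots> = D * (\<Sum>T\<in>faces k. \<Sum>v\<in>V - T. of_bool (insert v T \<in> Z) * (\<phi> (insert v T))\<^sup>2)"
    proof -
      have "(f T v)\<^sup>2 = of_bool (insert v T \<in> Z) * (\<phi> (insert v T))\<^sup>2" if "v \<in> V - T" for T v
      proof -
        have "(f T v)\<^sup>2 = (s v (insert v T) * s v (insert v T)) * (\<phi> (insert v T))\<^sup>2"
          using that by (simp add: f_def power2_eq_square)
        thus ?thesis using supp[of "insert v T"] by (auto simp: s_square faces_def)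
      qed
      thus ?thesis using Suc by (simp add: sum_distrib_left faces_def)
    qed
    also have "\<dots> = D * (\<Sum>S\<in>faces l. \<Sum>v\<in>S. (\<phi> S)\<^sup>2)"
      unfolding Suc sum_flags[of "\<lambda>v S. (\<phi> S)\<^sup>2" k] ..
    also have "\<dots> = real l * (D * (\<Sum>S\<in>faces l. (\<phi> S)\<^sup>2))"
      by (simp add: faces_def sum_distrib_left mult_ac)
    finally show ?thesis using Suc by (simp add: mult_le_cancel_left_pos)
  qed
  hence "(\<Sum>S\<in>faces l. (card {v\<in>V - S. insert v S \<in> Z} - D) * (\<phi> S)\<^sup>2) \<le> 0"
    using eq by (simp add: left_diff_distrib sum_subtractf sum_distrib_left)
  moreover have nn: "(card {v\<in>V - S. insert v S \<in> Z} - D) * (\<phi> S)\<^sup>2 \<ge> 0" if "S \<in> faces l" for S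
    using deg[OF that] by (intro mult_nonneg_nonneg) auto
  ultimately have "(\<Sum>S\<in>faces l. (card {v\<in>V - S. insert v S \<in> Z} - D) * (\<phi> S)\<^sup>2) = 0"
    using sum_nonneg[of "faces l" "\<lambda>S. (card {v\<in>V - S. insert v S \<in> Z} - D) * (\<phi> S)\<^sup>2"] by fastforce
  hence z: "\<forall>S\<in>faces l. (card {v\<in>V - S. insert v S \<in> Z} - D) * (\<phi> S)\<^sup>2 = 0"
    using nn by (subst (asm) sum_nonneg_eq_0_iff) auto
  show ?thesis
  proof (rule ccontr)
    assume "\<phi> S \<noteq> 0"
    with supp[OF this] z deg[of S] show False by fastforce
  qed
qed

text \<open>Subtract from \<open>\<phi>\<close> its best approximation by coboundaries. The residue
  is still a cocycle and is orthogonal to all coboundaries, that is coclosed, so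
  \<open>harmonic_eq_0\<close> makes it vanish.\<close>

lemma cocycle_is_cobdry:
  fixes D :: real
  assumes D0: "0 \<le> D" and supp: "\<And>S. \<phi> S \<noteq> 0 \<Longrightarrow> S \<in> faces l"
    and cocycle: "\<And>R. R \<in> faces (Suc l) \<Longrightarrow> cobdry \<phi> R = 0"
    and deg: "\<And>S. S \<in> faces l \<Longrightarrow> D < card {v\<in>V - S. insert v S \<in> Z}"
    and gap: "\<And>T f. T \<in> Z \<Longrightarrow> Suc (card T) = l \<Longrightarrow> (\<And>v. f v \<noteq> 0 \<Longrightarrow> v \<in> V - T \<and> insert v T \<in> Z) \<Longrightarrow>
        (\<Sum>v\<in>V - T. f v) = 0 \<Longrightarrow>
        real l * (\<Sum>u\<in>V - T. \<Sum>v\<in>V - T - {u}. of_bool (insert u (insert v T) \<in> Z) * f u * f v) \<le> D * (\<Sum>v\<in>V - T. (f v)\<^sup>2)"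
  shows "\<exists>\<psi>. (\<forall>T. \<psi> T \<noteq> 0 \<longrightarrow> T \<in> Z \<and> Suc (card T) = l) \<and> (\<forall>S\<in>faces l. cobdry \<psi> S = \<phi> S)"
proof -
  define TT where "TT = {T\<in>Z. Suc (card T) = l}"
  have fTT: "finite TT" using finite_Z by (simp add: TT_def)
  \<comment> \<open>The matrix of the coboundary operator. It is used only for \<open>T\<close> with
    one vertex less than \<open>S\<close>, where \<open>the_elem\<close> picks the missing
    vertex.\<close>
  define a where "a = (\<lambda>T S. if T \<subseteq> S then s (the_elem (S - T)) S else 0)"
  obtain \<psi>0 where \<psi>0: "\<forall>T\<in>TT. (\<Sum>S\<in>faces l. a T S * (\<phi> S - (\<Sum>T'\<in>TT. \<psi>0 T' * a T' S))) = 0"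
    using least_squares[OF finite_faces fTT] by blast
  define \<psi> where "\<psi> = (\<lambda>T. if T \<in> TT then \<psi>0 T else 0)"
  have cob: "(\<Sum>T'\<in>TT. \<psi>0 T' * a T' S) = cobdry \<psi> S" if S: "S \<in> faces l" for S
  proof -
    have fS: "finite S" using S finite_face by (auto simp: faces_def)
    have sub: "(\<lambda>v. S - {v}) ` S \<subseteq> TT"
      using S fS Z_down card_Suc_Diff1[OF fS] by (auto simp: faces_def TT_def)
    have inj: "inj_on (\<lambda>v. S - {v}) S" by (auto simp: inj_on_def)
    have "cobdry \<psi> S = (\<Sum>v\<in>S. \<psi>0 (S - {v}) * a (S - {v}) S)"
      unfolding cobdry_def
    proof (intro sum.cong refl)
      fix v assume v: "v \<in> S"
      have "S - (S - {v}) = {v}" using v by auto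
      thus "s v S * \<psi> (S - {v}) = \<psi>0 (S - {v}) * a (S - {v}) S" using v sub by (auto simp: \<psi>_def a_def)
    qed
    also have "\<dots> = (\<Sum>T\<in>(\<lambda>v. S - {v}) ` S. \<psi>0 T * a T S)" by (simp add: sum.reindex[OF inj])
    also have "\<dots> = (\<Sum>T\<in>TT. \<psi>0 T * a T S)"
    proof (rule sum.mono_neutral_left[OF fTT sub])
      show "\<forall>i\<in>TT - (\<lambda>v. S - {v}) ` S. \<psi>0 i * a i S = 0"
      proof
        fix T assume T: "T \<in> TT - (\<lambda>v. S - {v}) ` S"
        have "\<not> T \<subseteq> S"
        proof
          assume "T \<subseteq> S"
          hence "card (S - T) = 1" using T S fS by (auto simp: TT_def faces_def card_Diff_subset finite_subset)
          then obtain v where "S - T = {v}" by (auto simp: card_1_singleton_iff)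
          hence "v \<in> S" "T = S - {v}" using \<open>T \<subseteq> S\<close> by auto
          thus False using T by auto
        qed
        thus "\<psi>0 T * a T S = 0" by (simp add: a_def)
      qed
    qed
    finally show ?thesis by simp
  qed
  define \<phi>' where "\<phi>' = (\<lambda>S. if S \<in> faces l then \<phi> S - cobdry \<psi> S else 0)"
  have "\<phi>' S = 0" for S
  proof (rule harmonic_eq_0[where D = D])
    show "\<phi>' S \<noteq> 0 \<Longrightarrow> S \<in> faces l" for S by (auto simp: \<phi>'_def split: if_splits)
    show "cobdry \<phi>' R = 0" if R: "R \<in> faces (Suc l)" for R
    proof -
      have "R - {v} \<in> faces l" if "v \<in> R" for v
        using R that Z_down finite_face by (auto simp: faces_def)
      hence "cobdry \<phi>' R = cobdry \<phi> R - cobdry (cobdry \<psi>) R"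
        unfolding cobdry_def[of \<phi>'] cobdry_def[of \<phi>] cobdry_def[of "cobdry \<psi>"]
        by (simp add: \<phi>'_def sum_subtractf[symmetric] algebra_simps)
      thus ?thesis using cocycle[OF R] cobdry_cobdry[of R \<psi>] R Z_sub by (auto simp: faces_def)
    qed
    show "(\<Sum>v\<in>V - T. s v (insert v T) * \<phi>' (insert v T)) = 0" if T: "T \<in> Z" "Suc (card T) = l" for T
    proof -
      have inj: "inj_on (\<lambda>v. insert v T) (V - T)" by (auto simp: inj_on_def)
      have fT: "finite T" using finite_face T by auto
      have fI: "finite ((\<lambda>v. insert v T) ` (V - T) \<union> faces l)" using fin by simp
      have "(\<Sum>v\<in>V - T. s v (insert v T) * \<phi>' (insert v T)) = (\<Sum>v\<in>V - T. a T (insert v T) * \<phi>' (insert v T))"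
        by (intro sum.cong refl) (auto simp: a_def insert_Diff_if)
      also have "\<dots> = (\<Sum>S\<in>(\<lambda>v. insert v T) ` (V - T). a T S * \<phi>' S)" by (simp add: sum.reindex[OF inj])
      also have "\<dots> = (\<Sum>S\<in>(\<lambda>v. insert v T) ` (V - T) \<union> faces l. a T S * \<phi>' S)"
      proof (rule sum.mono_neutral_left[OF fI])
        show "\<forall>S\<in>(\<lambda>v. insert v T) ` (V - T) \<union> faces l - (\<lambda>v. insert v T) ` (V - T). a T S * \<phi>' S = 0"
        proof
          fix S assume S: "S \<in> (\<lambda>v. insert v T) ` (V - T) \<union> faces l - (\<lambda>v. insert v T) ` (V - T)"
          hence Sf: "S \<in> faces l" by auto
          have "\<not> T \<subseteq> S"
          proof
            assume "T \<subseteq> S"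
            hence "card (S - T) = 1" using T Sf fT by (auto simp: faces_def card_Diff_subset)
            then obtain v where "S - T = {v}" by (auto simp: card_1_singleton_iff)
            hence "S = insert v T" "v \<in> V - T" using \<open>T \<subseteq> S\<close> Sf Z_sub by (auto simp: faces_def)
            thus False using S by auto
          qed
          thus "a T S * \<phi>' S = 0" by (simp add: a_def)
        qed
      qed auto
      also have "\<dots> = (\<Sum>S\<in>faces l. a T S * \<phi>' S)"
        by (rule sum.mono_neutral_right[OF fI]) (auto simp: \<phi>'_def)
      also have "\<dots> = (\<Sum>S\<in>faces l. a T S * (\<phi> S - (\<Sum>T'\<in>TT. \<psi>0 T' * a T' S)))"
        by (intro sum.cong refl) (simp add: \<phi>'_def cob)
      also have "\<dots> = 0" using \<psi>0 T by (auto simp: TT_def)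
      finally show ?thesis .
    qed
  qed (use D0 deg gap in blast)+
  thus ?thesis by (intro exI[of _ \<psi>]) (force simp: \<phi>'_def \<psi>_def TT_def split: if_splits)
qed

end

section \<open>Alexander duality between \<open>Y\<close> and its dual complex\<close>

context complex_on
begin

text \<open>The combinatorial Alexander dual; treating the empty set like a face of \<open>Y\<close>
  keeps \<open>V\<close> itself out of it.\<close>

definition dual :: "nat set set" where
  "dual = {S. S \<subseteq> V \<and> V - S \<notin> Y \<union> {{}}}"

text \<open>With the signs taken at the complements, the coboundary of the dual at \<open>S\<close>
  is literally the boundary of the simplex at \<open>V - S\<close>.\<close>

lemma signed_complex_dual: "signed_complex V dual (\<lambda>v S. sgn_at v (V - S))"
proof
  fix S u v assume S: "S \<subseteq> V" "u \<in> S" "v \<in> S" "u \<noteq> v"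
  have "V - (S - {v}) = insert v (V - S)" "V - (S - {u}) = insert u (V - S)" using S by auto
  thus "sgn_at v (V - S) * sgn_at u (V - (S - {v})) = - (sgn_at u (V - S) * sgn_at v (V - (S - {u})))"
    using sgn_at_anticomm[of "V - S" u v] S by simp
next
  fix S T assume "S \<in> dual" "T \<subseteq> S"
  moreover have "V - S \<subseteq> V - T" using \<open>T \<subseteq> S\<close> by auto
  ultimately show "T \<in> dual" using Y_down[of "V - T" "V - S"] by (auto simp: dual_def)
qed (auto simp: dual_def)

interpretation du: signed_complex V dual "\<lambda>v S. sgn_at v (V - S)"
  by (rule signed_complex_dual)

text \<open>The relative chains that compute degree \<open>j\<close> live on non-faces with
  \<open>j + 2\<close> vertices; their complements have \<open>n + 1 - (j + 2) = l\<close> vertices.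
  Complementation turns relative cycles into cocycles of the dual, and a cochain that cobounds there
  into the required relative filling.\<close>

lemma reduced_betti_garland:
  fixes D :: real
  assumes l: "int n - j = int l + 1" and D0: "0 \<le> D"
    and deg: "\<And>S. S \<in> dual \<Longrightarrow> card S = l \<Longrightarrow> D < card {v\<in>V - S. insert v S \<in> dual}"
    and gap: "\<And>T f. T \<in> dual \<Longrightarrow> Suc (card T) = l \<Longrightarrow> (\<And>v. f v \<noteq> 0 \<Longrightarrow> v \<in> V - T \<and> insert v T \<in> dual) \<Longrightarrow>
        (\<Sum>v\<in>V - T. f v) = 0 \<Longrightarrow>
        real l * (\<Sum>u\<in>V - T. \<Sum>v\<in>V - T - {u}. of_bool (insert u (insert v T) \<in> dual) * f u * f v) \<le> D * (\<Sum>v\<in>V - T. (f v)\<^sup>2)"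
  shows "reduced_betti Y j = 0"
proof (rule reduced_betti_relative)
  fix b assume b: "\<And>\<sigma>. b \<sigma> \<noteq> 0 \<Longrightarrow> \<sigma> \<subseteq> V \<and> \<sigma> \<notin> Y \<union> {{}} \<and> int (card \<sigma>) = j + 2"
    and cyc: "\<And>\<tau>. \<tau> \<subseteq> V \<Longrightarrow> \<tau> \<notin> Y \<union> {{}} \<Longrightarrow> full_bdry V b \<tau> = 0"
  have mem: "S \<in> du.faces k \<longleftrightarrow> S \<in> dual \<and> card S = k" for S k by (simp add: du.faces_def)
  have dual_iff: "S \<in> dual \<longleftrightarrow> S \<subseteq> V \<and> V - S \<notin> Y \<union> {{}}" for S by (simp only: dual_def mem_Collect_eq)
  define \<phi> where "\<phi> = (\<lambda>S. if S \<subseteq> V then b (V - S) else 0)"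
  have card_compl: "int (card (V - S)) = int n + 1 - int (card S)" if "S \<subseteq> V" for S
  proof -
    have "finite S" "card S \<le> card V" using that by (auto simp: finite_subset card_mono)
    thus ?thesis using that V by (simp add: card_Diff_subset of_nat_diff)
  qed
  have supp: "S \<in> du.faces l" if "\<phi> S \<noteq> 0" for S
  proof -
    have S: "S \<subseteq> V" "b (V - S) \<noteq> 0" using that by (auto simp: \<phi>_def split: if_splits)
    have "S \<in> dual" using b[OF S(2)] S(1) unfolding dual_iff by simp
    moreover have "card S = l" using b[OF S(2)] card_compl[OF S(1)] l by linarith
    ultimately show ?thesis by (simp add: mem)
  qed
  have coc: "du.cobdry \<phi> R = 0" if R: "R \<in> du.faces (Suc l)" for R
  proof -
    have RV: "R \<subseteq> V" "V - R \<notin> Y \<union> {{}}" using R unfolding mem dual_iff by blast+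
    have "du.cobdry \<phi> R = full_bdry V b (V - R)"
      unfolding du.cobdry_def full_bdry_def
    proof (intro sum.cong)
      fix v assume "v \<in> V - (V - R)"
      hence "V - (R - {v}) = insert v (V - R)" "R - {v} \<subseteq> V" using RV by auto
      thus "sgn_at v (V - R) * \<phi> (R - {v}) = sgn_at v (V - R) * b (insert v (V - R))" by (simp add: \<phi>_def)
    qed (use RV in auto)
    also have "\<dots> = 0" using RV by (intro cyc) auto
    finally show ?thesis .
  qed
  have "\<exists>\<psi>. (\<forall>T. \<psi> T \<noteq> 0 \<longrightarrow> T \<in> dual \<and> Suc (card T) = l) \<and> (\<forall>S\<in>du.faces l. du.cobdry \<psi> S = \<phi> S)"
    by (rule du.cocycle_is_cobdry[where D = D and \<phi> = \<phi>, OF D0 supp coc])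
       (use deg gap in \<open>simp_all add: mem\<close>)
  then obtain \<psi> where \<psi>: "\<And>T. \<psi> T \<noteq> 0 \<Longrightarrow> T \<in> dual \<and> Suc (card T) = l"
      "\<And>S. S \<in> du.faces l \<Longrightarrow> du.cobdry \<psi> S = \<phi> S" by blast
  define e where "e = (\<lambda>\<sigma>. if \<sigma> \<subseteq> V then \<psi> (V - \<sigma>) else 0)"
  show "\<exists>e. (\<forall>\<sigma>. e \<sigma> \<noteq> 0 \<longrightarrow> \<sigma> \<subseteq> V \<and> int (card \<sigma>) = j + 3)
           \<and> (\<forall>\<sigma>\<subseteq>V. \<sigma> \<notin> Y \<union> {{}} \<longrightarrow> full_bdry V e \<sigma> = b \<sigma>)"
  proof (intro exI[of _ e] conjI allI impI)
    fix \<sigma> assume "e \<sigma> \<noteq> 0"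
    hence s: "\<sigma> \<subseteq> V" "\<psi> (V - \<sigma>) \<noteq> 0" by (auto simp: e_def split: if_splits)
    show "\<sigma> \<subseteq> V" by fact
    show "int (card \<sigma>) = j + 3" using \<psi>(1)[OF s(2)] card_compl[OF s(1)] l by auto
  next
    fix \<sigma> assume \<sigma>: "\<sigma> \<subseteq> V" "\<sigma> \<notin> Y \<union> {{}}"
    have \<sigma>': "V - (V - \<sigma>) = \<sigma>" using \<sigma> by auto
    have "full_bdry V e \<sigma> = du.cobdry \<psi> (V - \<sigma>)"
      unfolding du.cobdry_def full_bdry_def \<sigma>'
    proof (intro sum.cong refl)
      fix v assume "v \<in> V - \<sigma>"
      hence "V - insert v \<sigma> = V - \<sigma> - {v}" "insert v \<sigma> \<subseteq> V" using \<sigma> by auto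
      thus "sgn_at v \<sigma> * e (insert v \<sigma>) = sgn_at v \<sigma> * \<psi> (V - \<sigma> - {v})" by (simp add: e_def)
    qed
    also have "\<dots> = b \<sigma>"
    proof (cases "card (V - \<sigma>) = l")
      case True
      hence "V - \<sigma> \<in> du.faces l" using \<sigma> \<sigma>' unfolding mem dual_iff by simp
      thus ?thesis using \<psi>(2) \<sigma>' by (simp add: \<phi>_def)
    next
      case False
      have "b \<sigma> = 0"
        using b[of \<sigma>] card_compl[OF \<sigma>(1)] l False by (cases "b \<sigma> = 0") auto
      moreover have "\<psi> (V - \<sigma> - {v}) = 0" if "v \<in> V - \<sigma>" for v
      proof (rule ccontr)
        assume "\<psi> (V - \<sigma> - {v}) \<noteq> 0"
        hence "Suc (card (V - \<sigma> - {v})) = l" using \<psi>(1) by auto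
        thus False using False that card_Suc_Diff1[of "V - \<sigma>" v] by simp
      qed
      ultimately show ?thesis by (simp add: du.cobdry_def)
    qed
    finally show "full_bdry V e \<sigma> = b \<sigma>" .
  qed
qed

end

section \<open>Traces and closed walks\<close>

definition mat_app :: "'a set \<Rightarrow> ('a \<Rightarrow> 'a \<Rightarrow> real) \<Rightarrow> ('a \<Rightarrow> real) \<Rightarrow> 'a \<Rightarrow> real" where
  "mat_app A M f u = (\<Sum>v\<in>A. M u v * f v)"

primrec mat_pow :: "'a set \<Rightarrow> ('a \<Rightarrow> 'a \<Rightarrow> real) \<Rightarrow> nat \<Rightarrow> 'a \<Rightarrow> 'a \<Rightarrow> real" where
  "mat_pow A M 0 u v = of_bool (u = v)"
| "mat_pow A M (Suc t) u v = (\<Sum>x\<in>A. M u x * mat_pow A M t x v)"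

fun walk_weight :: "('a \<Rightarrow> 'a \<Rightarrow> real) \<Rightarrow> 'a list \<Rightarrow> real" where
  "walk_weight M (x # y # ys) = M x y * walk_weight M (y # ys)"
| "walk_weight M _ = 1"

lemma sum_lists_Suc:
  "(\<Sum>xs\<in>{xs. set xs \<subseteq> A \<and> length xs = Suc t}. h xs)
     = (\<Sum>x\<in>A. \<Sum>xs\<in>{xs. set xs \<subseteq> A \<and> length xs = t}. h (x # xs))"
proof -
  let ?L = "{xs. set xs \<subseteq> A \<and> length xs = t}"
  have inj: "inj_on (\<lambda>(xs, n). n # xs) (?L \<times> A)" by (auto simp: inj_on_def)
  have "(\<Sum>xs\<in>{xs. set xs \<subseteq> A \<and> length xs = Suc t}. h xs) = (\<Sum>(xs, x)\<in>?L \<times> A. h (x # xs))"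
    unfolding lists_length_Suc_eq by (subst sum.reindex[OF inj]) (simp add: case_prod_unfold)
  also have "\<dots> = (\<Sum>xs\<in>?L. \<Sum>x\<in>A. h (x # xs))" by (rule sum.cartesian_product[symmetric])
  also have "\<dots> = (\<Sum>x\<in>A. \<Sum>xs\<in>?L. h (x # xs))" by (rule sum.swap)
  finally show ?thesis .
qed

lemma mat_pow_walks:
  "mat_pow A M t u v =
    (\<Sum>xs\<in>{xs. set xs \<subseteq> A \<and> length xs = t}. of_bool (last (u # xs) = v) * walk_weight M (u # xs))"
proof (induction t arbitrary: u)
  case 0
  have "{xs. set xs \<subseteq> A \<and> length xs = 0} = {[]}" by auto
  thus ?case by simp
next
  case (Suc t)
  show ?case unfolding sum_lists_Suc mat_pow.simps Suc.IH
    by (simp add: sum_distrib_left mult_ac)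
qed

lemma trace_walks:
  "(\<Sum>u\<in>A. mat_pow A M t u u) =
    (\<Sum>ys\<in>{ys. set ys \<subseteq> A \<and> length ys = Suc t}. of_bool (last ys = hd ys) * walk_weight M ys)"
  unfolding sum_lists_Suc mat_pow_walks by simp

context
  fixes A :: "'a set" and M :: "'a \<Rightarrow> 'a \<Rightarrow> real"
  assumes fin: "finite A" and sym: "\<And>u v. M u v = M v u"
begin

lemma mat_pow_add:
  assumes "u \<in> A" shows "mat_pow A M (a + b) u v = (\<Sum>x\<in>A. mat_pow A M a u x * mat_pow A M b x v)"
  using assms
proof (induction a arbitrary: u)
  case 0
  have "(\<Sum>x\<in>A. mat_pow A M 0 u x * mat_pow A M b x v) = (\<Sum>x\<in>A. if x = u then mat_pow A M b x v else 0)"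
    by (intro sum.cong) auto
  thus ?case using fin 0 by simp
next
  case (Suc a)
  have "mat_pow A M (Suc a + b) u v = (\<Sum>y\<in>A. M u y * (\<Sum>x\<in>A. mat_pow A M a y x * mat_pow A M b x v))"
    using Suc.IH by simp
  also have "\<dots> = (\<Sum>y\<in>A. \<Sum>x\<in>A. M u y * mat_pow A M a y x * mat_pow A M b x v)"
    by (simp add: sum_distrib_left mult_ac)
  also have "\<dots> = (\<Sum>x\<in>A. \<Sum>y\<in>A. M u y * mat_pow A M a y x * mat_pow A M b x v)" by (rule sum.swap)
  finally show ?case by (simp add: sum_distrib_right)
qed

lemma mat_pow_sym:
  assumes "u \<in> A" "v \<in> A" shows "mat_pow A M t u v = mat_pow A M t v u"
  using assms
proof (induction t arbitrary: u v)
  case (Suc t)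
  have "mat_pow A M 1 x v = M x v" if "v \<in> A" for x v
  proof -
    have "mat_pow A M 1 x v = (\<Sum>y\<in>A. if y = v then M x y else 0)"
      unfolding One_nat_def mat_pow.simps by (intro sum.cong) auto
    thus ?thesis using that fin by simp
  qed
  hence "mat_pow A M (t + 1) v u = (\<Sum>x\<in>A. mat_pow A M t v x * M x u)"
    using Suc.prems by (simp only: mat_pow_add)
  also have "\<dots> = (\<Sum>x\<in>A. M u x * mat_pow A M t x v)"
    by (intro sum.cong refl) (metis Suc.IH Suc.prems(2) sym mult.commute)
  finally show ?case by simp
qed auto

lemma mat_app_iter:
  assumes "u \<in> A" shows "(mat_app A M ^^ t) f u = (\<Sum>v\<in>A. mat_pow A M t u v * f v)"
  using assms
proof (induction t arbitrary: u)
  case 0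
  have "(\<Sum>v\<in>A. mat_pow A M 0 u v * f v) = (\<Sum>v\<in>A. if v = u then f v else 0)" by (intro sum.cong) auto
  thus ?case using fin 0 by simp
next
  case (Suc t)
  have "(mat_app A M ^^ Suc t) f u = (\<Sum>x\<in>A. \<Sum>v\<in>A. M u x * mat_pow A M t x v * f v)"
    by (simp add: mat_app_def[of A M "(mat_app A M ^^ t) f"] Suc.IH sum_distrib_left mult.assoc)
  also have "\<dots> = (\<Sum>v\<in>A. \<Sum>x\<in>A. M u x * mat_pow A M t x v * f v)" by (rule sum.swap)
  finally show ?case by (simp add: sum_distrib_right)
qed

lemma mat_app_self_adjoint: "(\<Sum>u\<in>A. mat_app A M h u * k u) = (\<Sum>u\<in>A. h u * mat_app A M k u)"
proof -
  have "(\<Sum>u\<in>A. mat_app A M h u * k u) = (\<Sum>u\<in>A. \<Sum>v\<in>A. M u v * h v * k u)"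
    by (simp add: mat_app_def sum_distrib_right)
  also have "\<dots> = (\<Sum>v\<in>A. \<Sum>u\<in>A. M u v * h v * k u)" by (rule sum.swap)
  also have "\<dots> = (\<Sum>v\<in>A. h v * mat_app A M k v)"
    unfolding mat_app_def sum_distrib_left by (intro sum.cong refl) (metis sym mult.assoc mult.commute)
  finally show ?thesis .
qed

lemma frobenius_trace: "(\<Sum>u\<in>A. \<Sum>v\<in>A. (mat_pow A M s u v)\<^sup>2) = (\<Sum>u\<in>A. mat_pow A M (2 * s) u u)"
proof (intro sum.cong refl)
  fix u assume u: "u \<in> A"
  have "mat_pow A M (s + s) u u = (\<Sum>v\<in>A. mat_pow A M s u v * mat_pow A M s v u)" by (rule mat_pow_add[OF u])
  also have "\<dots> = (\<Sum>v\<in>A. (mat_pow A M s u v)\<^sup>2)"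
    by (intro sum.cong refl) (metis mat_pow_sym u power2_eq_square)
  finally show "(\<Sum>v\<in>A. (mat_pow A M s u v)\<^sup>2) = mat_pow A M (2 * s) u u" by (simp add: mult_2)
qed

lemma trace_nonneg: "0 \<le> (\<Sum>u\<in>A. mat_pow A M (2 * s) u u)"
  unfolding frobenius_trace[symmetric] by (intro sum_nonneg) auto

text \<open>The norms \<open>\<parallel>M\<^sup>t f\<parallel>\<close> are log-convex in \<open>t\<close>; this replaces the spectral theorem.\<close>
lemma quad_form_le_trace:
  assumes "s > 0"
  shows "(\<Sum>u\<in>A. \<Sum>v\<in>A. M u v * f u * f v) ^ (2 * s)
     \<le> (\<Sum>u\<in>A. mat_pow A M (2 * s) u u) * (\<Sum>u\<in>A. (f u)\<^sup>2) ^ (2 * s)"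
proof -
  define F where "F = (\<lambda>t. (mat_app A M ^^ t) f)"
  define g where "g = (\<lambda>t. \<Sum>u\<in>A. (F t u)\<^sup>2)"
  let ?q = "\<Sum>u\<in>A. \<Sum>v\<in>A. M u v * f u * f v" and ?T = "\<Sum>u\<in>A. mat_pow A M (2 * s) u u"
  have FS: "F (Suc t) = mat_app A M (F t)" for t by (simp add: F_def)
  have g0: "g t \<ge> 0" for t by (simp add: g_def sum_nonneg)
  have step: "(g (Suc t))\<^sup>2 \<le> g t * g (Suc (Suc t))" for t
  proof -
    have "g (Suc t) = (\<Sum>u\<in>A. mat_app A M (F t) u * F (Suc t) u)" by (simp add: g_def FS power2_eq_square)
    also have "\<dots> = (\<Sum>u\<in>A. F t u * F (Suc (Suc t)) u)" by (simp only: mat_app_self_adjoint FS)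
    also have "\<dots>\<^sup>2 \<le> g t * g (Suc (Suc t))" unfolding g_def by (rule Cauchy_Schwarz_ineq_sum)
    finally show ?thesis .
  qed
  \<comment> \<open>The ratios of consecutive values of \<open>g\<close> increase, so each is at
    least \<open>g 1 / g 0\<close>; multiplied out, this also makes sense when some value is
    0.\<close>
  have mono: "g 1 * g t \<le> g 0 * g (Suc t)" for t
  proof (induction t)
    case (Suc t)
    show ?case
    proof (cases "g (Suc t) = 0")
      case False
      hence pos: "g (Suc t) > 0" using g0[of "Suc t"] by simp
      have "(g 1 * g (Suc t)) * g (Suc t) = g 1 * (g (Suc t))\<^sup>2" by (simp add: power2_eq_square)
      also have "\<dots> \<le> g 1 * (g t * g (Suc (Suc t)))" by (intro mult_left_mono step g0)
      also have "\<dots> = (g 1 * g t) * g (Suc (Suc t))" by simp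
      also have "\<dots> \<le> (g 0 * g (Suc t)) * g (Suc (Suc t))" by (intro mult_right_mono Suc g0)
      also have "\<dots> = (g 0 * g (Suc (Suc t))) * g (Suc t)" by simp
      finally show ?thesis using pos by (simp only: mult_le_cancel_right_pos)
    qed (simp add: g0)
  qed simp
  have pow: "g 1 ^ Suc t \<le> g (Suc t) * g 0 ^ t" for t
  proof (induction t)
    case (Suc t)
    have "g 1 ^ Suc (Suc t) = g 1 * g 1 ^ Suc t" by simp
    also have "\<dots> \<le> g 1 * (g (Suc t) * g 0 ^ t)" by (intro mult_left_mono Suc g0)
    also have "\<dots> = (g 1 * g (Suc t)) * g 0 ^ t" by simp
    also have "\<dots> \<le> (g 0 * g (Suc (Suc t))) * g 0 ^ t" by (intro mult_right_mono mono zero_le_power g0)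
    finally show ?case by (simp add: mult_ac)
  qed simp
  \<comment> \<open>\<open>g s\<close> is the squared norm of the \<open>s\<close>-th power applied
    to \<open>f\<close>, bounded by the squared Frobenius norm of that power, which is the trace of
    the power \<open>2 * s\<close>.\<close>
  have gT: "g s \<le> ?T * g 0"
  proof -
    have "g s = (\<Sum>u\<in>A. (\<Sum>v\<in>A. mat_pow A M s u v * f v)\<^sup>2)"
      unfolding g_def F_def by (intro sum.cong refl) (simp add: mat_app_iter)
    also have "\<dots> \<le> (\<Sum>u\<in>A. (\<Sum>v\<in>A. (mat_pow A M s u v)\<^sup>2) * (\<Sum>v\<in>A. (f v)\<^sup>2))"
      by (intro sum_mono Cauchy_Schwarz_ineq_sum)
    also have "\<dots> = ?T * g 0" by (simp add: sum_distrib_right[symmetric] frobenius_trace g_def F_def)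
    finally show ?thesis .
  qed
  have "?q\<^sup>2 \<le> g 0 * g 1"
  proof -
    have "?q = (\<Sum>u\<in>A. F 0 u * F 1 u)"
      by (simp add: F_def mat_app_def sum_distrib_left mult_ac)
    also have "\<dots>\<^sup>2 \<le> g 0 * g 1" unfolding g_def by (rule Cauchy_Schwarz_ineq_sum)
    finally show ?thesis .
  qed
  hence "(?q\<^sup>2) ^ s \<le> (g 0 * g 1) ^ s" by (intro power_mono) auto
  also have "\<dots> = g 0 ^ s * g 1 ^ s" by (rule power_mult_distrib)
  also obtain t where t: "s = Suc t" using assms by (cases s) auto
  have "g 0 ^ s * g 1 ^ s \<le> g 0 ^ s * (g s * g 0 ^ t)"
    unfolding t by (intro mult_left_mono pow zero_le_power g0)
  also have "\<dots> \<le> g 0 ^ s * ((?T * g 0) * g 0 ^ t)"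
    by (intro mult_left_mono mult_right_mono gT zero_le_power g0)
  also have "\<dots> = ?T * g 0 ^ (2 * s)" by (simp only: t mult_2 power_add power_Suc) (simp only: mult_ac)
  finally show ?thesis by (simp add: power_mult g_def F_def)
qed

end

section \<open>Combinatorics of walks: vertices, edges and multiplicities\<close>

lemma card_lists_set_card:
  assumes "finite A" "card A \<le> N"
  shows "card {ys. set ys \<subseteq> A \<and> length ys = L \<and> card (set ys) = v} \<le> N ^ v * v ^ L"
proof -
  let ?P = "{g. set g \<subseteq> A \<and> length g = v} \<times> {w. set w \<subseteq> {..<v} \<and> length w = L}"
  have fP: "finite ?P" using assms by (intro finite_cartesian_product finite_lists_length_eq) auto
  have "{ys. set ys \<subseteq> A \<and> length ys = L \<and> card (set ys) = v} \<subseteq> (\<lambda>(g, w). map (nth g) w) ` ?P"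
  proof
    fix ys assume "ys \<in> {ys. set ys \<subseteq> A \<and> length ys = L \<and> card (set ys) = v}"
    hence ys: "set ys \<subseteq> A" "length ys = L" "card (set ys) = v" by auto
    obtain g where g: "set g = set ys" "distinct g" using finite_distinct_list[of "set ys"] by auto
    hence lg: "length g = v" using ys distinct_card by fastforce
    have "\<exists>i<v. g ! i = y" if "y \<in> set ys" for y using that g lg by (metis in_set_conv_nth)
    then obtain i where i: "\<And>y. y \<in> set ys \<Longrightarrow> i y < v \<and> g ! i y = y" by metis
    have "ys = map (nth g) (map i ys)" using i by (simp add: map_idI)
    moreover have "(g, map i ys) \<in> ?P" using g lg ys i by auto
    ultimately show "ys \<in> (\<lambda>(g, w). map (nth g) w) ` ?P" by (intro image_eqI[of _ _ "(g, map i ys)"]) simp_all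
  qed
  hence "card {ys. set ys \<subseteq> A \<and> length ys = L \<and> card (set ys) = v} \<le> card ((\<lambda>(g, w). map (nth g) w) ` ?P)"
    using fP by (intro card_mono) auto
  also have "\<dots> \<le> card ?P" using fP by (rule card_image_le)
  also have "\<dots> = card A ^ v * v ^ L"
    using assms by (simp add: card_cartesian_product card_lists_length_eq)
  also have "\<dots> \<le> N ^ v * v ^ L" using assms by (simp add: power_mono)
  finally show ?thesis .
qed

text \<open>A step that stays at its vertex is recorded as a singleton; the condition
  \<open>card e = 2\<close> below excludes such steps.\<close>

fun walk_edges :: "'a list \<Rightarrow> 'a set list" where
  "walk_edges (x # y # ys) = {x, y} # walk_edges (y # ys)"
| "walk_edges _ = []"

lemma length_walk_edges: "length (walk_edges ys) = length ys - 1"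
  by (induction ys rule: walk_edges.induct) auto

lemma walk_edges_subset: "e \<in> set (walk_edges ys) \<Longrightarrow> e \<subseteq> set ys"
  by (induction ys rule: walk_edges.induct) auto

lemma card_walk_vertices: "card (set ys) \<le> Suc (card (set (walk_edges ys)))"
proof (induction ys rule: walk_edges.induct)
  case (1 x y ys)
  show ?case
  proof (cases "x \<in> set (y # ys)")
    case True
    hence "card (set (x # y # ys)) = card (set (y # ys))" by (simp add: insert_absorb)
    also have "\<dots> \<le> Suc (card (set (walk_edges (y # ys))))" by (rule 1)
    also have "\<dots> \<le> Suc (card (set (walk_edges (x # y # ys))))" by (simp add: card_insert_le)
    finally show ?thesis .
  next
    case False
    hence "{x, y} \<notin> set (walk_edges (y # ys))" using walk_edges_subset by blast
    thus ?thesis using 1 False by simp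
  qed
qed auto

text \<open>Collects repeated edges of a walk, so that independence can be applied to the distinct
  ones.\<close>

lemma prod_list_map_count:
  "prod_list (map f xs) = (\<Prod>x\<in>set xs. f x ^ count_list xs x)" for f :: "'a \<Rightarrow> 'b :: comm_monoid_mult"
proof (induction xs)
  case (Cons a xs)
  have *: "(\<Prod>x\<in>set xs - {a}. f x ^ count_list (a # xs) x) = (\<Prod>x\<in>set xs - {a}. f x ^ count_list xs x)"
    by (intro prod.cong) auto
  have "(\<Prod>x\<in>set (a # xs). f x ^ count_list (a # xs) x) = f a ^ count_list (a # xs) a * (\<Prod>x\<in>set xs - {a}. f x ^ count_list (a # xs) x)"
    by (simp add: prod.insert_remove)
  also have "\<dots> = f a * (f a ^ count_list xs a * (\<Prod>x\<in>set xs - {a}. f x ^ count_list xs x))"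
    unfolding * by (simp add: mult_ac)
  also have "f a ^ count_list xs a * (\<Prod>x\<in>set xs - {a}. f x ^ count_list xs x) = (\<Prod>x\<in>set xs. f x ^ count_list xs x)"
    by (cases "a \<in> set xs") (auto simp: prod.remove)
  finally show ?case using Cons by simp
qed simp

section \<open>Centred adjacency matrices of random links\<close>

text \<open>\<open>J {u}\<close> indicates that \<open>u\<close> is a vertex of the link, and
  \<open>J {u, v}\<close> that two vertices of the link are adjacent; independence comes from the
  disjoint coordinate sets \<open>B e\<close>. The model is an Erdos-Renyi graph of density
  \<open>\<pi>\<close> on a random vertex set of density \<open>\<rho>\<close>.\<close>

locale random_link = bernoulli_family S r for S :: "'a set" and r +
  fixes A :: "'v set" and J :: "'v set \<Rightarrow> 'a set \<Rightarrow> real" and B :: "'v set \<Rightarrow> 'a set" and \<rho> \<pi> :: real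
  assumes finite_A: "finite A"
    and J_01: "\<And>e G. J e G = 0 \<or> J e G = 1"
    and J_dep: "\<And>e. e \<subseteq> A \<Longrightarrow> depends (B e) (J e)"
    and B_disj: "\<And>e e'. e \<subseteq> A \<Longrightarrow> e' \<subseteq> A \<Longrightarrow> e \<noteq> e' \<Longrightarrow> B e \<inter> B e' = {}"
    and expect_vertex: "\<And>u. u \<in> A \<Longrightarrow> expect S r (J {u}) = \<rho>"
    and expect_edge: "\<And>e. e \<subseteq> A \<Longrightarrow> card e = 2 \<Longrightarrow> expect S r (J e) = \<pi>"
    and \<rho>_range: "0 \<le> \<rho>" and \<pi>_range: "0 \<le> \<pi>" "\<pi> \<le> 1"
begin

definition link_mat :: "'a set \<Rightarrow> 'v \<Rightarrow> 'v \<Rightarrow> real" where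
  "link_mat G u v = (if u = v then 0 else J {u} G * J {v} G * (J {u, v} G - \<pi>))"

lemma link_mat_sym: "link_mat G u v = link_mat G v u"
  by (simp add: link_mat_def insert_commute)

lemma J_idem: "J e G * J e G = J e G" "J e G * (J e G * x) = J e G * x"
  using J_01[of e G] by auto

text \<open>Indicators are idempotent: a vertex counts once however often it is visited, while the
  centred edge factors keep their multiplicity.\<close>

lemma walk_weight_link_mat:
  assumes "length ys \<ge> 2"
  shows "walk_weight (link_mat G) ys = of_bool (\<forall>e\<in>set (walk_edges ys). card e = 2) *
     ((\<Prod>u\<in>set ys. J {u} G) * prod_list (map (\<lambda>e. J e G - \<pi>) (walk_edges ys)))"
  using assms
proof (induction ys rule: walk_edges.induct)
  case (1 x y ys)
  have abs: "J {u} G * (\<Prod>u\<in>U. J {u} G) = (\<Prod>u\<in>U. J {u} G)" if "finite U" "u \<in> U" for u U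
    using that by (simp add: prod.remove mult.assoc[symmetric] J_idem)
  have ins: "J {u} G * (\<Prod>u\<in>U. J {u} G) = (\<Prod>u\<in>insert u U. J {u} G)" if "finite U" for u U
    by (cases "u \<in> U") (use that abs in \<open>auto simp: insert_absorb\<close>)
  show ?case
  proof (cases ys)
    case Nil
    thus ?thesis by (auto simp: link_mat_def card_insert_if)
  next
    case (Cons z zs)
    hence IH: "walk_weight (link_mat G) (y # ys) = of_bool (\<forall>e\<in>set (walk_edges (y # ys)). card e = 2) *
     ((\<Prod>u\<in>set (y # ys). J {u} G) * prod_list (map (\<lambda>e. J e G - \<pi>) (walk_edges (y # ys))))"
      using 1 by simp
    have P: "J {x} G * J {y} G * (\<Prod>u\<in>set (y # ys). J {u} G) = (\<Prod>u\<in>set (x # y # ys). J {u} G)"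
    proof -
      have 1: "J {y} G * (\<Prod>u\<in>set (y # ys). J {u} G) = (\<Prod>u\<in>set (y # ys). J {u} G)" by (rule abs) auto
      have 2: "J {x} G * (\<Prod>u\<in>set (y # ys). J {u} G) = (\<Prod>u\<in>insert x (set (y # ys)). J {u} G)" by (rule ins) auto
      show ?thesis unfolding mult.assoc 1 2 by simp
    qed
    show ?thesis
    proof (cases "x = y")
      case True thus ?thesis by (simp add: link_mat_def)
    next
      case False
      have "walk_weight (link_mat G) (x # y # ys) = of_bool (\<forall>e\<in>set (walk_edges (y # ys)). card e = 2) *
         ((J {x} G * J {y} G * (\<Prod>u\<in>set (y # ys). J {u} G)) * ((J {x, y} G - \<pi>) * prod_list (map (\<lambda>e. J e G - \<pi>) (walk_edges (y # ys)))))"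
        using False by (simp only: walk_weight.simps IH) (simp add: link_mat_def mult_ac)
      thus ?thesis unfolding P using False by simp
    qed
  qed
qed auto

lemma expect_centered_power:
  assumes "e \<subseteq> A" "card e = 2"
  shows "expect S r (\<lambda>G. (J e G - \<pi>) ^ c) = \<pi> * (1 - \<pi>) ^ c + (1 - \<pi>) * (- \<pi>) ^ c"
proof -
  have "expect S r (\<lambda>G. (J e G - \<pi>) ^ c) = expect S r (\<lambda>G. ((1 - \<pi>) ^ c - (- \<pi>) ^ c) * J e G + (- \<pi>) ^ c)"
  proof (intro expect_cong)
    fix G show "(J e G - \<pi>) ^ c = ((1 - \<pi>) ^ c - (- \<pi>) ^ c) * J e G + (- \<pi>) ^ c"
      using J_01[of e G] by auto
  qed
  also have "\<dots> = ((1 - \<pi>) ^ c - (- \<pi>) ^ c) * \<pi> + (- \<pi>) ^ c"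
    by (simp add: expect_add expect_cmult expect_edge assms)
  finally show ?thesis by (simp add: algebra_simps)
qed

text \<open>For \<open>c \<ge> 2\<close> the two outcomes contribute at most
  \<open>\<pi> * (1 - \<pi>)\<close> and \<open>\<pi> * \<pi>\<close>, which add up to
  \<open>\<pi>\<close>.\<close>

lemma expect_centered_power_le:
  assumes "e \<subseteq> A" "card e = 2" "c \<ge> 2"
  shows "\<bar>expect S r (\<lambda>G. (J e G - \<pi>) ^ c)\<bar> \<le> \<pi>"
proof -
  obtain k where c: "c = Suc (Suc k)" using assms(3) by (metis Suc_le_D numeral_2_eq_2 Suc_le_mono)
  have 1: "\<pi> * (1 - \<pi>) ^ c \<le> \<pi> * (1 - \<pi>)"
    using \<pi>_range by (intro mult_left_mono) (auto simp: c mult_le_one power_le_one intro!: mult_left_le)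
  have 2: "(1 - \<pi>) * \<pi> ^ c \<le> \<pi> * \<pi>"
  proof -
    have "\<pi> ^ c \<le> \<pi> * \<pi>" using \<pi>_range by (auto simp: c power_le_one intro!: mult_left_mono mult_left_le)
    moreover have "(1 - \<pi>) * \<pi> ^ c \<le> 1 * \<pi> ^ c" using \<pi>_range by (intro mult_right_mono) auto
    ultimately show ?thesis by simp
  qed
  have "\<bar>expect S r (\<lambda>G. (J e G - \<pi>) ^ c)\<bar> \<le> \<bar>\<pi> * (1 - \<pi>) ^ c\<bar> + \<bar>(1 - \<pi>) * (- \<pi>) ^ c\<bar>"
    unfolding expect_centered_power[OF assms(1,2)] by (rule abs_triangle_ineq)
  also have "\<dots> = \<pi> * (1 - \<pi>) ^ c + (1 - \<pi>) * \<pi> ^ c"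
    using \<pi>_range by (simp add: abs_mult power_abs)
  also have "\<dots> \<le> \<pi>" using 1 2 by (simp add: algebra_simps)
  finally show ?thesis .
qed

lemma expect_walk_weight:
  assumes "set ys \<subseteq> A" "length ys \<ge> 2" "\<forall>e\<in>set (walk_edges ys). card e = 2"
  shows "expect S r (\<lambda>G. walk_weight (link_mat G) ys) = \<rho> ^ card (set ys) *
     (\<Prod>e\<in>set (walk_edges ys). expect S r (\<lambda>G. (J e G - \<pi>) ^ count_list (walk_edges ys) e))"
proof -
  let ?V = "(\<lambda>u. {u}) ` set ys" and ?E = "set (walk_edges ys)"
  \<comment> \<open>Vertices and edges are merged into one family of sets with disjoint coordinates,
    told apart by their size.\<close>
  define F where "F = (\<lambda>e G. if card e = 1 then J e G else (J e G - \<pi>) ^ count_list (walk_edges ys) e)"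
  have sub: "e \<subseteq> A" if "e \<in> ?V \<union> ?E" for e
    using that walk_edges_subset[of e ys] assms(1) by blast
  have disj: "?V \<inter> ?E = {}" using assms(3) by fastforce
  have inj: "inj_on (\<lambda>u. {u}) (set ys)" by (auto simp: inj_on_def)
  have "walk_weight (link_mat G) ys = (\<Prod>e\<in>?V \<union> ?E. F e G)" for G
  proof -
    have "(\<Prod>e\<in>?V \<union> ?E. F e G) = (\<Prod>e\<in>?V. F e G) * (\<Prod>e\<in>?E. F e G)"
      by (rule prod.union_disjoint) (use disj in auto)
    also have "(\<Prod>e\<in>?V. F e G) = (\<Prod>u\<in>set ys. J {u} G)"
      by (simp add: prod.reindex[OF inj] F_def)
    also have "(\<Prod>e\<in>?E. F e G) = (\<Prod>e\<in>?E. (J e G - \<pi>) ^ count_list (walk_edges ys) e)"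
      using assms(3) by (intro prod.cong) (auto simp: F_def)
    finally show ?thesis using walk_weight_link_mat[OF assms(2), of G] assms(3)
      by (simp add: prod_list_map_count)
  qed
  hence "expect S r (\<lambda>G. walk_weight (link_mat G) ys) = expect S r (\<lambda>G. \<Prod>e\<in>?V \<union> ?E. F e G)"
    by simp
  also have "\<dots> = (\<Prod>e\<in>?V \<union> ?E. expect S r (F e))"
  proof (rule expect_prod)
    fix e assume "e \<in> ?V \<union> ?E"
    thus "depends (B e) (F e)" using J_dep[OF sub] unfolding depends_def F_def by metis
  qed (use B_disj sub in \<open>auto\<close>)
  also have "\<dots> = (\<Prod>e\<in>?V. expect S r (F e)) * (\<Prod>e\<in>?E. expect S r (F e))"
    by (rule prod.union_disjoint) (use disj in auto)
  also have "(\<Prod>e\<in>?V. expect S r (F e)) = (\<Prod>u\<in>set ys. \<rho>)"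
    unfolding prod.reindex[OF inj] using assms(1) by (intro prod.cong) (auto simp: F_def expect_vertex)
  also have "(\<Prod>e\<in>?E. expect S r (F e)) = (\<Prod>e\<in>?E. expect S r (\<lambda>G. (J e G - \<pi>) ^ count_list (walk_edges ys) e))"
    using assms(3) by (intro prod.cong) (auto simp: F_def)
  finally show ?thesis by simp
qed

text \<open>An edge traversed exactly once contributes a factor of mean 0. Otherwise the
  \<open>2 * s\<close> steps use at most \<open>s\<close> distinct edges, hence at most
  \<open>s + 1\<close> vertices, and at least one edge per vertex beyond the first pays a factor
  \<open>\<pi>\<close>.\<close>

lemma expect_walk_weight_le:
  assumes "set ys \<subseteq> A" "length ys = Suc (2 * s)" "s > 0"
  shows "\<bar>expect S r (\<lambda>G. walk_weight (link_mat G) ys)\<bar>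
     \<le> of_bool (card (set ys) \<le> Suc s) * (\<rho> ^ card (set ys) * \<pi> ^ (card (set ys) - 1))"
proof (cases "(\<forall>e\<in>set (walk_edges ys). card e = 2) \<and> (\<forall>e\<in>set (walk_edges ys). count_list (walk_edges ys) e \<ge> 2)")
  case True
  let ?E = "set (walk_edges ys)"
  have "2 * card ?E = (\<Sum>e\<in>?E. 2)" by simp
  also have "\<dots> \<le> (\<Sum>e\<in>?E. count_list (walk_edges ys) e)" using True by (intro sum_mono) auto
  also have "\<dots> = 2 * s" using assms by (simp add: sum_count_set length_walk_edges)
  finally have "card ?E \<le> s" by simp
  hence c: "card (set ys) \<le> Suc s" "card (set ys) - 1 \<le> card ?E" using card_walk_vertices[of ys] by auto
  have "\<bar>expect S r (\<lambda>G. walk_weight (link_mat G) ys)\<bar> = \<rho> ^ card (set ys) *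
     (\<Prod>e\<in>?E. \<bar>expect S r (\<lambda>G. (J e G - \<pi>) ^ count_list (walk_edges ys) e)\<bar>)"
    using True assms \<rho>_range by (subst expect_walk_weight) (auto simp: abs_mult abs_prod)
  also have "\<dots> \<le> \<rho> ^ card (set ys) * (\<Prod>e\<in>?E. \<pi>)"
    using True assms walk_edges_subset[of _ ys]
    by (intro mult_left_mono prod_mono conjI expect_centered_power_le zero_le_power \<rho>_range) auto
  also have "\<dots> \<le> \<rho> ^ card (set ys) * \<pi> ^ (card (set ys) - 1)"
    using c(2) \<pi>_range by (intro mult_left_mono zero_le_power \<rho>_range) (auto intro: power_decreasing)
  finally show ?thesis using c by simp
next
  case False
  have "expect S r (\<lambda>G. walk_weight (link_mat G) ys) = 0"
  proof (cases "\<forall>e\<in>set (walk_edges ys). card e = 2")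
    case True
    then obtain e where e: "e \<in> set (walk_edges ys)" "\<not> count_list (walk_edges ys) e \<ge> 2" using False by auto
    moreover have "count_list (walk_edges ys) e \<noteq> 0" using e by (simp add: count_list_0_iff)
    ultimately have "count_list (walk_edges ys) e = 1" by linarith
    hence "expect S r (\<lambda>G. (J e G - \<pi>) ^ count_list (walk_edges ys) e) = 0"
      using expect_centered_power[of e 1] e True walk_edges_subset[of e ys] assms(1) by simp
    hence "(\<Prod>e\<in>set (walk_edges ys). expect S r (\<lambda>G. (J e G - \<pi>) ^ count_list (walk_edges ys) e)) = 0"
      using e(1) by (intro prod_zero) auto
    thus ?thesis using expect_walk_weight[OF assms(1) _ True] assms by simp
  next
    case False
    hence "walk_weight (link_mat G) ys = 0" for G
      using walk_weight_link_mat[of ys G] assms by (auto simp: of_bool_def)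
    thus ?thesis by simp
  qed
  thus ?thesis using \<rho>_range \<pi>_range by simp
qed

text \<open>Walks are grouped by their number \<open>v\<close> of distinct vertices. The at most
  \<open>N ^ v * v ^ (2 * s + 1)\<close> walks of a group contribute through
  \<open>(N * \<rho>) * (N * \<rho> * \<pi>) ^ (v - 1)\<close>, largest at \<open>v = s + 1\<close>
  because \<open>N * \<rho> * \<pi> \<ge> 1\<close>; the \<open>s + 1\<close> groups supply the last
  factor \<open>s + 1\<close>.\<close>

lemma expect_trace_le:
  assumes "s > 0" "card A \<le> N" "1 \<le> real N * \<rho> * \<pi>"
  shows "expect S r (\<lambda>G. \<Sum>u\<in>A. mat_pow A (link_mat G) (2 * s) u u)
    \<le> real (s + 1) ^ (2 * s + 2) * (N * \<rho>) * (N * \<rho> * \<pi>) ^ s"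
proof -
  let ?L = "{ys. set ys \<subseteq> A \<and> length ys = Suc (2 * s)}"
  define b where "b = (\<lambda>v. \<rho> ^ v * \<pi> ^ (v - 1))"
  have fL: "finite ?L" using finite_A by (rule finite_lists_length_eq)
  have b0: "0 \<le> b v" for v using \<rho>_range \<pi>_range by (simp add: b_def)
  have "expect S r (\<lambda>G. \<Sum>u\<in>A. mat_pow A (link_mat G) (2 * s) u u)
    = (\<Sum>ys\<in>?L. of_bool (last ys = hd ys) * expect S r (\<lambda>G. walk_weight (link_mat G) ys))"
    unfolding trace_walks expect_sum expect_cmult ..
  also have "\<dots> \<le> (\<Sum>ys\<in>?L. of_bool (card (set ys) \<le> Suc s) * b (card (set ys)))"
  proof (intro sum_mono)
    fix ys assume "ys \<in> ?L"
    hence "\<bar>expect S r (\<lambda>G. walk_weight (link_mat G) ys)\<bar> \<le> of_bool (card (set ys) \<le> Suc s) * b (card (set ys))"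
      unfolding b_def using assms(1) by (intro expect_walk_weight_le) auto
    moreover have "of_bool (last ys = hd ys) * x \<le> \<bar>x\<bar>" for x :: real using abs_ge_self[of x] by (simp add: of_bool_def)
    ultimately show "of_bool (last ys = hd ys) * expect S r (\<lambda>G. walk_weight (link_mat G) ys)
      \<le> of_bool (card (set ys) \<le> Suc s) * b (card (set ys))" using order_trans by blast
  qed
  also have "\<dots> = (\<Sum>ys\<in>{ys\<in>?L. card (set ys) \<in> {1..Suc s}}. b (card (set ys)))"
  proof (rule sum.mono_neutral_cong_right[OF fL])
    show "\<forall>ys\<in>?L - {ys\<in>?L. card (set ys) \<in> {1..Suc s}}. of_bool (card (set ys) \<le> Suc s) * b (card (set ys)) = 0"
    proof
      fix ys assume ys: "ys \<in> ?L - {ys\<in>?L. card (set ys) \<in> {1..Suc s}}"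
      hence "0 < card (set ys)" by (auto simp: card_gt_0_iff)
      thus "of_bool (card (set ys) \<le> Suc s) * b (card (set ys)) = 0" using ys by auto
    qed
  qed auto
  also have "\<dots> = (\<Sum>v\<in>{1..Suc s}. \<Sum>ys\<in>{ys. ys \<in> {ys\<in>?L. card (set ys) \<in> {1..Suc s}} \<and> card (set ys) = v}. b (card (set ys)))"
    by (intro sum.group[symmetric] finite_subset[OF _ fL]) auto
  also have "\<dots> = (\<Sum>v\<in>{1..Suc s}. real (card {ys. set ys \<subseteq> A \<and> length ys = Suc (2 * s) \<and> card (set ys) = v}) * b v)"
  proof (intro sum.cong refl)
    fix v assume v: "v \<in> {1..Suc s}"
    have "{ys. ys \<in> {ys\<in>?L. card (set ys) \<in> {1..Suc s}} \<and> card (set ys) = v}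
      = {ys. set ys \<subseteq> A \<and> length ys = Suc (2 * s) \<and> card (set ys) = v}" using v by auto
    thus "(\<Sum>ys\<in>{ys. ys \<in> {ys\<in>?L. card (set ys) \<in> {1..Suc s}} \<and> card (set ys) = v}. b (card (set ys)))
      = real (card {ys. set ys \<subseteq> A \<and> length ys = Suc (2 * s) \<and> card (set ys) = v}) * b v" by simp
  qed
  also have "\<dots> \<le> (\<Sum>v\<in>{1..Suc s}. real (s + 1) ^ Suc (2 * s) * (N * \<rho>) * (N * \<rho> * \<pi>) ^ s)"
  proof (intro sum_mono)
    fix v assume v: "v \<in> {1..Suc s}"
    then obtain w where w: "v = Suc w" "w \<le> s" by (cases v) auto
    have "real (card {ys. set ys \<subseteq> A \<and> length ys = Suc (2 * s) \<and> card (set ys) = v}) \<le> real (N ^ v * v ^ Suc (2 * s))"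
      using card_lists_set_card[OF finite_A assms(2)] of_nat_le_iff by blast
    also have "\<dots> \<le> real N ^ v * real (s + 1) ^ Suc (2 * s)"
      using v by (auto intro!: mult_left_mono power_mono simp del: power_Suc)
    finally have "real (card {ys. set ys \<subseteq> A \<and> length ys = Suc (2 * s) \<and> card (set ys) = v}) * b v
       \<le> real N ^ v * real (s + 1) ^ Suc (2 * s) * b v" using b0 by (intro mult_right_mono)
    also have "\<dots> = real (s + 1) ^ Suc (2 * s) * (N * \<rho>) * (N * \<rho> * \<pi>) ^ w"
      unfolding b_def w(1) by (simp add: power_mult_distrib mult_ac)
    also have "\<dots> \<le> real (s + 1) ^ Suc (2 * s) * (N * \<rho>) * (N * \<rho> * \<pi>) ^ s"
      using w \<rho>_range assms(3) by (intro mult_left_mono power_increasing) auto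
    finally show "real (card {ys. set ys \<subseteq> A \<and> length ys = Suc (2 * s) \<and> card (set ys) = v}) * b v
       \<le> real (s + 1) ^ Suc (2 * s) * (N * \<rho>) * (N * \<rho> * \<pi>) ^ s" .
  qed
  also have "\<dots> = real (s + 1) ^ (2 * s + 2) * (N * \<rho>) * (N * \<rho> * \<pi>) ^ s"
    by (simp add: algebra_simps)
  finally show ?thesis .
qed

text \<open>On functions with zero sum the constant \<open>\<pi>\<close> removed from the entries only contributes a
  negative diagonal term.\<close>
lemma prob_link_quad_form:
  assumes "s > 0" "card A \<le> N" "1 \<le> real N * \<rho> * \<pi>" "0 < t"
  shows "prob S r (\<lambda>G. \<exists>f. (\<forall>v. f v \<noteq> 0 \<longrightarrow> v \<in> A \<and> J {v} G = 1) \<and> (\<Sum>v\<in>A. f v) = 0 \<and>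
       t * (\<Sum>v\<in>A. (f v)\<^sup>2) < (\<Sum>u\<in>A. \<Sum>v\<in>A - {u}. J {u, v} G * f u * f v))
     \<le> real (s + 1) ^ (2 * s + 2) * (N * \<rho>) * (N * \<rho> * \<pi>) ^ s / t ^ (2 * s)" (is "prob S r ?P \<le> _")
proof -
  let ?tr = "\<lambda>G. \<Sum>u\<in>A. mat_pow A (link_mat G) (2 * s) u u"
  have "prob S r ?P \<le> prob S r (\<lambda>G. t ^ (2 * s) \<le> ?tr G)"
  proof (rule prob_mono)
    fix G assume "?P G"
    then obtain f where f: "\<And>v. f v \<noteq> 0 \<Longrightarrow> v \<in> A \<and> J {v} G = 1" "(\<Sum>v\<in>A. f v) = 0"
       "t * (\<Sum>v\<in>A. (f v)\<^sup>2) < (\<Sum>u\<in>A. \<Sum>v\<in>A - {u}. J {u, v} G * f u * f v)" by blast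
    let ?n = "\<Sum>v\<in>A. (f v)\<^sup>2" and ?q = "\<Sum>u\<in>A. \<Sum>v\<in>A. link_mat G u v * f u * f v"
    have Jf: "J {v} G * f v = f v" for v using f(1)[of v] by (cases "f v = 0") auto
    have "?q = (\<Sum>u\<in>A. \<Sum>v\<in>A - {u}. link_mat G u v * f u * f v)"
      using finite_A by (intro sum.cong refl sum.mono_neutral_right) (auto simp: link_mat_def)
    also have "\<dots> = (\<Sum>u\<in>A. \<Sum>v\<in>A - {u}. J {u, v} G * f u * f v - \<pi> * (f u * f v))"
    proof (intro sum.cong refl)
      fix u v assume "v \<in> A - {u}"
      hence "link_mat G u v * f u * f v = (J {u} G * f u) * (J {v} G * f v) * (J {u, v} G - \<pi>)"
        by (auto simp: link_mat_def)
      thus "link_mat G u v * f u * f v = J {u, v} G * f u * f v - \<pi> * (f u * f v)"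
        unfolding Jf by (simp add: algebra_simps)
    qed
    also have "\<dots> = (\<Sum>u\<in>A. \<Sum>v\<in>A - {u}. J {u, v} G * f u * f v) - \<pi> * (\<Sum>u\<in>A. f u * (\<Sum>v\<in>A - {u}. f v))"
      by (simp add: sum_subtractf sum_distrib_left)
    \<comment> \<open>As \<open>f\<close> has zero sum, its values away from \<open>u\<close> add up
      to \<open>- f u\<close>.\<close>
    also have "(\<Sum>u\<in>A. f u * (\<Sum>v\<in>A - {u}. f v)) = - ?n"
      using finite_A f(2) by (simp add: sum_diff1 power2_eq_square sum_negf)
    finally have "t * ?n < ?q" using f(3) mult_nonneg_nonneg[OF \<pi>_range(1), of ?n] by (simp add: sum_nonneg)
    moreover have n0: "0 \<le> ?n" by (simp add: sum_nonneg)
    ultimately have lt: "(t * ?n) ^ (2 * s) < ?q ^ (2 * s)"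
      using assms by (intro power_strict_mono) auto
    also have "\<dots> \<le> ?tr G * ?n ^ (2 * s)"
      by (rule quad_form_le_trace[OF finite_A link_mat_sym assms(1)])
    finally have "t ^ (2 * s) * ?n ^ (2 * s) < ?tr G * ?n ^ (2 * s)" by (simp add: power_mult_distrib)
    thus "t ^ (2 * s) \<le> ?tr G" using n0
      by (meson linorder_not_le mult_right_mono zero_le_power order_less_imp_le)
  qed
  also have "\<dots> \<le> expect S r ?tr / t ^ (2 * s)"
    using assms trace_nonneg[OF finite_A link_mat_sym] by (intro prob_markov) auto
  also have "\<dots> \<le> real (s + 1) ^ (2 * s + 2) * (N * \<rho>) * (N * \<rho> * \<pi>) ^ s / t ^ (2 * s)"
    using assms by (intro divide_right_mono expect_trace_le) auto
  finally show ?thesis .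
qed

end

section \<open>The upper model and its dual\<close>

text \<open>\<open>G\<close> is the set of all \<open>T\<close> whose complement is not in \<open>X\<close>; it determines both \<open>Y\<close> and the Alexander
  dual of \<open>Y\<close>.\<close>
definition lower_of :: "nat \<Rightarrow> nat set set \<Rightarrow> nat set set" where
  "lower_of n G = {S. S \<subset> {0..n} \<and> (\<forall>T. T \<noteq> {} \<longrightarrow> T \<subseteq> S \<longrightarrow> T \<in> G)}"

definition upper_of :: "nat \<Rightarrow> nat set set \<Rightarrow> nat set set" where
  "upper_of n G = upper_closure ((\<lambda>T. {0..n} - T) ` (simps n - G))"

lemma finite_simps [simp]: "finite (simps n)"
  by (rule finite_subset[of _ "Pow {0..n}"]) (auto simp: simps_def)

lemma simps_subset: "T \<subseteq> S \<Longrightarrow> S \<subset> {0..n} \<Longrightarrow> T \<noteq> {} \<Longrightarrow> T \<in> simps n"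
  by (auto simp: simps_def)

lemma upper_prob_eq_prob:
  "upper_prob n q E = prob (simps n) (\<lambda>\<sigma>. 1 - q ({0..n} - \<sigma>)) (\<lambda>G. E (upper_of n G))"
proof -
  have b: "bij_betw (\<lambda>T. {0..n} - T) (simps n) (simps n)"
    by (rule bij_betw_byWitness[where f' = "\<lambda>T. {0..n} - T"]) (auto simp: simps_def)
  have "upper_prob n q E = expect (simps n) q (\<lambda>X. of_bool (E (upper_closure X)))"
    by (simp add: upper_prob_def expect_def of_bool_def)
  also have "\<dots> = prob (simps n) (\<lambda>\<sigma>. 1 - q ({0..n} - \<sigma>)) (\<lambda>G. E (upper_of n G))"
    unfolding prob_def upper_of_def by (rule expect_reindex[OF b]) auto
  finally show ?thesis .
qed

lemma mem_upper_of:
  "\<sigma> \<in> upper_of n G \<longleftrightarrow> \<sigma> \<noteq> {} \<and> \<sigma> \<subseteq> {0..n} \<and> (\<exists>T\<in>simps n - G. T \<subseteq> {0..n} - \<sigma>)"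
proof -
  have 1: "\<sigma> \<subseteq> {0..n} - T \<longleftrightarrow> \<sigma> \<subseteq> {0..n} \<and> T \<subseteq> {0..n} - \<sigma>" if "T \<in> simps n" for T
    using that by (auto simp: simps_def)
  have "\<sigma> \<in> upper_of n G \<longleftrightarrow> \<sigma> \<noteq> {} \<and> (\<exists>T\<in>simps n - G. \<sigma> \<subseteq> {0..n} - T)"
    by (auto simp: upper_of_def upper_closure_def)
  also have "(\<exists>T\<in>simps n - G. \<sigma> \<subseteq> {0..n} - T) \<longleftrightarrow> (\<exists>T\<in>simps n - G. \<sigma> \<subseteq> {0..n} \<and> T \<subseteq> {0..n} - \<sigma>)"
    by (intro bex_cong refl 1) auto
  finally show ?thesis by blast
qed

lemma full_notin_upper_of: "{0..n} \<notin> upper_of n G"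
  unfolding mem_upper_of simps_def by blast

lemma mem_lower_of:
  assumes "S \<subset> {0..n}" shows "S \<in> lower_of n G \<longleftrightarrow> Pow S - {{}} \<subseteq> G"
  using assms by (auto simp: lower_of_def)

lemma mem_lower_of_iff:
  assumes "S \<subset> {0..n}" shows "S \<in> lower_of n G \<longleftrightarrow> {0..n} - S \<notin> upper_of n G"
proof -
  have 1: "{0..n} - ({0..n} - S) = S" "{0..n} - S \<noteq> {}" "{0..n} - S \<subseteq> {0..n}" using assms by auto
  have "S \<in> lower_of n G \<longleftrightarrow> (\<forall>T. T \<noteq> {} \<longrightarrow> T \<subseteq> S \<longrightarrow> T \<in> G)"
    using assms by (simp add: lower_of_def)
  also have "\<dots> \<longleftrightarrow> \<not> (\<exists>T\<in>simps n - G. T \<subseteq> S)"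
    using simps_subset[OF _ assms] unfolding simps_def by blast
  also have "\<dots> \<longleftrightarrow> {0..n} - S \<notin> upper_of n G" unfolding mem_upper_of using 1 by simp
  finally show ?thesis .
qed

lemma complex_on_upper_of: "complex_on {0..n} (upper_of n G) n"
  by unfold_locales (unfold mem_upper_of, blast+)

lemma dual_upper_of: "complex_on.dual {0..n} (upper_of n G) = lower_of n G"
proof (intro set_eqI)
  interpret complex_on "{0..n}" "upper_of n G" n by (rule complex_on_upper_of)
  fix S
  show "S \<in> dual \<longleftrightarrow> S \<in> lower_of n G"
  proof (cases "S \<subset> {0..n}")
    case True
    thus ?thesis using mem_lower_of_iff[OF True] by (auto simp: dual_def)
  qed (auto simp: dual_def lower_of_def)
qed

section \<open>The skeleton defect read off from the dual complex\<close>

lemma finite_skel_set: "finite {k::int. -1 \<le> k \<and> k \<le> int n \<and> skeleton n k \<subseteq> Y}"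
  by (rule finite_subset[of _ "{-1..int n}"]) auto

text \<open>The empty skeleton is always contained in \<open>Y\<close>, so the \<open>Max\<close> in
  \<open>skel_defect\<close> is over a non-empty set.\<close>

lemma skel_set_minus_1: "-1 \<in> {k::int. -1 \<le> k \<and> k \<le> int n \<and> skeleton n k \<subseteq> Y}"
  by (auto simp: skeleton_def finite_subset)

lemma skeleton_skel_defect: "skeleton n (int n - skel_defect n Y) \<subseteq> Y"
proof -
  let ?K = "{k::int. -1 \<le> k \<and> k \<le> int n \<and> skeleton n k \<subseteq> Y}"
  have "Max ?K \<in> ?K" using finite_skel_set skel_set_minus_1 by (intro Max_in) blast+
  thus ?thesis by (simp add: skel_defect_def)
qed

lemma skel_defect_le:
  assumes "m \<le> Suc n" "skeleton n (int n - int m) \<subseteq> Y" shows "skel_defect n Y \<le> int m"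
proof -
  let ?K = "{k::int. -1 \<le> k \<and> k \<le> int n \<and> skeleton n k \<subseteq> Y}"
  have "int n - int m \<in> ?K" using assms by simp
  hence "int n - int m \<le> Max ?K" by (intro Max_ge finite_skel_set)
  thus ?thesis by (simp add: skel_defect_def)
qed

text \<open>The complement of a dual face with \<open>m\<close> vertices is a simplex of dimension
  \<open>n - m\<close> missing from \<open>Y\<close>.\<close>

lemma skel_defect_ge:
  assumes "S \<in> lower_of n G" shows "int (card S) + 1 \<le> skel_defect n (upper_of n G)"
proof -
  let ?k = "int n - skel_defect n (upper_of n G)"
  have S: "S \<subset> {0..n}" using assms by (auto simp: lower_of_def)
  have fS: "finite S" using S finite_subset by blast
  have "card S \<le> n + 1" using S card_mono[of "{0..n}" S] by auto
  hence c: "int (card ({0..n} - S)) = int n + 1 - int (card S)"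
    using S fS by (auto simp: card_Diff_subset of_nat_diff)
  have "{0..n} - S \<notin> upper_of n G" using mem_lower_of_iff[OF S] assms by auto
  hence "{0..n} - S \<notin> skeleton n ?k" using skeleton_skel_defect by blast
  thus ?thesis using S c by (auto simp: skeleton_def)
qed

text \<open>A simplex of dimension at most \<open>n - m\<close> leaves at least \<open>m\<close>
  vertices outside. Any \<open>m\<close> of them form a non-face of the dual and so contain a set
  not in \<open>G\<close>, whose complement is in \<open>X\<close> and contains the simplex.\<close>

lemma skeleton_upper_of:
  assumes "m \<le> n" "\<And>S. S \<in> lower_of n G \<Longrightarrow> card S \<noteq> m"
  shows "skeleton n (int n - int m) \<subseteq> upper_of n G"
proof
  fix \<sigma> assume "\<sigma> \<in> skeleton n (int n - int m)"
  hence \<sigma>: "\<sigma> \<subseteq> {0..n}" "\<sigma> \<noteq> {}" "int (card \<sigma>) \<le> int n - int m + 1" by (auto simp: skeleton_def)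
  have "finite \<sigma>" using \<sigma>(1) finite_subset by blast
  hence "m \<le> card ({0..n} - \<sigma>)" using \<sigma> assms(1) by (auto simp: card_Diff_subset)
  then obtain S where S: "S \<subseteq> {0..n} - \<sigma>" "card S = m" using obtain_subset_with_card_n by metis
  hence "S \<notin> lower_of n G" "S \<subset> {0..n}" using assms(2) \<sigma> by auto
  then obtain T where "T \<noteq> {}" "T \<subseteq> S" "T \<notin> G" by (auto simp: lower_of_def)
  hence "T \<in> simps n - G" "T \<subseteq> {0..n} - \<sigma>" using S \<open>S \<subset> {0..n}\<close> simps_subset by auto
  thus "\<sigma> \<in> upper_of n G" using \<sigma> unfolding mem_upper_of by blast
qed

text \<open>\<open>r T\<close> is the probability that \<open>T\<close> lies in \<open>G\<close>; in
  the application \<open>lo\<close> and \<open>hi\<close> are the dual numbers \<open>a'\<close> and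
  \<open>A'\<close>.\<close>

locale medial = 
  fixes n :: nat and r :: "nat set \<Rightarrow> real" and lo hi :: real
  assumes lo_hi: "0 < lo" "lo \<le> hi"
    and r_bounds: "\<And>T. T \<in> simps n \<Longrightarrow> exp (- hi) \<le> r T \<and> r T \<le> exp (- lo)"
begin

lemma exp_lo_le_1: "exp (- lo) \<le> 1" using lo_hi by simp

sublocale bernoulli_family "simps n" r
proof
  fix x assume "x \<in> simps n"
  thus "0 \<le> r x \<and> r x \<le> 1" using r_bounds[of x] exp_lo_le_1 exp_ge_zero[of "- hi"] by linarith
qed simp

definition face_prob :: "nat set \<Rightarrow> real" where
  "face_prob S = (\<Prod>T\<in>Pow S - {{}}. r T)"

lemma expect_face:
  assumes "S \<subset> {0..n}"
  shows "expect (simps n) r (\<lambda>G. of_bool (S \<in> lower_of n G)) = face_prob S"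
proof -
  have "S \<in> lower_of n G \<longleftrightarrow> Pow S - {{}} \<subseteq> G" for G by (rule mem_lower_of[OF assms])
  moreover have "Pow S - {{}} \<subseteq> simps n" using simps_subset[OF _ assms] by auto
  ultimately show ?thesis by (simp only: expect_subset[OF finite_simps] face_prob_def)
qed

lemma card_Pow_nonempty: "finite S \<Longrightarrow> card (Pow S - {{}}) = 2 ^ card S - 1"
  by (simp add: card_Diff_subset card_Pow)

lemma face_prob_le:
  assumes "S \<subset> {0..n}" shows "face_prob S \<le> exp (- lo * (2 ^ card S - 1))"
proof -
  have fS: "finite S" using assms finite_subset by blast
  have "face_prob S \<le> (\<Prod>T\<in>Pow S - {{}}. exp (- lo))"
    unfolding face_prob_def using r_bounds r_range simps_subset[OF _ assms] by (intro prod_mono) auto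
  also have "\<dots> = exp (- lo) ^ (2 ^ card S - 1)" unfolding prod_constant card_Pow_nonempty[OF fS] ..
  also have "\<dots> = exp (- lo * (2 ^ card S - 1))"
    by (simp add: exp_of_nat_mult[symmetric] of_nat_diff mult.commute)
  finally show ?thesis .
qed

lemma face_prob_ge:
  assumes "S \<subset> {0..n}" shows "exp (- hi * (2 ^ card S - 1)) \<le> face_prob S"
proof -
  have fS: "finite S" using assms finite_subset by blast
  have "exp (- hi * (2 ^ card S - 1)) = exp (- hi) ^ (2 ^ card S - 1)"
    by (simp add: exp_of_nat_mult[symmetric] of_nat_diff mult.commute)
  also have "\<dots> = (\<Prod>T\<in>Pow S - {{}}. exp (- hi))" unfolding prod_constant card_Pow_nonempty[OF fS] ..
  also have "\<dots> \<le> face_prob S"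
    unfolding face_prob_def using r_bounds simps_subset[OF _ assms] by (intro prod_mono) auto
  finally show ?thesis .
qed

text \<open>The dimension drops only if none of the \<open>n + 1\<close> facets of the simplex is in
  \<open>X\<close>, that is if all singletons are in \<open>G\<close>.\<close>

lemma prob_cdim:
  assumes "n \<ge> 1"
  shows "prob (simps n) r (\<lambda>G. cdim (upper_of n G) \<noteq> int n - 1) \<le> exp (- lo * real (n + 1))"
proof -
  let ?A = "(\<lambda>v. {v}) ` {0..n}"
  have inj: "inj_on (\<lambda>v. {v}) {0..n}" by (auto simp: inj_on_def)
  have "{v} \<noteq> {0..n}" for v
  proof
    assume "{v} = {0..n}"
    hence "card {v} = card {0..n}" by simp
    thus False using assms by simp
  qed
  hence sub: "?A \<subseteq> simps n" by (auto simp: simps_def)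
  have "prob (simps n) r (\<lambda>G. cdim (upper_of n G) \<noteq> int n - 1) \<le> prob (simps n) r (\<lambda>G. ?A \<subseteq> G)"
  proof (rule prob_mono, rule ccontr)
    fix G assume neq: "cdim (upper_of n G) \<noteq> int n - 1" and "\<not> ?A \<subseteq> G"
    then obtain v where v: "v \<le> n" "{v} \<notin> G" unfolding image_subset_iff by (meson atLeastAtMost_iff)
    interpret complex_on "{0..n}" "upper_of n G" n by (rule complex_on_upper_of)
    let ?\<sigma> = "{0..n} - {v}"
    have c\<sigma>: "card ?\<sigma> = n" using v by simp
    have "?\<sigma> \<noteq> {}"
    proof
      assume "?\<sigma> = {}"
      with c\<sigma> assms show False by (metis card.empty not_one_le_zero)
    qed
    moreover have "{v} \<in> simps n - G" using sub v by (simp add: image_subset_iff)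
    ultimately have \<sigma>: "?\<sigma> \<in> upper_of n G" using v unfolding mem_upper_of
      by (intro conjI bexI[of _ "{v}"]) auto
    have "Max (card ` upper_of n G) = n"
    proof (rule Max_eqI)
      fix y assume "y \<in> card ` upper_of n G"
      then obtain \<tau> where \<tau>: "\<tau> \<in> upper_of n G" "y = card \<tau>" by auto
      hence "\<tau> \<subset> {0..n}" using Y_sub full_notin_upper_of by blast
      hence "card \<tau> < card {0..n}" by (intro psubset_card_mono) auto
      thus "y \<le> n" using \<tau> by simp
    qed (use \<sigma> c\<sigma> in \<open>auto intro!: rev_image_eqI\<close>)
    moreover have "upper_of n G \<noteq> {}" using \<sigma> by blast
    ultimately show False using neq by (simp add: cdim_def)
  qed
  also have "\<dots> = (\<Prod>v\<in>{0..n}. r {v})"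
    unfolding prob_def expect_subset[OF finite_simps sub] prod.reindex[OF inj] by simp
  also have "\<dots> \<le> (\<Prod>v\<in>{0..n}. exp (- lo))"
    using sub r_bounds r_range by (intro prod_mono) (simp add: image_subset_iff)
  also have "\<dots> = exp (- lo * real (n + 1))"
    by (simp add: exp_of_nat_mult[symmetric] mult.commute exp_add[symmetric] algebra_simps)
  finally show ?thesis .
qed

lemma prob_skel_defect_gt:
  assumes "m \<le> n"
  shows "prob (simps n) r (\<lambda>G. skel_defect n (upper_of n G) > int m) \<le> real (n + 1) ^ m * exp (- lo * (2 ^ m - 1))"
proof -
  let ?F = "{S. S \<subseteq> {0..n} \<and> card S = m}"
  have fF: "finite ?F" by (rule finite_subset[of _ "Pow {0..n}"]) auto
  have pr: "S \<subset> {0..n}" if "S \<in> ?F" for S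
    using that assms by (auto simp: psubset_eq)
  have "prob (simps n) r (\<lambda>G. skel_defect n (upper_of n G) > int m) \<le> prob (simps n) r (\<lambda>G. \<exists>S\<in>?F. S \<in> lower_of n G)"
  proof (rule prob_mono, rule ccontr)
    fix G assume gt: "skel_defect n (upper_of n G) > int m" and no: "\<not> (\<exists>S\<in>?F. S \<in> lower_of n G)"
    have "card S \<noteq> m" if "S \<in> lower_of n G" for S
      using that no unfolding lower_of_def by blast
    hence "skeleton n (int n - int m) \<subseteq> upper_of n G" by (rule skeleton_upper_of[OF assms])
    hence "skel_defect n (upper_of n G) \<le> int m" using assms by (intro skel_defect_le) auto
    thus False using gt by simp
  qed
  also have "\<dots> \<le> (\<Sum>S\<in>?F. prob (simps n) r (\<lambda>G. S \<in> lower_of n G))" by (rule prob_Bex[OF fF])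
  also have "\<dots> \<le> (\<Sum>S\<in>?F. exp (- lo * (2 ^ m - 1)))"
  proof (intro sum_mono)
    fix S assume S: "S \<in> ?F"
    show "prob (simps n) r (\<lambda>G. S \<in> lower_of n G) \<le> exp (- lo * (2 ^ m - 1))"
      unfolding prob_def expect_face[OF pr[OF S]] using face_prob_le[OF pr[OF S]] S by simp
  qed
  also have "\<dots> = real ((n + 1) choose m) * exp (- lo * (2 ^ m - 1))"
    using n_subsets[of "{0..n}" m] by simp
  also have "\<dots> \<le> real ((n + 1) ^ m) * exp (- lo * (2 ^ m - 1))"
    using assms binomial_le_pow[of m "n + 1"] by (intro mult_right_mono) (auto simp flip: of_nat_power)
  finally show ?thesis by simp
qed

end

section \<open>Second moment bound for the number of dual faces\<close>

lemma binomial_sub_le: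
  assumes "i \<le> m" "m \<le> N"
  shows "real ((N - i) choose (m - i)) \<le> real (N choose m) * (real m / real N) ^ i"
  using assms(1)
proof (induction i)
  case (Suc i)
  obtain k where k: "m - i = Suc k" using Suc.prems by (metis Suc_diff_Suc Suc_le_lessD)
  obtain M where M: "N - i = Suc M" using Suc.prems assms(2) by (metis Suc_diff_Suc Suc_le_lessD order_trans)
  have eq: "m - Suc i = k" "N - Suc i = M" using k M by auto
  have "real (Suc k) * real (Suc M choose Suc k) = real (Suc M) * real (M choose k)"
    by (metis Suc_times_binomial_eq of_nat_mult mult.commute)
  hence "real (M choose k) = real (Suc M choose Suc k) * (real (Suc k) / real (Suc M))"
    by (simp add: field_simps)
  also have "\<dots> \<le> real (Suc M choose Suc k) * (real m / real N)"
  proof (intro mult_left_mono)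
    have eqs: "real (Suc k) = real m - real i" "real (Suc M) = real N - real i"
      using k M by linarith+
    have pos: "real N - real i > 0" "real N > 0" using M eqs(2) by linarith+
    have "real i * real m \<le> real i * real N" using assms(2) by (intro mult_left_mono) auto
    hence "(real m - real i) * real N \<le> real m * (real N - real i)" by (simp add: algebra_simps)
    thus "real (Suc k) / real (Suc M) \<le> real m / real N"
      unfolding eqs using pos by (simp add: pos_divide_le_eq pos_le_divide_eq)
  qed simp
  also have "\<dots> \<le> (real (N choose m) * (real m / real N) ^ i) * (real m / real N)"
    using Suc k M by (intro mult_right_mono) auto
  finally show ?case by (simp add: eq mult_ac)
qed simp

lemma card_supersets_le:
  assumes "finite V" "I \<subseteq> V" "card I \<le> m" "m \<le> card V"
  shows "real (card {S. S \<subseteq> V \<and> card S = m \<and> I \<subseteq> S}) \<le> real (card V choose m) * (real m / real (card V)) ^ card I"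
proof -
  have fI: "finite I" using assms finite_subset by auto
  have "bij_betw (\<lambda>S. S - I) {S. S \<subseteq> V \<and> card S = m \<and> I \<subseteq> S} {K. K \<subseteq> V - I \<and> card K = m - card I}"
  proof (rule bij_betw_byWitness[where f' = "\<lambda>K. K \<union> I"])
    show "(\<lambda>K. K \<union> I) ` {K. K \<subseteq> V - I \<and> card K = m - card I} \<subseteq> {S. S \<subseteq> V \<and> card S = m \<and> I \<subseteq> S}"
    proof safe
      fix K assume K: "K \<subseteq> V - I" "card K = m - card I"
      have "finite K" using K assms finite_subset by blast
      thus "card (K \<union> I) = m" using K assms fI by (subst card_Un_disjoint) auto
    qed (use assms in auto)
  qed (use fI in \<open>auto simp: card_Diff_subset\<close>)
  hence "card {S. S \<subseteq> V \<and> card S = m \<and> I \<subseteq> S} = (card V - card I) choose (m - card I)"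
    using assms fI n_subsets[of "V - I" "m - card I"] by (auto simp: bij_betw_same_card card_Diff_subset)
  thus ?thesis using binomial_sub_le[OF assms(3,4)] by simp
qed

context medial
begin

text \<open>Two faces require the union of two families of subsets, whose intersection is the family
  of \<open>S \<inter> S'\<close>; the multiplied form is inclusion-exclusion for products.\<close>

lemma expect_two_faces:
  assumes "S \<subset> {0..n}" "S' \<subset> {0..n}"
  shows "expect (simps n) r (\<lambda>G. of_bool (S \<in> lower_of n G) * of_bool (S' \<in> lower_of n G)) * face_prob (S \<inter> S')
      = face_prob S * face_prob S'"
proof -
  let ?P = "\<lambda>S. Pow S - {{}}"
  have fin: "finite S" "finite S'" using assms finite_subset by blast+
  have "of_bool (S \<in> lower_of n G) * of_bool (S' \<in> lower_of n G) = (of_bool (?P S \<union> ?P S' \<subseteq> G) :: real)" for G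
    unfolding mem_lower_of[OF assms(1)] mem_lower_of[OF assms(2)] Un_subset_iff of_bool_conj ..
  moreover have "?P S \<union> ?P S' \<subseteq> simps n"
    using simps_subset[OF _ assms(1)] simps_subset[OF _ assms(2)] by blast
  ultimately have "expect (simps n) r (\<lambda>G. of_bool (S \<in> lower_of n G) * of_bool (S' \<in> lower_of n G)) = (\<Prod>T\<in>?P S \<union> ?P S'. r T)"
    by (simp only: expect_subset[OF finite_simps])
  moreover have "face_prob (S \<inter> S') = (\<Prod>T\<in>?P S \<inter> ?P S'. r T)"
    unfolding face_prob_def by (intro prod.cong) auto
  ultimately show ?thesis unfolding face_prob_def using fin by (simp add: prod.union_inter)
qed

lemma face_prob_pos: "S \<subset> {0..n} \<Longrightarrow> 0 < face_prob S"
  using face_prob_ge exp_gt_zero order_less_le_trans by blast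

text \<open>Second moment method; dividing each indicator by its probability makes it insensitive to the
  inhomogeneity of the parameters.\<close>
lemma prob_no_face:
  assumes "m \<le> n"
  shows "prob (simps n) r (\<lambda>G. \<forall>S. S \<subseteq> {0..n} \<longrightarrow> card S = m \<longrightarrow> S \<notin> lower_of n G)
     \<le> (\<Sum>i=1..m. (real m ^ 2 / real (n + 1)) ^ i * exp (hi * 2 ^ i))"
proof -
  let ?F = "{S. S \<subseteq> {0..n} \<and> card S = m}" and ?E = "expect (simps n) r"
  define M where "M = real ((n + 1) choose m)"
  define b where "b = (\<Sum>i=1..m. (real m ^ 2 / real (n + 1)) ^ i * exp (hi * 2 ^ i))"
  define Z where "Z = (\<lambda>S G. of_bool (S \<in> lower_of n G) / face_prob S)"
  have fF: "finite ?F" by (rule finite_subset[of _ "Pow {0..n}"]) auto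
  have M: "real (card ?F) = M" unfolding M_def using n_subsets[of "{0..n}" m] by simp
  have Mpos: "M > 0" unfolding M_def using assms by simp
  have pr: "S \<subset> {0..n}" if "S \<in> ?F" for S using that assms by (auto simp: psubset_eq)
  have EZ: "?E (Z S) = 1" if "S \<in> ?F" for S
  proof -
    have "?E (Z S) = ?E (\<lambda>G. (1 / face_prob S) * of_bool (S \<in> lower_of n G))" by (simp add: Z_def)
    also have "\<dots> = 1" unfolding expect_cmult expect_face[OF pr[OF that]] using face_prob_pos[OF pr[OF that]] by simp
    finally show ?thesis .
  qed
  have EZZ: "?E (\<lambda>G. Z S G * Z S' G) = 1 / face_prob (S \<inter> S')" if "S \<in> ?F" "S' \<in> ?F" for S S'
  proof -
    have p: "face_prob S > 0" "face_prob S' > 0" "face_prob (S \<inter> S') > 0"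
      using pr[OF that(1)] pr[OF that(2)] by (auto intro!: face_prob_pos)
    have "?E (\<lambda>G. Z S G * Z S' G) = ?E (\<lambda>G. (1 / (face_prob S * face_prob S')) * (of_bool (S \<in> lower_of n G) * of_bool (S' \<in> lower_of n G)))"
      by (simp add: Z_def)
    also have "\<dots> = 1 / face_prob (S \<inter> S')" unfolding expect_cmult
      using expect_two_faces[OF pr[OF that(1)] pr[OF that(2)]] p by (simp add: field_simps)
    finally show ?thesis .
  qed
  have inner: "(\<Sum>S'\<in>?F. 1 / face_prob (S \<inter> S') - 1) \<le> M * b" if S: "S \<in> ?F" for S
  proof -
    have fS: "finite S" using S finite_subset by blast
    let ?I = "Pow S - {{}}"
    \<comment> \<open>Only \<open>I = S \<inter> S'\<close> is needed on the right. Allowing all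
      non-empty \<open>I\<close> in \<open>S\<close> turns the sum into a count of supersets of
      \<open>I\<close>.\<close>
    have "(\<Sum>S'\<in>?F. 1 / face_prob (S \<inter> S') - 1) \<le> (\<Sum>S'\<in>?F. \<Sum>I\<in>?I. of_bool (I \<subseteq> S') * exp (hi * 2 ^ card I))"
    proof (intro sum_mono)
      fix S' assume S': "S' \<in> ?F"
      show "1 / face_prob (S \<inter> S') - 1 \<le> (\<Sum>I\<in>?I. of_bool (I \<subseteq> S') * exp (hi * 2 ^ card I))"
      proof (cases "S \<inter> S' = {}")
        case True
        hence "face_prob (S \<inter> S') = 1" by (simp add: face_prob_def)
        thus ?thesis by (simp add: sum_nonneg)
      next
        case False
        let ?K = "S \<inter> S'"
        have "?K \<subset> {0..n}" using pr[OF S] by auto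
        hence "1 / face_prob ?K \<le> 1 / exp (- hi * (2 ^ card ?K - 1))"
          by (intro divide_left_mono face_prob_ge mult_pos_pos face_prob_pos) auto
        also have "\<dots> = exp (hi * (2 ^ card ?K - 1))"
          by (simp only: mult_minus_left exp_minus inverse_eq_divide) simp
        also have "\<dots> \<le> of_bool (?K \<subseteq> S') * exp (hi * 2 ^ card ?K)"
          using lo_hi by (simp add: mult_left_mono)
        also have "\<dots> \<le> (\<Sum>I\<in>?I. of_bool (I \<subseteq> S') * exp (hi * 2 ^ card I))"
          by (rule member_le_sum) (use False fS in auto)
        finally show ?thesis by simp
      qed
    qed
    also have "\<dots> = (\<Sum>I\<in>?I. real (card {S'. S' \<subseteq> {0..n} \<and> card S' = m \<and> I \<subseteq> S'}) * exp (hi * 2 ^ card I))"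
    proof (subst sum.swap, intro sum.cong refl)
      fix I
      have "(\<Sum>S'\<in>?F. of_bool (I \<subseteq> S') * exp (hi * 2 ^ card I)) = (\<Sum>S'\<in>{S'. S' \<subseteq> {0..n} \<and> card S' = m \<and> I \<subseteq> S'}. exp (hi * 2 ^ card I))"
        using fF by (intro sum.mono_neutral_cong_right) auto
      thus "(\<Sum>S'\<in>?F. of_bool (I \<subseteq> S') * exp (hi * 2 ^ card I)) = real (card {S'. S' \<subseteq> {0..n} \<and> card S' = m \<and> I \<subseteq> S'}) * exp (hi * 2 ^ card I)"
        by simp
    qed
    also have "\<dots> \<le> (\<Sum>I\<in>?I. M * (real m / real (n + 1)) ^ card I * exp (hi * 2 ^ card I))"
    proof (intro sum_mono mult_right_mono)
      fix I assume I: "I \<in> ?I"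
      have "card I \<le> m" using I S fS card_mono[of S I] by auto
      thus "real (card {S'. S' \<subseteq> {0..n} \<and> card S' = m \<and> I \<subseteq> S'}) \<le> M * (real m / real (n + 1)) ^ card I"
        using card_supersets_le[of "{0..n}" I m] I S assms unfolding M_def by auto
    qed simp
    also have "\<dots> = (\<Sum>i=1..m. \<Sum>I\<in>{I. I \<in> ?I \<and> card I = i}. M * (real m / real (n + 1)) ^ card I * exp (hi * 2 ^ card I))"
    proof (rule sum.group[symmetric])
      show "card ` ?I \<subseteq> {1..m}"
      proof (rule image_subsetI)
        fix I assume "I \<in> ?I"
        hence I: "I \<subseteq> S" "I \<noteq> {}" by auto
        hence "finite I" using fS finite_subset by auto
        thus "card I \<in> {1..m}" using I S card_mono[OF fS I(1)] by (auto simp: Suc_le_eq card_gt_0_iff)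
      qed
    qed (use fS in auto)
    also have "\<dots> \<le> (\<Sum>i=1..m. M * ((real m ^ 2 / real (n + 1)) ^ i * exp (hi * 2 ^ i)))"
    proof (intro sum_mono)
      fix i assume i: "i \<in> {1..m}"
      have "{I. I \<in> ?I \<and> card I = i} = {I. I \<subseteq> S \<and> card I = i}" using i by auto
      hence c: "card {I. I \<in> ?I \<and> card I = i} = m choose i" using n_subsets[OF fS, of i] S by simp
      have "(\<Sum>I\<in>{I. I \<in> ?I \<and> card I = i}. M * (real m / real (n + 1)) ^ card I * exp (hi * 2 ^ card I))
        = real (m choose i) * (M * (real m / real (n + 1)) ^ i * exp (hi * 2 ^ i))"
        unfolding c[symmetric] by simp
      also have "\<dots> \<le> real (m ^ i) * (M * (real m / real (n + 1)) ^ i * exp (hi * 2 ^ i))"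
        using binomial_le_pow[of i m] i Mpos by (intro mult_right_mono) (auto simp flip: of_nat_power)
      also have "\<dots> = M * ((real m ^ 2 / real (n + 1)) ^ i * exp (hi * 2 ^ i))"
        by (simp add: power_divide power_mult_distrib power2_eq_square)
      finally show "(\<Sum>I\<in>{I. I \<in> ?I \<and> card I = i}. M * (real m / real (n + 1)) ^ card I * exp (hi * 2 ^ card I))
         \<le> M * ((real m ^ 2 / real (n + 1)) ^ i * exp (hi * 2 ^ i))" .
    qed
    also have "\<dots> = M * b" by (simp add: b_def sum_distrib_left)
    finally show ?thesis .
  qed
  \<comment> \<open>Chebyshev: without faces the sum of the \<open>Z S\<close> is 0, at distance
    \<open>M\<close> from its mean \<open>M\<close>.\<close>
  have "prob (simps n) r (\<lambda>G. \<forall>S. S \<subseteq> {0..n} \<longrightarrow> card S = m \<longrightarrow> S \<notin> lower_of n G)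
     \<le> prob (simps n) r (\<lambda>G. M\<^sup>2 \<le> ((\<Sum>S\<in>?F. Z S G) - M)\<^sup>2)"
    by (intro prob_mono) (simp add: Z_def)
  also have "\<dots> \<le> ?E (\<lambda>G. ((\<Sum>S\<in>?F. Z S G) - M)\<^sup>2) / M\<^sup>2" using Mpos by (intro prob_markov) auto
  also have "?E (\<lambda>G. ((\<Sum>S\<in>?F. Z S G) - M)\<^sup>2) = (\<Sum>S\<in>?F. \<Sum>S'\<in>?F. 1 / face_prob (S \<inter> S') - 1)"
  proof -
    have "((\<Sum>S\<in>?F. Z S G) - M)\<^sup>2 = (\<Sum>S\<in>?F. \<Sum>S'\<in>?F. Z S G * Z S' G - 1) - 2 * M * ((\<Sum>S\<in>?F. Z S G - 1))" for G
      by (simp add: power2_eq_square algebra_simps sum_subtractf sum_product M)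
    hence "?E (\<lambda>G. ((\<Sum>S\<in>?F. Z S G) - M)\<^sup>2) = (\<Sum>S\<in>?F. \<Sum>S'\<in>?F. ?E (\<lambda>G. Z S G * Z S' G - 1)) - 2 * M * (\<Sum>S\<in>?F. ?E (\<lambda>G. Z S G - 1))"
      by (simp only: expect_diff expect_sum expect_cmult)
    also have "\<dots> = (\<Sum>S\<in>?F. \<Sum>S'\<in>?F. 1 / face_prob (S \<inter> S') - 1)"
      by (simp add: expect_diff EZ EZZ)
    finally show ?thesis .
  qed
  also have "\<dots> \<le> (\<Sum>S\<in>?F. M * b)" by (intro sum_mono inner)
  also have "\<dots> = M\<^sup>2 * b" by (simp add: M power2_eq_square)
  finally show ?thesis using Mpos unfolding b_def by (simp add: divide_right_mono)
qed

lemma prob_skel_defect_lt: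
  assumes "m \<le> n"
  shows "prob (simps n) r (\<lambda>G. skel_defect n (upper_of n G) < int m + 1)
    \<le> (\<Sum>i=1..m. (real m ^ 2 / real (n + 1)) ^ i * exp (hi * 2 ^ i))"
  by (rule order_trans[OF prob_mono prob_no_face[OF assms]]) (use skel_defect_ge in fastforce)

end

section \<open>Degrees and links in the homogeneous case\<close>

text \<open>If a set of size \<open>k\<close> lies in \<open>G\<close> with probability \<open>g k\<close>, this is the probability that the union of a
  set of size \<open>i\<close> with every subset of a disjoint set of size \<open>l\<close> lies in \<open>G\<close>; the recursion is
  Pascal's.\<close>
fun cone_prob :: "(nat \<Rightarrow> real) \<Rightarrow> nat \<Rightarrow> nat \<Rightarrow> real" where
  "cone_prob g i 0 = g i"
| "cone_prob g i (Suc l) = cone_prob g i l * cone_prob g (Suc i) l"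

lemma prod_Pow_card:
  assumes "finite \<sigma>" shows "(\<Prod>T\<in>Pow \<sigma>. g (card T + i)) = cone_prob g i (card \<sigma>)"
  using assms
proof (induction \<sigma> arbitrary: i rule: finite_induct)
  case (insert v \<sigma>)
  have inj: "inj_on (insert v) (Pow \<sigma>)" using insert.hyps by (auto simp: inj_on_def)
  have "(\<Prod>T\<in>Pow (insert v \<sigma>). g (card T + i)) = (\<Prod>T\<in>Pow \<sigma>. g (card T + i)) * (\<Prod>T\<in>insert v ` Pow \<sigma>. g (card T + i))"
    unfolding Pow_insert using insert.hyps by (intro prod.union_disjoint) auto
  also have "(\<Prod>T\<in>insert v ` Pow \<sigma>. g (card T + i)) = (\<Prod>T\<in>Pow \<sigma>. g (card T + Suc i))"
    unfolding prod.reindex[OF inj]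
  proof (intro prod.cong refl)
    fix T assume "T \<in> Pow \<sigma>"
    hence "finite T" "v \<notin> T" using insert.hyps finite_subset by auto
    thus "((\<lambda>T. g (card T + i)) \<circ> insert v) T = g (card T + Suc i)" by simp
  qed
  finally show ?case using insert.hyps insert.IH[of i] insert.IH[of "Suc i"] by simp
qed simp

lemma cone_prob_bounds:
  assumes "\<And>i. exp (- hi) \<le> g i \<and> g i \<le> 1"
  shows "exp (- hi * 2 ^ l) \<le> cone_prob g i l \<and> cone_prob g i l \<le> 1"
proof (induction l arbitrary: i)
  case (Suc l)
  have "exp (- hi * 2 ^ Suc l) = exp (- hi * 2 ^ l) * exp (- hi * 2 ^ l)" by (simp flip: exp_add)
  also have "\<dots> \<le> cone_prob g i l * cone_prob g (Suc i) l"
    using Suc by (intro mult_mono) (auto intro: order_trans[OF exp_ge_zero])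
  moreover have "cone_prob g i l * cone_prob g (Suc i) l \<le> 1 * 1"
    using Suc by (intro mult_mono) (auto intro: order_trans[OF exp_ge_zero])
  ultimately show ?case by simp
qed (use assms in simp)

definition join_faces :: "nat set \<Rightarrow> nat set \<Rightarrow> nat set set" where
  "join_faces \<sigma> e = (\<lambda>T. T \<union> e) ` Pow \<sigma>"

lemma insert_in_lower_of:
  assumes "v \<notin> S" "insert v S \<subset> {0..n}"
  shows "insert v S \<in> lower_of n G \<longleftrightarrow> S \<in> lower_of n G \<and> join_faces S {v} \<subseteq> G"
proof -
  have S: "S \<subset> {0..n}" using assms by auto
  have "Pow (insert v S) - {{}} = (Pow S - {{}}) \<union> join_faces S {v}"
    unfolding Pow_insert join_faces_def by auto
  thus ?thesis unfolding mem_lower_of[OF S] mem_lower_of[OF assms(2)] by simp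
qed

text \<open>If \<open>u\<close> is already a vertex of the link of \<open>S\<close>, adjacency of
  \<open>u\<close> and \<open>v\<close> depends only on the sets containing both.\<close>

lemma join_faces_insert: "join_faces (insert v S) {u} = join_faces S {u} \<union> join_faces S {u, v}"
proof -
  have "insert v T \<union> {u} = T \<union> {u, v}" for T by auto
  thus ?thesis unfolding join_faces_def Pow_insert image_Un image_image by simp
qed

text \<open>The part of a member outside \<open>\<sigma>\<close> determines \<open>e\<close>. This
  is the source of independence within a link.\<close>

lemma join_faces_disjoint:
  assumes "e \<inter> \<sigma> = {}" "e' \<inter> \<sigma> = {}" "e \<noteq> e'"
  shows "join_faces \<sigma> e \<inter> join_faces \<sigma> e' = {}"
proof -
  have "e = e'" if "T \<union> e = T' \<union> e'" "T \<subseteq> \<sigma>" "T' \<subseteq> \<sigma>" for T T'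
    using that assms by blast
  thus ?thesis using assms(3) unfolding join_faces_def by auto
qed

text \<open>The bounds on \<open>g\<close> also cover sizes that do not occur, so the bounds on
  \<open>cone_prob\<close> carry no side conditions.\<close>

locale homogeneous_medial = medial +
  fixes g :: "nat \<Rightarrow> real"
  assumes r_card: "\<And>T. T \<in> simps n \<Longrightarrow> r T = g (card T)"
    and g_bounds: "\<And>i. exp (- hi) \<le> g i \<and> g i \<le> 1"
begin

abbreviation joined :: "nat set \<Rightarrow> nat set \<Rightarrow> nat set set \<Rightarrow> real" where
  "joined \<sigma> e G \<equiv> of_bool (join_faces \<sigma> e \<subseteq> G)"

lemma cone_bounds: "exp (- hi * 2 ^ l) \<le> cone_prob g i l \<and> cone_prob g i l \<le> 1"
  by (rule cone_prob_bounds) (rule g_bounds)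

lemma cone_prob_pos: "0 < cone_prob g i l"
  using cone_bounds[of l i] exp_gt_zero order_less_le_trans by blast

lemma joined_depends: "depends (join_faces \<sigma> e) (joined \<sigma> e)"
  by (auto simp: depends_def)

lemma expect_joined:
  assumes "\<sigma> \<union> e \<subset> {0..n}" "e \<inter> \<sigma> = {}" "e \<noteq> {}"
  shows "expect (simps n) r (joined \<sigma> e) = cone_prob g (card e) (card \<sigma>)"
proof -
  have fin: "finite \<sigma>" "finite e" using assms(1) finite_subset[of _ "{0..n}"] by auto
  have sub: "T \<union> e \<in> simps n" if "T \<subseteq> \<sigma>" for T
    by (rule simps_subset[OF _ assms(1)]) (use that assms in auto)
  have inj: "inj_on (\<lambda>T. T \<union> e) (Pow \<sigma>)" using assms(2) by (auto simp: inj_on_def)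
  have "expect (simps n) r (joined \<sigma> e) = (\<Prod>T\<in>Pow \<sigma>. r (T \<union> e))"
    unfolding join_faces_def
    by (subst expect_subset) (use sub in \<open>auto simp: prod.reindex[OF inj]\<close>)
  also have "\<dots> = (\<Prod>T\<in>Pow \<sigma>. g (card T + card e))"
  proof (intro prod.cong refl)
    fix T assume "T \<in> Pow \<sigma>"
    hence "card (T \<union> e) = card T + card e"
      using fin assms(2) finite_subset[of T \<sigma>] by (intro card_Un_disjoint) auto
    thus "r (T \<union> e) = g (card T + card e)" using r_card sub \<open>T \<in> Pow \<sigma>\<close> by simp
  qed
  also have "\<dots> = cone_prob g (card e) (card \<sigma>)" by (rule prod_Pow_card[OF fin(1)])
  finally show ?thesis .
qed

text \<open>Chernoff's lower tail at exponent 1. Since \<open>exp (-1) \<le> 1/2\<close>, a vertex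
  contributes at most \<open>1 - \<theta> / 2\<close> to the exponential moment, and there are at
  least \<open>3/4\<close> of \<open>n + 1\<close> vertices; the exponents \<open>3/8\<close> and
  \<open>1/4\<close> leave \<open>1/8\<close>.\<close>

lemma prob_small_degree:
  assumes \<sigma>: "\<sigma> \<subseteq> {0..n}" "card \<sigma> = l" and l: "4 * l \<le> n + 1" "l + 2 \<le> n + 1"
  shows "prob (simps n) r (\<lambda>G. (\<Sum>u\<in>{0..n} - \<sigma>. joined \<sigma> {u} G) \<le> real (n + 1) * cone_prob g 1 l / 4)
     \<le> exp (- (real (n + 1) * cone_prob g 1 l) / 8)"
proof -
  define \<theta> where "\<theta> = cone_prob g 1 l"
  let ?A = "{0..n} - \<sigma>" and ?N = "real (n + 1)"
  have \<theta>: "0 < \<theta>" "\<theta> \<le> 1" using cone_prob_pos cone_bounds by (auto simp: \<theta>_def)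
  have f\<sigma>: "finite \<sigma>" using \<sigma> finite_subset by auto
  have cA: "card ?A = n + 1 - l" using \<sigma> f\<sigma> by (simp add: card_Diff_subset)
  have "exp 1 \<ge> (2::real)" using exp_ge_add_one_self[of 1] by simp
  hence e2: "exp (-1) \<le> (1/2::real)" by (simp add: exp_minus field_simps)
  have E: "expect (simps n) r (\<lambda>G. 1 - (1/2) * joined \<sigma> {u} G) = 1 - \<theta> / 2" if "u \<in> ?A" for u
  proof -
    have "\<sigma> \<union> {u} \<subset> {0..n}"
    proof (rule psubsetI)
      have "card (\<sigma> \<union> {u}) \<le> l + 1" using \<sigma> card_Un_le[of \<sigma> "{u}"] by simp
      hence "card (\<sigma> \<union> {u}) \<noteq> card {0..n}" using l by simp
      thus "\<sigma> \<union> {u} \<noteq> {0..n}" by metis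
    qed (use \<sigma> that in auto)
    hence "expect (simps n) r (joined \<sigma> {u}) = \<theta>"
      using expect_joined[of \<sigma> "{u}"] that \<sigma> by (simp add: \<theta>_def)
    thus ?thesis by (simp only: expect_diff expect_cmult expect_const[OF finite_simps])
  qed
  have "prob (simps n) r (\<lambda>G. (\<Sum>u\<in>?A. joined \<sigma> {u} G) \<le> ?N * \<theta> / 4)
    \<le> prob (simps n) r (\<lambda>G. exp (- (?N * \<theta> / 4)) \<le> (\<Prod>u\<in>?A. 1 - (1/2) * joined \<sigma> {u} G))"
  proof (rule prob_mono)
    fix G assume "(\<Sum>u\<in>?A. joined \<sigma> {u} G) \<le> ?N * \<theta> / 4"
    hence "exp (- (?N * \<theta> / 4)) \<le> exp (- (\<Sum>u\<in>?A. joined \<sigma> {u} G))" by simp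
    also have "\<dots> = (\<Prod>u\<in>?A. exp (- joined \<sigma> {u} G))" unfolding sum_negf[symmetric] by (rule exp_sum) simp
    also have "\<dots> \<le> (\<Prod>u\<in>?A. 1 - (1/2) * joined \<sigma> {u} G)"
      using e2 by (intro prod_mono) auto
    finally show "exp (- (?N * \<theta> / 4)) \<le> (\<Prod>u\<in>?A. 1 - (1/2) * joined \<sigma> {u} G)" .
  qed
  also have "\<dots> \<le> expect (simps n) r (\<lambda>G. \<Prod>u\<in>?A. 1 - (1/2) * joined \<sigma> {u} G) / exp (- (?N * \<theta> / 4))"
    by (intro prob_markov prod_nonneg) auto
  also have "expect (simps n) r (\<lambda>G. \<Prod>u\<in>?A. 1 - (1/2) * joined \<sigma> {u} G) = (\<Prod>u\<in>?A. expect (simps n) r (\<lambda>G. 1 - (1/2) * joined \<sigma> {u} G))"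
  proof (rule expect_prod[where B = "\<lambda>u. join_faces \<sigma> {u}"])
    show "depends (join_faces \<sigma> {u}) (\<lambda>G. 1 - (1/2) * joined \<sigma> {u} G)" for u
      using joined_depends[of \<sigma> "{u}"] unfolding depends_def by metis
    show "join_faces \<sigma> {u} \<inter> join_faces \<sigma> {v} = {}" if "u \<in> ?A" "v \<in> ?A" "u \<noteq> v" for u v
      using that by (intro join_faces_disjoint) auto
  qed auto
  also have "\<dots> = (1 - \<theta> / 2) ^ (n + 1 - l)" using E cA by simp
  also have "\<dots> \<le> exp (- (\<theta> / 2)) ^ (n + 1 - l)"
    using \<theta> exp_ge_add_one_self[of "- (\<theta> / 2)"] by (intro power_mono) auto
  also have "\<dots> = exp (- (\<theta> / 2) * (?N - real l))"
    using l by (simp add: exp_of_nat_mult[symmetric] of_nat_diff mult.commute)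
  also have "\<dots> \<le> exp (- (\<theta> / 2) * (3 / 4 * ?N))"
  proof -
    have "real (4 * l) \<le> ?N" using l(1) by (rule of_nat_mono)
    moreover have "3 / 4 * x \<le> x - y" if "4 * y \<le> x" for x y :: real using that by simp
    ultimately have "3 / 4 * ?N \<le> ?N - real l" by simp
    hence "\<theta> / 2 * (3 / 4 * ?N) \<le> \<theta> / 2 * (?N - real l)" using \<theta> by (intro mult_left_mono) auto
    thus ?thesis by simp
  qed
  also have "\<dots> / exp (- (?N * \<theta> / 4)) = exp (- (?N * \<theta>) / 8)"
    unfolding exp_diff[symmetric] by (rule arg_cong[of _ _ exp]) (simp add: field_simps)
  finally show ?thesis unfolding \<theta>_def by (simp add: divide_right_mono)
qed

text \<open>A link of a face with \<open>l - 1\<close> vertices has vertex density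
  \<open>\<rho>\<close> and edge density \<open>\<pi>\<close>, and \<open>\<rho> * \<pi>\<close> is
  the coface density of a face with \<open>l\<close> vertices. The level is a quarter of the mean
  degree divided by \<open>l\<close>, as Garland's criterion with the degree bound of
  \<open>prob_small_degree\<close> demands. In the quotient of the trace bound by this level to the
  power \<open>2 * s\<close>, half of the powers of the mean degree cancel.\<close>

lemma prob_link_gap:
  assumes \<tau>: "\<tau> \<subseteq> {0..n}" "Suc (card \<tau>) = l" and l: "l + 2 \<le> n + 1" and s: "s > 0"
    and big: "1 \<le> real (n + 1) * cone_prob g 1 l"
  shows "prob (simps n) r (\<lambda>G. \<exists>f. (\<forall>v. f v \<noteq> 0 \<longrightarrow> v \<in> {0..n} - \<tau> \<and> joined \<tau> {v} G = 1) \<and> (\<Sum>v\<in>{0..n} - \<tau>. f v) = 0 \<and>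
       real (n + 1) * cone_prob g 1 l / (4 * real l) * (\<Sum>v\<in>{0..n} - \<tau>. (f v)\<^sup>2)
         < (\<Sum>u\<in>{0..n} - \<tau>. \<Sum>v\<in>{0..n} - \<tau> - {u}. joined \<tau> {u, v} G * f u * f v))
     \<le> real (s + 1) ^ (2 * s + 2) * real (n + 1) * (4 * real l) ^ (2 * s) / (real (n + 1) * cone_prob g 1 l) ^ s"
proof -
  define k where "k = card \<tau>"
  define \<rho> where "\<rho> = cone_prob g 1 k"
  define \<pi> where "\<pi> = cone_prob g 2 k"
  let ?N = "real (n + 1)" and ?A = "{0..n} - \<tau>"
  define t where "t = ?N * (\<rho> * \<pi>) / (4 * real l)"
  have lk: "l = Suc k" using \<tau> by (simp add: k_def)
  have th: "cone_prob g 1 l = \<rho> * \<pi>" by (simp add: lk \<rho>_def \<pi>_def numeral_2_eq_2)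
  have pos: "0 < \<rho>" "0 < \<pi>" "\<rho> \<le> 1" "\<pi> \<le> 1" using cone_prob_pos cone_bounds by (auto simp: \<rho>_def \<pi>_def)
  have pr: "\<tau> \<union> e \<subset> {0..n}" if "e \<subseteq> ?A" "card e \<le> 2" for e
  proof (rule psubsetI)
    have "card (\<tau> \<union> e) \<le> l + 1" using \<tau> card_Un_le[of \<tau> e] that by simp
    hence "card (\<tau> \<union> e) \<noteq> card {0..n}" using l by simp
    thus "\<tau> \<union> e \<noteq> {0..n}" by metis
  qed (use \<tau> that in auto)
  interpret rl: random_link "simps n" r ?A "joined \<tau>" "join_faces \<tau>" \<rho> \<pi>
  proof
    show "expect (simps n) r (joined \<tau> {u}) = \<rho>" if "u \<in> ?A" for u
      using that pr[of "{u}"] expect_joined[of \<tau> "{u}"] by (simp add: \<rho>_def k_def)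
    show "expect (simps n) r (joined \<tau> e) = \<pi>" if "e \<subseteq> ?A" "card e = 2" for e
    proof -
      have "e \<inter> \<tau> = {}" "e \<noteq> {}" using that by auto
      thus ?thesis using that pr[of e] expect_joined[of \<tau> e] by (simp add: \<pi>_def k_def)
    qed
    show "join_faces \<tau> e \<inter> join_faces \<tau> e' = {}" if "e \<subseteq> ?A" "e' \<subseteq> ?A" "e \<noteq> e'" for e e'
      using that by (intro join_faces_disjoint) auto
  qed (use pos joined_depends in auto)
  have N1: "1 \<le> ?N * \<rho> * \<pi>" using big th by (simp add: mult.assoc)
  have t: "t > 0" unfolding t_def using pos lk by (intro divide_pos_pos mult_pos_pos) auto
  have cA: "card ?A \<le> n + 1" using card_mono[of "{0..n}" ?A] by auto
  have "real (s + 1) ^ (2 * s + 2) * (?N * \<rho>) * (?N * \<rho> * \<pi>) ^ s / t ^ (2 * s)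
      \<le> real (s + 1) ^ (2 * s + 2) * ?N * (?N * \<rho> * \<pi>) ^ s / t ^ (2 * s)"
    using pos t by (intro divide_right_mono mult_right_mono mult_left_mono) auto
  also have "\<dots> = real (s + 1) ^ (2 * s + 2) * ?N * (4 * real l) ^ (2 * s) / (?N * (\<rho> * \<pi>)) ^ s"
  proof -
    define x where "x = ?N * (\<rho> * \<pi>)"
    have x: "x > 0" unfolding x_def using pos by (intro mult_pos_pos) auto
    have "x ^ s / (x / (4 * real l)) ^ (2 * s) = (4 * real l) ^ (2 * s) / x ^ s"
      using x lk by (simp add: power_divide mult_2 power_add)
    thus ?thesis unfolding t_def x_def[symmetric] mult.assoc[of ?N \<rho>] by (metis times_divide_eq_right)
  qed
  finally show ?thesis
    using rl.prob_link_quad_form[OF s cA N1 t] unfolding th t_def by linarith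
qed

text \<open>The two summands are union bounds for a face of small degree and for a link without gap;
  outside these events Garland's criterion holds at the common threshold \<open>D\<close>.\<close>

lemma prob_betti_ne_0:
  assumes l: "4 * l \<le> n + 1" "l + 2 \<le> n + 1" and s: "s > 0"
    and big: "1 \<le> real (n + 1) * cone_prob g 1 l" and j: "int n - j = int l + 1"
  shows "prob (simps n) r (\<lambda>G. reduced_betti (upper_of n G) j \<noteq> 0)
     \<le> real (n + 1) ^ l * exp (- (real (n + 1) * cone_prob g 1 l) / 8)
      + real (n + 1) ^ l * (real (s + 1) ^ (2 * s + 2) * real (n + 1) * (4 * real l) ^ (2 * s) / (real (n + 1) * cone_prob g 1 l) ^ s)"
proof -
  let ?V = "{0..n}" and ?N = "real (n + 1)"
  define D where "D = ?N * cone_prob g 1 l / 4"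
  define small where "small = (\<lambda>\<sigma> G. (\<Sum>u\<in>?V - \<sigma>. joined \<sigma> {u} G) \<le> ?N * cone_prob g 1 l / 4)"
  define bad where "bad = (\<lambda>\<tau> G. \<exists>f. (\<forall>v. f v \<noteq> 0 \<longrightarrow> v \<in> {0..n} - \<tau> \<and> joined \<tau> {v} G = 1) \<and> (\<Sum>v\<in>{0..n} - \<tau>. f v) = 0 \<and>
       real (n + 1) * cone_prob g 1 l / (4 * real l) * (\<Sum>v\<in>{0..n} - \<tau>. (f v)\<^sup>2)
         < (\<Sum>u\<in>{0..n} - \<tau>. \<Sum>v\<in>{0..n} - \<tau> - {u}. joined \<tau> {u, v} G * f u * f v))"
  define P1 where "P1 = {\<sigma>. \<sigma> \<subseteq> ?V \<and> card \<sigma> = l}"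
  define P2 where "P2 = {\<tau>. \<tau> \<subseteq> ?V \<and> Suc (card \<tau>) = l}"
  have fin: "finite P1" "finite P2"
    unfolding P1_def P2_def by (rule finite_subset[of _ "Pow ?V"], auto)+
  have D0: "0 \<le> D" unfolding D_def using cone_prob_pos[of 1 l] by simp
  have "prob (simps n) r (\<lambda>G. reduced_betti (upper_of n G) j \<noteq> 0)
     \<le> prob (simps n) r (\<lambda>G. (\<exists>\<sigma>\<in>P1. small \<sigma> G) \<or> (\<exists>\<tau>\<in>P2. bad \<tau> G))"
  proof (rule prob_mono, rule ccontr)
    fix G assume ne: "reduced_betti (upper_of n G) j \<noteq> 0" and no: "\<not> ((\<exists>\<sigma>\<in>P1. small \<sigma> G) \<or> (\<exists>\<tau>\<in>P2. bad \<tau> G))"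
    interpret cx: complex_on ?V "upper_of n G" n by (rule complex_on_upper_of)
    have pr: "S \<subset> ?V" if "S \<subseteq> ?V" "card S < n + 1" for S
    proof -
      have "S \<noteq> ?V" using that by auto
      thus ?thesis using that by auto
    qed
    have ins: "insert v S \<in> lower_of n G \<longleftrightarrow> join_faces S {v} \<subseteq> G"
      if "S \<in> lower_of n G" "card S + 1 < n + 1" "v \<in> ?V - S" for S v
    proof -
      have S: "S \<subset> ?V" using that by (auto simp: lower_of_def)
      hence fS: "finite S" using finite_subset by blast
      have "insert v S \<subset> ?V" using S that fS by (intro pr) auto
      thus ?thesis using insert_in_lower_of[of v S n G] that by auto
    qed
    have "reduced_betti (upper_of n G) j = 0"
    proof (rule cx.reduced_betti_garland[where D = D, OF j D0, unfolded dual_upper_of])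
      fix S assume S: "S \<in> lower_of n G" "card S = l"
      have "{v\<in>?V - S. insert v S \<in> lower_of n G} = {v\<in>?V - S. join_faces S {v} \<subseteq> G}"
        using ins[OF S(1)] S(2) l by auto
      hence "real (card {v\<in>?V - S. insert v S \<in> lower_of n G}) = (\<Sum>v\<in>?V - S. joined S {v} G)"
        by (simp add: sum.If_cases of_bool_def Int_def)
      moreover have "S \<in> P1" using S by (auto simp: P1_def lower_of_def)
      ultimately show "D < real (card {v\<in>?V - S. insert v S \<in> lower_of n G})"
        using no unfolding small_def D_def by (auto simp: not_le)
    next
      fix T f
      assume T: "T \<in> lower_of n G" "Suc (card T) = l"
        and f: "\<And>v. f v \<noteq> 0 \<Longrightarrow> v \<in> ?V - T \<and> insert v T \<in> lower_of n G" "(\<Sum>v\<in>?V - T. f v) = (0::real)"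
      have TV: "T \<subseteq> ?V" using T by (auto simp: lower_of_def)
      hence fT: "finite T" using finite_subset by auto
      have J1: "join_faces T {v} \<subseteq> G" if "f v \<noteq> 0" for v
        using f(1)[OF that] ins[OF T(1), of v] T(2) l by auto
      let ?q = "\<Sum>u\<in>?V - T. \<Sum>v\<in>?V - T - {u}. joined T {u, v} G * f u * f v"
      have "(\<Sum>u\<in>?V - T. \<Sum>v\<in>?V - T - {u}. of_bool (insert u (insert v T) \<in> lower_of n G) * f u * f v) = ?q"
      proof (intro sum.cong refl)
        fix u v assume u: "u \<in> ?V - T" and v: "v \<in> ?V - T - {u}"
        show "of_bool (insert u (insert v T) \<in> lower_of n G) * f u * f v = joined T {u, v} G * f u * f v"
        proof (cases "f u = 0 \<or> f v = 0")
          case False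
          \<comment> \<open>Since \<open>f u\<close> and \<open>f v\<close> are non-zero, both
            vertices belong to the link, so only the sets containing both remain to be
            checked.\<close>
          have "insert u (insert v T) \<in> lower_of n G \<longleftrightarrow> join_faces (insert v T) {u} \<subseteq> G"
            using f(1)[of v] False u v T fT l by (intro ins) auto
          also have "\<dots> \<longleftrightarrow> join_faces T {u, v} \<subseteq> G"
            unfolding join_faces_insert using J1[of u] False by auto
          finally show ?thesis by simp
        qed auto
      qed
      moreover have "?q \<le> ?N * cone_prob g 1 l / (4 * real l) * (\<Sum>v\<in>?V - T. (f v)\<^sup>2)"
      proof (rule ccontr)
        assume "\<not> ?thesis"
        hence "bad T G" unfolding bad_def using f J1 by (intro exI[of _ f]) (auto simp: not_le)
        thus False using no T TV by (auto simp: P2_def)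
      qed
      hence "real l * ?q \<le> real l * (?N * cone_prob g 1 l / (4 * real l) * (\<Sum>v\<in>?V - T. (f v)\<^sup>2))"
        by (intro mult_left_mono) auto
      moreover have "real l * (?N * cone_prob g 1 l / (4 * real l) * (\<Sum>v\<in>?V - T. (f v)\<^sup>2)) = D * (\<Sum>v\<in>?V - T. (f v)\<^sup>2)"
        using T by (auto simp: D_def)
      ultimately show "real l * (\<Sum>u\<in>?V - T. \<Sum>v\<in>?V - T - {u}. of_bool (insert u (insert v T) \<in> lower_of n G) * f u * f v)
        \<le> D * (\<Sum>v\<in>?V - T. (f v)\<^sup>2)" by simp
    qed
    thus False using ne by simp
  qed
  also have "\<dots> \<le> (\<Sum>\<sigma>\<in>P1. prob (simps n) r (small \<sigma>)) + (\<Sum>\<tau>\<in>P2. prob (simps n) r (bad \<tau>))"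
    by (rule order_trans[OF prob_disj]) (intro add_mono prob_Bex fin)
  also have "(\<Sum>\<sigma>\<in>P1. prob (simps n) r (small \<sigma>)) \<le> ?N ^ l * exp (- (?N * cone_prob g 1 l) / 8)"
  proof -
    have "(\<Sum>\<sigma>\<in>P1. prob (simps n) r (small \<sigma>)) \<le> (\<Sum>\<sigma>\<in>P1. exp (- (?N * cone_prob g 1 l) / 8))"
      using prob_small_degree[OF _ _ l] by (intro sum_mono) (auto simp: P1_def small_def)
    also have "\<dots> = real ((n + 1) choose l) * exp (- (?N * cone_prob g 1 l) / 8)"
      using n_subsets[of ?V l] by (simp add: P1_def)
    also have "\<dots> \<le> real ((n + 1) ^ l) * exp (- (?N * cone_prob g 1 l) / 8)"
      using binomial_le_pow[of l "n + 1"] l by (intro mult_right_mono) (simp_all only: of_nat_le_iff exp_ge_zero)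
    finally show ?thesis by simp
  qed
  also have "(\<Sum>\<tau>\<in>P2. prob (simps n) r (bad \<tau>)) \<le> ?N ^ l * (real (s + 1) ^ (2 * s + 2) * real (n + 1) * (4 * real l) ^ (2 * s) / (real (n + 1) * cone_prob g 1 l) ^ s)"
    (is "_ \<le> _ * ?b")
  proof -
    have b0: "0 \<le> ?b" using less_imp_le[OF cone_prob_pos[of 1 l]] by (intro divide_nonneg_nonneg mult_nonneg_nonneg zero_le_power) auto
    have "(\<Sum>\<tau>\<in>P2. prob (simps n) r (bad \<tau>)) \<le> (\<Sum>\<tau>\<in>P2. ?b)"
    proof (intro sum_mono)
      fix \<tau> assume "\<tau> \<in> P2"
      thus "prob (simps n) r (bad \<tau>) \<le> ?b" unfolding bad_def P2_def
        by (intro prob_link_gap l s big) auto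
    qed
    also have "\<dots> = real (card P2) * ?b" by simp
    also have "\<dots> \<le> ?N ^ l * ?b"
    proof (intro mult_right_mono b0)
      show "real (card P2) \<le> ?N ^ l"
      proof (cases l)
        case 0 thus ?thesis by (simp add: P2_def)
      next
        case (Suc k)
        hence "card P2 = (n + 1) choose k" using n_subsets[of ?V k] by (simp add: P2_def)
        also have "\<dots> \<le> (n + 1) ^ k" using l Suc by (intro binomial_le_pow) auto
        also have "\<dots> \<le> (n + 1) ^ l" using Suc by (intro power_increasing) auto
        finally have "real (card P2) \<le> real ((n + 1) ^ l)" by (simp only: of_nat_le_iff)
        thus ?thesis by simp
      qed
    qed
    finally show ?thesis .
  qed
  finally show ?thesis by linarith
qed

end

section \<open>Asymptotics\<close>

text \<open>The expression is convex in \<open>i\<close>: its increments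
  \<open>c * 2 ^ j - L\<close> increase, so the largest value is at an end of the range.\<close>

lemma pow2_minus_linear_le:
  fixes c L :: real
  assumes "0 \<le> c" "1 \<le> i" "i \<le> m"
  shows "c * 2 ^ i - real i * L \<le> max (c * 2 - L) (c * 2 ^ m - real m * L)"
proof -
  define h where "h = (\<lambda>i::nat. c * 2 ^ i - real i * L)"
  have step: "h (Suc j) = h j + (c * 2 ^ j - L)" for j by (simp add: h_def algebra_simps)
  obtain k where k: "i = Suc k" using assms(2) by (cases i) auto
  have mono: "c * 2 ^ j \<le> c * 2 ^ j'" if "j \<le> j'" for j j' :: nat
    using assms(1) that by (intro mult_left_mono power_increasing) auto
  show ?thesis
  proof (cases "c * 2 ^ k \<le> L")
    case True
    have "j \<le> k \<Longrightarrow> h (Suc j) \<le> h 1" for j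
    proof (induction j)
      case (Suc j)
      thus ?case using step[of "Suc j"] mono[of "Suc j" k] True by simp
    qed simp
    from this[of k] show ?thesis by (simp add: h_def k)
  next
    case False
    have "h i \<le> h m" using assms(3)
    proof (induction rule: dec_induct)
      case (step j)
      thus ?case using \<open>\<And>j. h (Suc j) = _\<close>[of j] mono[of k j] False k by linarith
    qed simp
    thus ?thesis by (simp add: h_def)
  qed
qed

text \<open>By convexity of the exponent, every term is at most the bound for the first term plus
  the last one.\<close>

lemma sum_double_exp_le:
  fixes c :: real
  assumes "0 \<le> c" "1 \<le> m" "N > 0"
  shows "(\<Sum>i=1..m. (real m ^ 2 / N) ^ i * exp (c * 2 ^ i))
     \<le> real m * (exp (2 * c) * real m ^ 2 / N + exp (c * 2 ^ m - real m * ln (N / real m ^ 2)))"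
proof -
  define L where "L = ln (N / real m ^ 2)"
  have eL: "real m ^ 2 / N = exp (- L)" using assms by (simp add: L_def exp_minus field_simps)
  have "(real m ^ 2 / N) ^ i * exp (c * 2 ^ i) \<le> exp (2 * c) * real m ^ 2 / N + exp (c * 2 ^ m - real m * L)"
    if i: "i \<in> {1..m}" for i
  proof -
    have "(real m ^ 2 / N) ^ i * exp (c * 2 ^ i) = exp (c * 2 ^ i - real i * L)"
      unfolding eL by (simp add: exp_of_nat_mult[symmetric] exp_diff exp_minus field_simps)
    also have "\<dots> \<le> exp (max (c * 2 - L) (c * 2 ^ m - real m * L))"
      using pow2_minus_linear_le[of c i m L] assms i by simp
    also have "\<dots> \<le> exp (c * 2 - L) + exp (c * 2 ^ m - real m * L)"
      by (simp add: max_def)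
    also have "exp (c * 2 - L) = exp (2 * c) * (real m ^ 2 / N)"
      unfolding eL by (simp add: exp_add[symmetric] mult.commute)
    finally show ?thesis by simp
  qed
  hence "(\<Sum>i=1..m. (real m ^ 2 / N) ^ i * exp (c * 2 ^ i))
     \<le> (\<Sum>i=1..m. exp (2 * c) * real m ^ 2 / N + exp (c * 2 ^ m - real m * L))" by (rule sum_mono)
  thus ?thesis by (simp add: L_def)
qed

section \<open>The limit as \<open>n\<close> tends to infinity\<close>

locale upper_model =
  fixes a A a' A' :: real and q :: "nat \<Rightarrow> nat set \<Rightarrow> real"
  assumes A: "0 < A" "A \<le> a"
    and a': "exp (- a) + exp (- a') = 1" and A': "exp (- A) + exp (- A') = 1"
    and bounds: "\<And>n \<sigma>. \<sigma> \<in> simps n \<Longrightarrow> exp (- a) \<le> q n \<sigma> \<and> q n \<sigma> \<le> exp (- A)"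
begin

definition missing_prob :: "nat \<Rightarrow> nat set \<Rightarrow> real" where
  "missing_prob n \<sigma> = 1 - q n ({0..n} - \<sigma>)"

abbreviation Pr :: "nat \<Rightarrow> (nat set set \<Rightarrow> bool) \<Rightarrow> real" where
  "Pr n E \<equiv> prob (simps n) (missing_prob n) (\<lambda>G. E (upper_of n G))"

lemma dual_pos: "0 < a'" "a' \<le> A'" "0 < A'"
proof -
  have "exp (- a') < exp 0" using a' exp_gt_zero[of "- a"] by (simp only: exp_zero)
  thus "0 < a'" by (simp only: exp_less_cancel_iff)
  have "exp (- a) \<le> exp (- A)" using A by simp
  hence "exp (- A') \<le> exp (- a')" using a' A' by linarith
  thus "a' \<le> A'" by simp
  thus "0 < A'" using \<open>0 < a'\<close> by simp
qed

lemma compl_simps: "\<sigma> \<in> simps n \<Longrightarrow> {0..n} - \<sigma> \<in> simps n"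
  by (auto simp: simps_def)

lemma medial_missing: "medial n (missing_prob n) a' A'"
proof
  fix T assume "T \<in> simps n"
  thus "exp (- A') \<le> missing_prob n T \<and> missing_prob n T \<le> exp (- a')"
    using bounds[OF compl_simps[of T n]] a' A' by (auto simp: missing_prob_def)
qed (use dual_pos in auto)

sublocale m: medial n "missing_prob n" a' A' for n
  by (rule medial_missing)

lemma upper_prob_tendsto_1:
  assumes "(\<lambda>n. Pr n (\<lambda>Y. \<not> E n Y)) \<longlonglongrightarrow> 0"
  shows "(\<lambda>n. upper_prob n (q n) (E n)) \<longlonglongrightarrow> 1"
proof -
  have "upper_prob n (q n) (E n) = 1 - Pr n (\<lambda>Y. \<not> E n Y)" for n
    by (simp add: upper_prob_eq_prob missing_prob_def[abs_def] m.prob_not[unfolded missing_prob_def[abs_def]])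
  thus ?thesis using tendsto_diff[OF tendsto_const[of 1] assms] by simp
qed

lemma Pr_tendsto_0:
  assumes "\<forall>\<^sub>F n in sequentially. Pr n (E n) \<le> b n" "b \<longlonglongrightarrow> 0"
  shows "(\<lambda>n. Pr n (E n)) \<longlonglongrightarrow> 0"
  using assms m.prob_nonneg by (intro tendsto_sandwich[OF _ assms(1) tendsto_const assms(2)]) auto

lemma Pr_disj_tendsto_0:
  assumes "(\<lambda>n. Pr n (E n)) \<longlonglongrightarrow> 0" "(\<lambda>n. Pr n (E' n)) \<longlonglongrightarrow> 0"
    and "\<forall>\<^sub>F n in sequentially. \<forall>G. F n (upper_of n G) \<longrightarrow> E n (upper_of n G) \<or> E' n (upper_of n G)"
  shows "(\<lambda>n. Pr n (F n)) \<longlonglongrightarrow> 0"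
proof (rule Pr_tendsto_0)
  show "\<forall>\<^sub>F n in sequentially. Pr n (F n) \<le> Pr n (E n) + Pr n (E' n)"
    using assms(3) by eventually_elim (rule order_trans[OF m.prob_mono m.prob_disj], blast)
  show "(\<lambda>n. Pr n (E n) + Pr n (E' n)) \<longlonglongrightarrow> 0"
    using tendsto_add[OF assms(1,2)] by simp
qed

lemma cdim_tendsto: "(\<lambda>n. Pr n (\<lambda>Y. cdim Y \<noteq> int n - 1)) \<longlonglongrightarrow> 0"
proof (rule Pr_tendsto_0)
  show "\<forall>\<^sub>F n in sequentially. Pr n (\<lambda>Y. cdim Y \<noteq> int n - 1) \<le> exp (- a' * real (n + 1))"
    using eventually_ge_at_top[of 1] by eventually_elim (rule m.prob_cdim)
  show "(\<lambda>n. exp (- a' * real (n + 1))) \<longlonglongrightarrow> 0" using dual_pos(1) by real_asymp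
qed

lemma powr_beta:
  assumes "ln (real n) > 0" "log 2 (ln (real n)) > 0" "y > 0"
  shows "y * 2 powr (beta n y) = ln (real n) * log 2 (ln (real n))"
  using assms by (simp add: beta_def powr_add powr_diff)

text \<open>Rounding \<open>beta n a' + \<epsilon>\<close> up to \<open>m\<close> costs the 1 in the
  bound. Then \<open>a' * 2 ^ m\<close> is at least \<open>2 powr \<epsilon>\<close> times
  \<open>ln n * log 2 (ln n)\<close>, whereas \<open>m * ln (n + 1)\<close> is asymptotic to
  \<open>ln n * log 2 (ln n)\<close>, so the union bound tends to 0.\<close>

lemma defect_upper_tendsto:
  assumes "\<epsilon> > 0"
  shows "(\<lambda>n. Pr n (\<lambda>Y. \<not> real_of_int (skel_defect n Y) \<le> beta n a' + 1 + \<epsilon>)) \<longlonglongrightarrow> 0"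
proof (rule Pr_tendsto_0)
  define K where "K = 2 powr \<epsilon>"
  let ?b = "\<lambda>n. exp ((log 2 (ln n) + log 2 (log 2 (ln n)) + (\<epsilon> + 1 - log 2 a')) * ln (n + 1) - K * (ln n * log 2 (ln n)) + a')"
  have "K > 1" using assms by (simp add: K_def)
  thus "(\<lambda>n::nat. ?b n) \<longlonglongrightarrow> 0" by real_asymp
  have e1: "\<forall>\<^sub>F n::nat in sequentially. ln (real n) > 0" by real_asymp
  have e2: "\<forall>\<^sub>F n::nat in sequentially. log 2 (ln (real n)) > 0" by real_asymp
  have e3: "\<forall>\<^sub>F n::nat in sequentially. beta n a' + \<epsilon> \<ge> 0" unfolding beta_def by real_asymp
  have e4: "\<forall>\<^sub>F n::nat in sequentially. beta n a' + \<epsilon> + 1 \<le> real n" unfolding beta_def by real_asymp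
  show "\<forall>\<^sub>F n::nat in sequentially. Pr n (\<lambda>Y. \<not> real_of_int (skel_defect n Y) \<le> beta n a' + 1 + \<epsilon>) \<le> ?b n"
    using e1 e2 e3 e4
  proof eventually_elim
    case (elim n)
    define m where "m = nat \<lceil>beta n a' + \<epsilon>\<rceil>"
    have m: "beta n a' + \<epsilon> \<le> real m" "real m \<le> beta n a' + \<epsilon> + 1"
      unfolding m_def using elim(3) by linarith+
    hence mn: "m \<le> n" using elim(4) by simp
    have "Pr n (\<lambda>Y. \<not> real_of_int (skel_defect n Y) \<le> beta n a' + 1 + \<epsilon>) \<le> Pr n (\<lambda>Y. skel_defect n Y > int m)"
      by (rule m.prob_mono) (use m(2) in linarith)
    also have "\<dots> \<le> real (n + 1) ^ m * exp (- a' * (2 ^ m - 1))" by (rule m.prob_skel_defect_gt[OF mn])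
    also have "real (n + 1) ^ m = exp (real m * ln (real (n + 1)))" by (simp add: exp_of_nat_mult)
    also have "exp (real m * ln (real (n + 1))) * exp (- a' * (2 ^ m - 1)) = exp (real m * ln (real (n + 1)) - a' * 2 ^ m + a')"
      by (simp add: exp_add[symmetric] algebra_simps)
    also have "\<dots> \<le> ?b (real n)"
    proof -
      have "real m * ln (real (n + 1)) \<le> (beta n a' + \<epsilon> + 1) * ln (real n + 1)"
        using m(2) by (intro mult_mono) auto
      moreover have "K * (ln n * log 2 (ln n)) \<le> a' * 2 ^ m"
      proof -
        have "K * (ln n * log 2 (ln n)) = a' * 2 powr (beta n a' + \<epsilon>)"
          using powr_beta[OF elim(1,2) dual_pos(1)] by (simp add: powr_add K_def)
        also have "\<dots> \<le> a' * 2 powr (real m)" using m(1) dual_pos by (intro mult_left_mono powr_mono) auto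
        finally show ?thesis by (simp add: powr_realpow)
      qed
      ultimately show ?thesis by (simp add: beta_def algebra_simps)
    qed
    finally show ?case .
  qed
qed

text \<open>Here \<open>m\<close> is \<open>beta n A'\<close> rounded down, so
  \<open>A' * 2 ^ m \<le> ln n * log 2 (ln n)\<close>. The product \<open>m * ln n\<close> is larger
  than this by about \<open>ln n * log 2 (log 2 (ln n))\<close>, which absorbs the rounding and all
  constants; hence no \<open>\<epsilon>\<close> in this bound.\<close>

lemma defect_lower_tendsto:
  "(\<lambda>n. Pr n (\<lambda>Y. \<not> real_of_int \<lfloor>beta n A'\<rfloor> + 1 \<le> real_of_int (skel_defect n Y))) \<longlonglongrightarrow> 0"
proof (rule Pr_tendsto_0)
  define B where "B = (\<lambda>n::real. log 2 (ln n) + log 2 (log 2 (ln n)) - log 2 A')"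
  let ?b = "\<lambda>n. exp (2 * A') * (B n ^ 3 / n) + B n * exp (ln n * log 2 (ln n) - (B n - 1) * (ln n - 2 * ln (B n)))"
  have l1: "(\<lambda>n::nat. B n ^ 3 / n) \<longlonglongrightarrow> 0" unfolding B_def by real_asymp
  have l2: "(\<lambda>n::nat. B n * exp (ln n * log 2 (ln n) - (B n - 1) * (ln n - 2 * ln (B n)))) \<longlonglongrightarrow> 0"
    unfolding B_def by real_asymp
  show "(\<lambda>n::nat. ?b n) \<longlonglongrightarrow> 0"
    using tendsto_add[OF tendsto_mult_left[OF l1, of "exp (2 * A')"] l2] by simp
  have e1: "\<forall>\<^sub>F n::nat in sequentially. ln (real n) > 0" by real_asymp
  have e2: "\<forall>\<^sub>F n::nat in sequentially. log 2 (ln (real n)) > 0" by real_asymp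
  have e3: "\<forall>\<^sub>F n::nat in sequentially. B n \<ge> 1" unfolding B_def by real_asymp
  have e4: "\<forall>\<^sub>F n::nat in sequentially. B n \<le> real n" unfolding B_def by real_asymp
  have e5: "\<forall>\<^sub>F n::nat in sequentially. ln n - 2 * ln (B n) \<ge> 0" unfolding B_def by real_asymp
  show "\<forall>\<^sub>F n::nat in sequentially. Pr n (\<lambda>Y. \<not> real_of_int \<lfloor>beta n A'\<rfloor> + 1 \<le> real_of_int (skel_defect n Y)) \<le> ?b n"
    using e1 e2 e3 e4 e5
  proof eventually_elim
    case (elim n)
    have Bn: "beta n A' = B n" by (simp add: B_def beta_def)
    define m where "m = nat \<lfloor>B n\<rfloor>"
    have m: "B n - 1 \<le> real m" "real m \<le> B n" "1 \<le> m" "real_of_int \<lfloor>B n\<rfloor> = real m"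
      unfolding m_def using elim(3) by linarith+
    have mn: "m \<le> n" using m elim(4) by simp
    have n0: "0 < n" using mn m by simp
    have "Pr n (\<lambda>Y. \<not> real_of_int \<lfloor>beta n A'\<rfloor> + 1 \<le> real_of_int (skel_defect n Y)) \<le> Pr n (\<lambda>Y. skel_defect n Y < int m + 1)"
      unfolding Bn m(4) by (rule m.prob_mono) linarith
    also have "\<dots> \<le> (\<Sum>i=1..m. (real m ^ 2 / real (n + 1)) ^ i * exp (A' * 2 ^ i))"
      by (rule m.prob_skel_defect_lt[OF mn])
    also have "\<dots> \<le> real m * (exp (2 * A') * real m ^ 2 / real (n + 1) + exp (A' * 2 ^ m - real m * ln (real (n + 1) / real m ^ 2)))"
      using dual_pos m by (intro sum_double_exp_le) auto
    also have "\<dots> \<le> B n * (exp (2 * A') * B n ^ 2 / real n + exp (ln n * log 2 (ln n) - (B n - 1) * (ln n - 2 * ln (B n))))"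
    proof (intro mult_mono add_mono m)
      show "exp (2 * A') * real m ^ 2 / real (n + 1) \<le> exp (2 * A') * B n ^ 2 / real n"
        using n0 m by (intro frac_le mult_left_mono power_mono) auto
      have "A' * 2 ^ m \<le> A' * 2 powr (B n)"
        using m dual_pos by (intro mult_left_mono) (auto simp flip: powr_realpow)
      also have "\<dots> = ln n * log 2 (ln n)" using powr_beta[OF elim(1,2) dual_pos(3)] Bn by simp
      finally have 1: "A' * 2 ^ m \<le> ln n * log 2 (ln n)" .
      have "ln (real (n + 1) / real m ^ 2) = ln (real (n + 1)) - 2 * ln (real m)"
        using m by (subst ln_div) (auto simp: ln_realpow)
      moreover have "ln (real m) \<le> ln (B n)" "ln (real n) \<le> ln (real (n + 1))" using m n0 by auto
      ultimately have "ln n - 2 * ln (B n) \<le> ln (real (n + 1) / real m ^ 2)" by linarith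
      hence "(B n - 1) * (ln n - 2 * ln (B n)) \<le> real m * ln (real (n + 1) / real m ^ 2)"
        using m elim by (intro mult_mono) auto
      thus "exp (A' * 2 ^ m - real m * ln (real (n + 1) / real m ^ 2)) \<le> exp (ln n * log 2 (ln n) - (B n - 1) * (ln n - 2 * ln (B n)))"
        using 1 by simp
    qed (use elim in auto)
    also have "\<dots> = ?b n" by (simp add: power3_eq_cube power2_eq_square algebra_simps)
    finally show ?case .
  qed
qed

text \<open>For \<open>l \<le> h n\<close> the mean coface number is at least a fixed positive power
  of \<open>n\<close>, so both parts of \<open>prob_betti_ne_0\<close>, with a suitable
  \<open>s\<close>, are small enough to be summed over all these \<open>l\<close>.\<close>

lemma betti_low_tendsto:
  assumes hom: "\<And>n. homogeneous n (q n)" and \<delta>: "\<delta> > 0"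
  defines "h \<equiv> \<lambda>n::real. log 2 (ln n) - log 2 A' - \<delta>"
  shows "(\<lambda>n. Pr n (\<lambda>Y. \<exists>l. real l \<le> h n \<and> reduced_betti Y (int n - int l - 1) \<noteq> 0)) \<longlonglongrightarrow> 0"
proof (rule Pr_tendsto_0)
  \<comment> \<open>The exponent of the mean degree: \<open>2 ^ l \<le> 2 powr (h n)\<close> gives
    \<open>exp (- A' * 2 ^ l) \<ge> n powr (c - 1)\<close>.\<close>
  define c where "c = 1 - 2 powr (- \<delta>)"
  have c: "0 < c" "c < 1" using \<delta> by (auto simp: c_def powr_less_one)
  define \<kappa> where "\<kappa> = nat \<lceil>1 / c\<rceil>"
  have \<kappa>1: "1 / c \<le> real \<kappa>" unfolding \<kappa>_def by linarith
  hence \<kappa>c: "1 \<le> c * real \<kappa>" using c by (simp add: field_simps)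
  have \<kappa>: "0 < real \<kappa>" "1 \<le> \<kappa>"
    using \<kappa>c by (cases "\<kappa> = 0", auto)+
  \<comment> \<open>The upper bound for \<open>Z\<close> below, with \<open>H\<close> replaced by
    \<open>h n\<close>.\<close>
  define z where "z = (\<lambda>n::real. 5 * (real \<kappa> * (h n + 3) + 1))"
  let ?b = "\<lambda>n. (h n + 1) * exp (h n * ln (n + 1) - n powr c / 8) + (h n + 1) * exp ((z n)^2 - 2 * ln n)"
  have l1: "(\<lambda>n::nat. (h n + 1) * exp (h n * ln (n + 1) - n powr c / 8)) \<longlonglongrightarrow> 0"
    unfolding h_def using c by real_asymp
  have l2: "(\<lambda>n::nat. (h n + 1) * exp ((z n)^2 - 2 * ln n)) \<longlonglongrightarrow> 0"
    unfolding h_def z_def using \<kappa>(1) by real_asymp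
  show "(\<lambda>n::nat. ?b n) \<longlonglongrightarrow> 0"
    using tendsto_add[OF l1 l2] by simp
  have e1: "\<forall>\<^sub>F n::nat in sequentially. ln (real n) > 0" by real_asymp
  have e2: "\<forall>\<^sub>F n::nat in sequentially. h n \<ge> 0" unfolding h_def by real_asymp
  have e3: "\<forall>\<^sub>F n::nat in sequentially. 4 * h n + 4 \<le> real n" unfolding h_def by real_asymp
  show "\<forall>\<^sub>F n::nat in sequentially. Pr n (\<lambda>Y. \<exists>l. real l \<le> h n \<and> reduced_betti Y (int n - int l - 1) \<noteq> 0) \<le> ?b n"
    using e1 e2 e3
  proof eventually_elim
    case (elim n)
    have n0: "real n > 0" using elim by linarith
    define H where "H = nat \<lfloor>h n\<rfloor>"
    have H: "real H \<le> h n" unfolding H_def using elim(2) by linarith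
    have leH: "l \<le> H" if "real l \<le> h n" for l using that unfolding H_def by linarith
    \<comment> \<open>Since \<open>c * \<kappa> \<ge> 1\<close>, the power \<open>s\<close> of
      \<open>n powr c\<close> is at least \<open>n ^ (H + 3)\<close>: this pays for the
      \<open>n ^ l\<close> links and the extra factor \<open>n + 1\<close> of the trace bound, and
      leaves \<open>n ^ 2\<close>.\<close>
    define s where "s = \<kappa> * (H + 3)"
    have s0: "s > 0" "H + 3 \<le> s" using \<kappa> by (auto simp: s_def)
    define Z where "Z = 5 * (real s + 1)"
    have "Z \<le> z n" unfolding Z_def z_def s_def using H \<kappa> by (simp add: mult_left_mono)
    \<comment> \<open>Initial segments represent the sizes that occur; all other sizes get a value
      within the required bounds.\<close>
    define g where "g = (\<lambda>i. if 1 \<le> i \<and> i \<le> n then missing_prob n {0..<i} else exp (- A'))"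
    have seg: "{0..<i} \<in> simps n" if "1 \<le> i" "i \<le> n" for i
    proof -
      have "n \<in> {0..n} - {0..<i}" "0 \<in> {0..<i}" "{0..<i} \<subseteq> {0..n}" using that by auto
      thus ?thesis unfolding simps_def by blast
    qed
    interpret hm: homogeneous_medial n "missing_prob n" a' A' g
    proof
      fix T assume T: "T \<in> simps n"
      have fT: "finite T" using T finite_subset by (auto simp: simps_def)
      have cT: "1 \<le> card T" "card T \<le> n"
      proof -
        show "1 \<le> card T" using T fT by (auto simp: simps_def Suc_le_eq card_gt_0_iff)
        have "card T < card {0..n}" using T by (intro psubset_card_mono) (auto simp: simps_def)
        thus "card T \<le> n" by simp
      qed
      \<comment> \<open>The parameters of \<open>G\<close> are those of \<open>q\<close> at
        complements, so homogeneity has to be applied to the complements.\<close>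
      have "card ({0..n} - T) = card ({0..n} - {0..<card T})"
      proof -
        have "T \<subseteq> {0..n}" "{0..<card T} \<subseteq> {0..n}" using T cT by (auto simp: simps_def)
        thus ?thesis using fT by (simp add: card_Diff_subset)
      qed
      hence "q n ({0..n} - T) = q n ({0..n} - {0..<card T})"
        using hom[of n] compl_simps[OF T] compl_simps[OF seg[OF cT]] unfolding homogeneous_def by blast
      thus "missing_prob n T = g (card T)" using cT by (simp add: g_def missing_prob_def)
    next
      fix i
      show "exp (- A') \<le> g i \<and> g i \<le> 1"
      proof (cases "1 \<le> i \<and> i \<le> n")
        case True
        thus ?thesis using m.r_bounds[OF seg[of i]] m.r_range[OF seg[of i]] by (simp add: g_def)
      qed (use dual_pos in \<open>auto simp: g_def\<close>)
    qed
    have one: "Pr n (\<lambda>Y. reduced_betti Y (int n - int l - 1) \<noteq> 0)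
       \<le> exp (h n * ln (real n + 1) - real n powr c / 8) + exp ((z n)^2 - 2 * ln n)" if l: "l \<le> H" for l
    proof -
      let ?N = "real (n + 1)"
      define x where "x = ?N * cone_prob g 1 l"
      have lh: "real l \<le> h n" using l H by linarith
      have "A' * 2 ^ l \<le> A' * 2 powr (h n)"
        using lh dual_pos by (intro mult_left_mono) (auto simp flip: powr_realpow)
      also have "2 powr (h n) = ln n / A' * 2 powr (- \<delta>)"
        using elim(1) dual_pos(3) by (simp add: h_def powr_diff powr_minus divide_inverse)
      also have "A' * (ln n / A' * 2 powr (- \<delta>)) = (1 - c) * ln n"
        using dual_pos(3) by (simp add: c_def)
      finally have "exp (- ((1 - c) * ln n)) \<le> exp (- A' * 2 ^ l)" by simp
      also have "\<dots> \<le> cone_prob g 1 l" using hm.cone_bounds by simp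
      finally have cp: "real n powr (c - 1) \<le> cone_prob g 1 l" using n0 by (simp add: powr_def algebra_simps)
      have "real n powr c = real n * real n powr (c - 1)" using n0 by (simp add: powr_diff)
      also have "\<dots> \<le> x" unfolding x_def using cp n0 by (intro mult_mono) auto
      finally have x: "real n powr c \<le> x" .
      have n1: "1 \<le> real n" using n0 by simp
      have "1 \<le> real n powr c" using n1 c by (intro ge_one_powr_ge_zero) auto
      hence x1: "1 \<le> x" using x by linarith
      have "Pr n (\<lambda>Y. reduced_betti Y (int n - int l - 1) \<noteq> 0)
        \<le> ?N ^ l * exp (- x / 8) + ?N ^ l * (real (s + 1) ^ (2 * s + 2) * ?N * (4 * real l) ^ (2 * s) / x ^ s)"
        unfolding x_def
      proof (rule hm.prob_betti_ne_0)
        show "4 * l \<le> n + 1" "l + 2 \<le> n + 1" using lh elim(3) by linarith+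
      qed (use s0 x1 in \<open>auto simp: x_def\<close>)
      also have "?N ^ l * exp (- x / 8) \<le> exp (h n * ln (real n + 1) - real n powr c / 8)"
      proof -
        have "?N ^ l = exp (real l * ln ?N)" by (simp add: exp_of_nat_mult)
        hence "?N ^ l * exp (- x / 8) = exp (real l * ln ?N + - x / 8)" by (simp only: exp_add)
        also have "\<dots> = exp (real l * ln ?N - x / 8)" by simp
        also have "\<dots> \<le> exp (h n * ln (real n + 1) - real n powr c / 8)"
          using x lh mult_right_mono[OF lh, of "ln ?N"] by (simp add: add.commute)
        finally show ?thesis .
      qed
      also have "?N ^ l * (real (s + 1) ^ (2 * s + 2) * ?N * (4 * real l) ^ (2 * s) / x ^ s) \<le> exp ((z n)^2 - 2 * ln n)"
      proof -
        have ll: "l \<le> s" using l s0 by simp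
        have Z1: "1 \<le> Z" by (simp add: Z_def)
        have "real n ^ (H + 3) \<le> x ^ s"
        proof -
          have "real n ^ (H + 3) = real n powr real (H + 3)" using n0 by (rule powr_realpow[symmetric])
          also have "\<dots> \<le> real n powr (c * real s)"
          proof (rule powr_mono)
            have "1 * real (H + 3) \<le> (c * real \<kappa>) * real (H + 3)" using \<kappa>c by (intro mult_right_mono) auto
            thus "real (H + 3) \<le> c * real s" by (simp add: s_def mult.assoc)
            show "1 \<le> real n" using n0 by simp
          qed
          also have "\<dots> = (real n powr c) ^ s" using n0 by (simp add: powr_powr[symmetric] powr_realpow)
          also have "\<dots> \<le> x ^ s" using x by (intro power_mono) auto
          finally show ?thesis .
        qed
        \<comment> \<open>\<open>Z\<close> dominates each of 2, \<open>s + 1\<close> and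
          \<open>4 * l\<close>; the exponents \<open>s + 3\<close>, \<open>2 * s + 2\<close> and
          \<open>2 * s\<close> add up to \<open>5 * s + 5\<close>.\<close>
        moreover have "?N ^ l * (real (s + 1) ^ (2 * s + 2) * ?N * (4 * real l) ^ (2 * s)) \<le> real n ^ (H + 1) * Z ^ (5 * s + 5)"
        proof -
          have "?N ^ l * ?N = ?N ^ (l + 1)" by simp
          also have "\<dots> \<le> ?N ^ (H + 1)" using l by (intro power_increasing) auto
          also have "\<dots> \<le> (real n * 2) ^ (H + 1)" using n0 by (intro power_mono) auto
          also have "\<dots> = real n ^ (H + 1) * 2 ^ (H + 1)" by (rule power_mult_distrib)
          also have "\<dots> \<le> real n ^ (H + 1) * Z ^ (s + 3)"
          proof (intro mult_left_mono)
            have "(2::real) ^ (H + 1) \<le> Z ^ (H + 1)" by (intro power_mono) (auto simp: Z_def)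
            also have "\<dots> \<le> Z ^ (s + 3)" using s0 Z1 by (intro power_increasing) auto
            finally show "(2::real) ^ (H + 1) \<le> Z ^ (s + 3)" .
          qed auto
          finally have 1: "?N ^ l * ?N \<le> real n ^ (H + 1) * Z ^ (s + 3)" .
          have 2: "real (s + 1) ^ (2 * s + 2) \<le> Z ^ (2 * s + 2)" by (intro power_mono) (auto simp: Z_def)
          have 3: "(4 * real l) ^ (2 * s) \<le> Z ^ (2 * s)" using ll by (intro power_mono) (auto simp: Z_def)
          have "?N ^ l * (real (s + 1) ^ (2 * s + 2) * ?N * (4 * real l) ^ (2 * s)) = (?N ^ l * ?N) * (real (s + 1) ^ (2 * s + 2) * (4 * real l) ^ (2 * s))"
            by (simp only: mult_ac)
          also have "\<dots> \<le> (real n ^ (H + 1) * Z ^ (s + 3)) * (Z ^ (2 * s + 2) * Z ^ (2 * s))"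
            using Z1 by (intro mult_mono 1 2 3) auto
          also have "\<dots> = real n ^ (H + 1) * Z ^ (5 * s + 5)"
          proof -
            have "Z ^ (s + 3) * (Z ^ (2 * s + 2) * Z ^ (2 * s)) = Z ^ (5 * s + 5)"
              unfolding power_add[symmetric] by (rule arg_cong[of _ _ "(^) Z"]) simp
            thus ?thesis by (simp only: mult.assoc)
          qed
          finally show ?thesis .
        qed
        ultimately have "?N ^ l * (real (s + 1) ^ (2 * s + 2) * ?N * (4 * real l) ^ (2 * s)) / x ^ s
           \<le> real n ^ (H + 1) * Z ^ (5 * s + 5) / real n ^ (H + 3)"
          using n0 Z1 x1 by (intro frac_le) auto
        also have "\<dots> = Z ^ (5 * s + 5) / real n ^ 2"
          using n0 by (simp add: power_add field_simps power2_eq_square power3_eq_cube)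
        also have "Z ^ (5 * s + 5) \<le> exp ((z n)\<^sup>2)"
        proof -
          \<comment> \<open>The exponent equals \<open>Z\<close> itself, and
            \<open>Z * ln Z \<le> Z * Z\<close> is of order \<open>(ln ln n)^2\<close>, negligible
            against \<open>2 * ln n\<close>.\<close>
          have "Z ^ (5 * s + 5) = exp (real (5 * s + 5) * ln Z)" unfolding exp_of_nat_mult using Z1 by simp
          also have "real (5 * s + 5) * ln Z = Z * ln Z" by (simp add: Z_def)
          also have "\<dots> \<le> Z * Z" using Z1 ln_le_minus_one[of Z] by (intro mult_left_mono) auto
          also have "\<dots> \<le> (z n)\<^sup>2" unfolding power2_eq_square using \<open>Z \<le> z n\<close> Z1 by (intro mult_mono) auto
          finally show ?thesis by simp
        qed
        hence "Z ^ (5 * s + 5) / real n ^ 2 \<le> exp ((z n)\<^sup>2) / real n ^ 2" by (intro divide_right_mono) auto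
        also have "\<dots> = exp ((z n)\<^sup>2 - 2 * ln n)"
          using exp_of_nat_mult[of 2 "ln (real n)"] n0 by (simp add: exp_diff)
        finally show ?thesis by (simp add: mult.assoc)
      qed
      finally show ?thesis by simp
    qed
    have "Pr n (\<lambda>Y. \<exists>l. real l \<le> h n \<and> reduced_betti Y (int n - int l - 1) \<noteq> 0)
       \<le> prob (simps n) (missing_prob n) (\<lambda>G. \<exists>l\<in>{..H}. reduced_betti (upper_of n G) (int n - int l - 1) \<noteq> 0)"
      by (rule m.prob_mono) (use leH in blast)
    also have "\<dots> \<le> (\<Sum>l\<in>{..H}. Pr n (\<lambda>Y. reduced_betti Y (int n - int l - 1) \<noteq> 0))"
      by (rule m.prob_Bex) simp
    also have "\<dots> \<le> (\<Sum>l\<in>{..H}. exp (h n * ln (real n + 1) - real n powr c / 8) + exp ((z n)^2 - 2 * ln n))"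
      by (intro sum_mono one) auto
    also have "\<dots> = (real H + 1) * (exp (h n * ln (real n + 1) - real n powr c / 8) + exp ((z n)^2 - 2 * ln n))"
      by simp
    also have "\<dots> \<le> (h n + 1) * (exp (h n * ln (real n + 1) - real n powr c / 8) + exp ((z n)^2 - 2 * ln n))"
      using H by (intro mult_right_mono) auto
    finally show ?case by (simp only: distrib_left)
  qed
qed

lemma betti_tendsto:
  assumes hom: "\<And>n. homogeneous n (q n)" and \<epsilon>: "\<epsilon> > 0" and \<delta>: "\<delta> > 0"
  shows "(\<lambda>n. Pr n (\<lambda>Y. \<not> (\<forall>j::int. reduced_betti Y j \<noteq> 0 \<longrightarrow>
               log 2 (ln (real n)) - log 2 A' + 1 - \<delta> < real_of_int (int n - j)
             \<and> real_of_int (int n - j) \<le> beta n a' + 1 + \<epsilon>))) \<longlonglongrightarrow> 0"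
proof (rule Pr_disj_tendsto_0[OF defect_upper_tendsto[OF \<epsilon>] betti_low_tendsto[OF hom \<delta>]],
    rule always_eventually, intro allI impI)
  fix n G
  let ?Y = "upper_of n G"
  interpret complex_on "{0..n}" ?Y n by (rule complex_on_upper_of)
  assume "\<not> (\<forall>j::int. reduced_betti ?Y j \<noteq> 0 \<longrightarrow>
               log 2 (ln (real n)) - log 2 A' + 1 - \<delta> < real_of_int (int n - j)
             \<and> real_of_int (int n - j) \<le> beta n a' + 1 + \<epsilon>)"
  then obtain j where j: "reduced_betti ?Y j \<noteq> 0"
    "real_of_int (int n - j) \<le> log 2 (ln (real n)) - log 2 A' + 1 - \<delta> \<or> beta n a' + 1 + \<epsilon> < real_of_int (int n - j)"
    by (auto simp: not_less not_le)
  \<comment> \<open>This makes \<open>n - j - 1\<close> non-negative, so the \<open>l\<close> chosen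
    below with \<open>nat\<close> is exact.\<close>
  have jn: "j < int n" using j(1) reduced_betti_high[OF full_notin_upper_of] by (meson not_le)
  show "\<not> real_of_int (skel_defect n ?Y) \<le> beta n a' + 1 + \<epsilon> \<or>
     (\<exists>l. real l \<le> log 2 (ln (real n)) - log 2 A' - \<delta> \<and> reduced_betti ?Y (int n - int l - 1) \<noteq> 0)"
    using j(2)
  proof
    assume 1: "real_of_int (int n - j) \<le> log 2 (ln (real n)) - log 2 A' + 1 - \<delta>"
    let ?l = "nat (int n - j - 1)"
    have "int n - int ?l - 1 = j" "real ?l = real_of_int (int n - j) - 1" using jn by auto
    thus ?thesis using 1 j(1) by (intro disjI2 exI[of _ ?l]) auto
  next
    assume 2: "beta n a' + 1 + \<epsilon> < real_of_int (int n - j)"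
    \<comment> \<open>A non-zero Betti number forces \<open>n - j\<close> to be at most the skeleton
      defect, so the upper end of the range is that of the defect.\<close>
    have "reduced_betti ?Y j = 0" if "j < int n - skel_defect n ?Y"
      by (rule reduced_betti_skeleton[OF skeleton_skel_defect that])
    hence "int n - j \<le> skel_defect n ?Y" using j(1) by linarith
    hence "real_of_int (int n - j) \<le> real_of_int (skel_defect n ?Y)" by (simp only: of_int_le_iff)
    thus ?thesis using 2 by linarith
  qed
qed

end

theorem theorem3p2:
  fixes a A a' A' :: real
    and q :: "nat \<Rightarrow> nat set \<Rightarrow> real"
  assumes "0 < A" and "A \<le> a"
    and "exp (- a) + exp (- a') = 1"
    and "exp (- A) + exp (- A') = 1"
    and bounds: "\<And>n \<sigma>. \<sigma> \<in> simps n \<Longrightarrow> exp (- a) \<le> q n \<sigma> \<and> q n \<sigma> \<le> exp (- A)"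
  shows "((\<lambda>n. upper_prob n (q n) (\<lambda>Y. cdim Y = int n - 1)) \<longlonglongrightarrow> 1)
    \<and> (\<forall>\<epsilon>0 > 0.
           (\<lambda>n. upper_prob n (q n) (\<lambda>Y.
               real_of_int \<lfloor>beta n A'\<rfloor> + 1 \<le> real_of_int (skel_defect n Y)
             \<and> real_of_int (skel_defect n Y) \<le> beta n a' + 1 + \<epsilon>0)) \<longlonglongrightarrow> 1)
    \<and> ((\<forall>n. homogeneous n (q n)) \<longrightarrow> (\<forall>\<epsilon>0 > 0. \<forall>\<delta>0 > 0.
           (\<lambda>n. upper_prob n (q n) (\<lambda>Y. \<forall>j::int. reduced_betti Y j \<noteq> 0 \<longrightarrow>
               log 2 (ln (real n)) - log 2 A' + 1 - \<delta>0 < real_of_int (int n - j)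
             \<and> real_of_int (int n - j) \<le> beta n a' + 1 + \<epsilon>0)) \<longlonglongrightarrow> 1))"
proof -
  interpret upper_model a A a' A' q by unfold_locales (fact assms)+
  show ?thesis
  proof (intro conjI allI impI)
    show "(\<lambda>n. upper_prob n (q n) (\<lambda>Y. cdim Y = int n - 1)) \<longlonglongrightarrow> 1"
      using upper_prob_tendsto_1[OF cdim_tendsto] by simp
  next
    fix \<epsilon>0 :: real assume \<epsilon>: "\<epsilon>0 > 0"
    show "(\<lambda>n. upper_prob n (q n) (\<lambda>Y.
               real_of_int \<lfloor>beta n A'\<rfloor> + 1 \<le> real_of_int (skel_defect n Y)
             \<and> real_of_int (skel_defect n Y) \<le> beta n a' + 1 + \<epsilon>0)) \<longlonglongrightarrow> 1"
      by (rule upper_prob_tendsto_1, rule Pr_disj_tendsto_0[OF defect_lower_tendsto defect_upper_tendsto[OF \<epsilon>]])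
         auto
  next
    fix \<epsilon>0 \<delta>0 :: real assume "\<forall>n. homogeneous n (q n)" "\<epsilon>0 > 0" "\<delta>0 > 0"
    thus "(\<lambda>n. upper_prob n (q n) (\<lambda>Y. \<forall>j::int. reduced_betti Y j \<noteq> 0 \<longrightarrow>
               log 2 (ln (real n)) - log 2 A' + 1 - \<delta>0 < real_of_int (int n - j)
             \<and> real_of_int (int n - j) \<le> beta n a' + 1 + \<epsilon>0)) \<longlonglongrightarrow> 1"
      by (intro upper_prob_tendsto_1 betti_tendsto) auto
  qed
qed

end
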